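(* Let $(V,E)$ be a Bratteli diagram with infinite path space $X$ and tail equivalence relation $R$, and let $D\in Z^1(R,\mathbf{R}_+^* )$ be the quasi-product cocycle defined by a function $\Phi:E\to\mathbf{R}_+^*$. For $n\ge 1$, $v\in V(n-1)$ and $w\in V(n)$, let $A_n(w,v)=\sum\Phi(e)$, the sum being over all $e\in E(n)$ starting at $v$ and ending at $w$. Let $S_D(X)$ be the set of probability measures on $X$ which are quasi-invariant under $R$ and admit $D$ as Radon-Nikodym derivative. (i) Let $u_0=1$ and, for $n\ge1$ and $w\in V(n)$, let $u_n(w)=\sum_{v\in V(0)}(A_n A_{n-1}\cdots A_1)(w,v)$; for $n\ge 1$, $w\in V(n)$, $v\in V(n-1)$, let $B_n(w,v)=u_n(w)^{-1}A_n(w,v)u_{n-1}(v)$. Then $S_D(X)$ has exactly one element if and only if, for every fixed $m\ge 0$ and $v\in V(m)$, the variation (maximum minus minimum) of the function $w\in V(n)\mapsto (B_nB_{n-1}\cdots B_{m+1})(w,v)$ tends to $0$ as $n\to\infty$. (ii) Let $\epsilon_n$ be the ratio of the smallest entry of the matrix $A_n$ (indexed by $V(n)\times V(n-1)$) to its largest entry. If $\sum_n\epsilon_n=\infty$, then $S_D(X)$ has exactly one element.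
   Context: A Bratteli diagram $(V,E)$ consists of vertex sets $V(n)$, $n\ge 0$, and edge sets $E(n)$, $n\ge 1$, with source and range maps $s:E(n)\to V(n-1)$, $r:E(n)\to V(n)$ ($V,E$ are the disjoint unions). Standing assumptions: each $V(n)$ is finite, every vertex emits finitely many and at least one edge, and every vertex of level $n\ge 1$ receives at least one edge. $X$ is the compact space of infinite paths $x=x_1x_2\ldots$ ($x_k\in E(k)$, $r(x_k)=s(x_{k+1})$), with the cylinder sets as a basis of the topology. For $n\ge0$, $R_n=\{(x,y)\in X\times X: x_k=y_k \text{ for all } k>n\}$, with the relative product topology, and $R=\bigcup_n R_n$ is the tail equivalence relation, with the inductive limit topology ($W\subset R$ is open iff $W\cap R_n$ is open in $R_n$ for all $n$). $\mathbf{R}_+^*=(0,\infty)$. $Z^1(R,\mathbf{R}_+^* )$ is the set of continuous $D:R\to\mathbf{R}_+^*$ with $D(x,y)D(y,z)=D(x,z)$. The quasi-product cocycle defined by $\Phi$ is $$D(x,y)=\lim_{n\to\infty}\frac{\Phi(x_1)\cdots\Phi(x_n)}{\Phi(y_1)\cdots\Phi(y_n)}$$ (the sequence is eventually constant for $(x,y)\in R$). A probability measure $\mu$ on $X$ is quasi-invariant if the measures $f\mapsto\int\sum_{y:(x,y)\in R}f(x,y)\,d\mu(x)$ and $f\mapsto\int\sum_{x:(x,y)\in R}f(x,y)\,d\mu(y)$ ($f\in C_c(R)$) on $R$ are equivalent; its Radon-Nikodym derivative is the derivative of the first with respect to the second. Thus $\mu\in S_D(X)$ iff $\int\sum_{y}f(x,y)\,d\mu(x)=\int\sum_x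 f(x,y)D(x,y)\,d\mu(y)$ for all $f\in C_c(R)$. *)

theory Defs
  imports "HOL-Probability.Probability"
begin

record ('v, 'e) bratteli =
  verts :: "nat \<Rightarrow> 'v set"
  edges :: "nat \<Rightarrow> 'e set"
  src :: "'e \<Rightarrow> 'v"
  rng :: "'e \<Rightarrow> 'v"

(* The edges of level n are those of edges G n for n >= 1; edges G 0 plays no role.
   Level 0 is required to be nonempty, and then all levels are. *)
definition bratteli_diagram :: "('v, 'e) bratteli \<Rightarrow> bool" where
  "bratteli_diagram G \<longleftrightarrow>
     disjoint_family (verts G) \<and>
     disjoint_family_on (edges G) {1..} \<and>
     (\<forall>n\<ge>1. \<forall>e\<in>edges G n. src G e \<in> verts G (n - 1) \<and> rng G e \<in> verts G n) \<and>
     verts G 0 \<noteq> {} \<and>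
     (\<forall>n. finite (verts G n)) \<and>
     (\<forall>n. \<forall>v\<in>verts G n. finite {e \<in> edges G (Suc n). src G e = v}
                        \<and> {e \<in> edges G (Suc n). src G e = v} \<noteq> {}) \<and>
     (\<forall>n\<ge>1. \<forall>w\<in>verts G n. {e \<in> edges G n. rng G e = w} \<noteq> {})"

(* A path x = x_1 x_2 ... is a function on nat whose value at the unused index 0 is
   normalised to "undefined", so that equality of functions is equality of paths. *)
definition paths :: "('v, 'e) bratteli \<Rightarrow> (nat \<Rightarrow> 'e) set" where
  "paths G = {x \<in> \<Pi>\<^sub>E k\<in>{1..}. edges G k. \<forall>k\<ge>1. rng G (x k) = src G (x (Suc k))}"

definition cylinder :: "('v, 'e) bratteli \<Rightarrow> (nat \<Rightarrow> 'e) \<Rightarrow> nat \<Rightarrow> (nat \<Rightarrow> 'e) set" where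
  "cylinder G x n = {y \<in> paths G. \<forall>k\<in>{1..n}. y k = x k}"

definition path_topology :: "('v, 'e) bratteli \<Rightarrow> (nat \<Rightarrow> 'e) topology" where
  "path_topology G = topology_generated_by {cylinder G x n | x n. x \<in> paths G}"

lemma topspace_path_topology: "topspace (path_topology G) = paths G"
  by (auto simp: path_topology_def topology_generated_by_topspace cylinder_def)

definition tail_rel_upto :: "('v, 'e) bratteli \<Rightarrow> nat \<Rightarrow> ((nat \<Rightarrow> 'e) \<times> (nat \<Rightarrow> 'e)) set" where
  "tail_rel_upto G n = {(x, y). x \<in> paths G \<and> y \<in> paths G \<and> (\<forall>k>n. x k = y k)}"

definition tail_rel :: "('v, 'e) bratteli \<Rightarrow> ((nat \<Rightarrow> 'e) \<times> (nat \<Rightarrow> 'e)) set" where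
  "tail_rel G = (\<Union>n. tail_rel_upto G n)"

definition tail_topology_upto ::
    "('v, 'e) bratteli \<Rightarrow> nat \<Rightarrow> ((nat \<Rightarrow> 'e) \<times> (nat \<Rightarrow> 'e)) topology" where
  "tail_topology_upto G n =
     subtopology (prod_topology (path_topology G) (path_topology G)) (tail_rel_upto G n)"

definition tail_topology ::
    "('v, 'e) bratteli \<Rightarrow> ((nat \<Rightarrow> 'e) \<times> (nat \<Rightarrow> 'e)) topology" where
  "tail_topology G = topology (\<lambda>W. W \<subseteq> tail_rel G \<and>
     (\<forall>n. openin (tail_topology_upto G n) (W \<inter> tail_rel_upto G n)))"

lemma openin_tail_topology:
  "openin (tail_topology G) W \<longleftrightarrow>
     W \<subseteq> tail_rel G \<and> (\<forall>n. openin (tail_topology_upto G n) (W \<inter> tail_rel_upto G n))"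
proof -
  have "istopology (\<lambda>W. W \<subseteq> tail_rel G \<and>
     (\<forall>n. openin (tail_topology_upto G n) (W \<inter> tail_rel_upto G n)))"
    unfolding istopology_def
  proof (rule conjI; (rule allI)+; (rule impI)+)
    fix S T
    assume S: "S \<subseteq> tail_rel G \<and> (\<forall>n. openin (tail_topology_upto G n) (S \<inter> tail_rel_upto G n))"
      and T: "T \<subseteq> tail_rel G \<and> (\<forall>n. openin (tail_topology_upto G n) (T \<inter> tail_rel_upto G n))"
    have "openin (tail_topology_upto G n) (S \<inter> T \<inter> tail_rel_upto G n)" for n
    proof -
      have "S \<inter> T \<inter> tail_rel_upto G n = (S \<inter> tail_rel_upto G n) \<inter> (T \<inter> tail_rel_upto G n)"
        by (rule Int_assoc[THEN trans]) (simp only: Int_ac Int_absorb Int_left_absorb)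
      then show ?thesis
        using openin_Int[OF S[THEN conjunct2, rule_format, of n] T[THEN conjunct2, rule_format, of n]] by (simp only:)
    qed
    then show "S \<inter> T \<subseteq> tail_rel G \<and>
        (\<forall>n. openin (tail_topology_upto G n) (S \<inter> T \<inter> tail_rel_upto G n))"
      using le_infI1[OF S[THEN conjunct1]] by (intro conjI allI)
  next
    fix K
    assume K: "\<forall>S\<in>K. S \<subseteq> tail_rel G \<and>
      (\<forall>n. openin (tail_topology_upto G n) (S \<inter> tail_rel_upto G n))"
    have "openin (tail_topology_upto G n) (\<Union>K \<inter> tail_rel_upto G n)" for n
      unfolding Int_Union2 using K by (intro openin_Union) auto
    moreover have "\<Union>K \<subseteq> tail_rel G"
      using K by (intro Sup_least) simp
    ultimately show "\<Union>K \<subseteq> tail_rel G \<and>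
        (\<forall>n. openin (tail_topology_upto G n) (\<Union>K \<inter> tail_rel_upto G n))"
      by (intro conjI allI)
  qed
  then show ?thesis
    unfolding tail_topology_def by (simp only: topology_inverse')
qed

lemma topspace_tail_topology: "topspace (tail_topology G) = tail_rel G"
proof (rule antisym)
  show "topspace (tail_topology G) \<subseteq> tail_rel G"
    using openin_topspace[of "tail_topology G"] by (simp only: openin_tail_topology)
  have "openin (tail_topology_upto G n) (tail_rel_upto G n)" for n
  proof -
    have "topspace (tail_topology_upto G n) = tail_rel_upto G n"
      by (auto simp: tail_topology_upto_def topspace_path_topology tail_rel_upto_def)
    then show ?thesis
      using openin_topspace[of "tail_topology_upto G n"] by (simp only:)
  qed
  moreover have "tail_rel G \<inter> tail_rel_upto G n = tail_rel_upto G n" for n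
    by (auto simp: tail_rel_def)
  ultimately have "openin (tail_topology G) (tail_rel G)"
    by (simp add: openin_tail_topology)
  then show "tail_rel G \<subseteq> topspace (tail_topology G)"
    by (rule openin_subset)
qed

definition cocycles :: "('v, 'e) bratteli \<Rightarrow> ((nat \<Rightarrow> 'e) \<times> (nat \<Rightarrow> 'e) \<Rightarrow> real) set" where
  "cocycles G = {D. continuous_map (tail_topology G) (top_of_set {0<..}) D \<and>
     (\<forall>x y z. (x, y) \<in> tail_rel G \<longrightarrow> (y, z) \<in> tail_rel G \<longrightarrow> D (x, y) * D (y, z) = D (x, z))}"

definition quasi_product :: "('e \<Rightarrow> real) \<Rightarrow> (nat \<Rightarrow> 'e) \<times> (nat \<Rightarrow> 'e) \<Rightarrow> real" where
  "quasi_product \<Phi> = (\<lambda>(x, y). lim (\<lambda>n. (\<Prod>k=1..n. \<Phi> (x k)) / (\<Prod>k=1..n. \<Phi> (y k))))"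

definition tail_Cc :: "('v, 'e) bratteli \<Rightarrow> ((nat \<Rightarrow> 'e) \<times> (nat \<Rightarrow> 'e) \<Rightarrow> real) set" where
  "tail_Cc G = {f. continuous_map (tail_topology G) euclideanreal f \<and>
     compactin (tail_topology G) (tail_topology G closure_of {p \<in> tail_rel G. f p \<noteq> 0})}"

definition borel_on :: "'a topology \<Rightarrow> 'a measure" where
  "borel_on T = sigma (topspace T) {U. openin T U}"

definition first_functional ::
    "('v, 'e) bratteli \<Rightarrow> (nat \<Rightarrow> 'e) measure \<Rightarrow> ((nat \<Rightarrow> 'e) \<times> (nat \<Rightarrow> 'e) \<Rightarrow> real) \<Rightarrow> real" where
  "first_functional G \<mu> f = (\<integral>x. (\<Sum>\<^sub>\<infinity>y\<in>{y. (x, y) \<in> tail_rel G}. f (x, y)) \<partial>\<mu>)"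

definition second_functional ::
    "('v, 'e) bratteli \<Rightarrow> (nat \<Rightarrow> 'e) measure \<Rightarrow> ((nat \<Rightarrow> 'e) \<times> (nat \<Rightarrow> 'e) \<Rightarrow> real) \<Rightarrow> real" where
  "second_functional G \<mu> f = (\<integral>y. (\<Sum>\<^sub>\<infinity>x\<in>{x. (x, y) \<in> tail_rel G}. f (x, y)) \<partial>\<mu>)"

(* nu is the Borel measure on R given by the positive linear functional I on C_c(R).
   R is locally compact, sigma-compact and metrizable, so nu exists and is unique
   by the Riesz representation theorem. *)
definition represents ::
    "('v, 'e) bratteli \<Rightarrow> ((nat \<Rightarrow> 'e) \<times> (nat \<Rightarrow> 'e)) measure
      \<Rightarrow> (((nat \<Rightarrow> 'e) \<times> (nat \<Rightarrow> 'e) \<Rightarrow> real) \<Rightarrow> real) \<Rightarrow> bool" where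
  "represents G \<nu> I \<longleftrightarrow> sets \<nu> = sets (borel_on (tail_topology G)) \<and>
     (\<forall>f\<in>tail_Cc G. integrable \<nu> f \<and> integral\<^sup>L \<nu> f = I f)"

definition quasi_invariant :: "('v, 'e) bratteli \<Rightarrow> (nat \<Rightarrow> 'e) measure \<Rightarrow> bool" where
  "quasi_invariant G \<mu> \<longleftrightarrow>
     (\<exists>\<nu>\<^sub>1 \<nu>\<^sub>2. represents G \<nu>\<^sub>1 (first_functional G \<mu>) \<and> represents G \<nu>\<^sub>2 (second_functional G \<mu>) \<and>
        absolutely_continuous \<nu>\<^sub>1 \<nu>\<^sub>2 \<and> absolutely_continuous \<nu>\<^sub>2 \<nu>\<^sub>1)"

definition admits_RN_derivative ::
    "('v, 'e) bratteli \<Rightarrow> (nat \<Rightarrow> 'e) measure \<Rightarrow> ((nat \<Rightarrow> 'e) \<times> (nat \<Rightarrow> 'e) \<Rightarrow> real) \<Rightarrow> bool" where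
  "admits_RN_derivative G \<mu> D \<longleftrightarrow>
     (\<exists>\<nu>\<^sub>1 \<nu>\<^sub>2. represents G \<nu>\<^sub>1 (first_functional G \<mu>) \<and> represents G \<nu>\<^sub>2 (second_functional G \<mu>) \<and>
        \<nu>\<^sub>1 = density \<nu>\<^sub>2 (\<lambda>p. ennreal (D p)))"

definition SD :: "('v, 'e) bratteli \<Rightarrow> ((nat \<Rightarrow> 'e) \<times> (nat \<Rightarrow> 'e) \<Rightarrow> real)
    \<Rightarrow> (nat \<Rightarrow> 'e) measure set" where
  "SD G D = {\<mu>. prob_space \<mu> \<and> sets \<mu> = sets (borel_on (path_topology G)) \<and>
     quasi_invariant G \<mu> \<and> admits_RN_derivative G \<mu> D}"

definition Amat :: "('v, 'e) bratteli \<Rightarrow> ('e \<Rightarrow> real) \<Rightarrow> nat \<Rightarrow> 'v \<Rightarrow> 'v \<Rightarrow> real" where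
  "Amat G \<Phi> n w v = (\<Sum>e | e \<in> edges G n \<and> src G e = v \<and> rng G e = w. \<Phi> e)"

(* mat_prod G C m n = C_n C_(n-1) ... C_(m+1), indexed by V(n) x V(m); it is the identity
   for n = m and not meaningful for n < m. *)
primrec mat_prod :: "('v, 'e) bratteli \<Rightarrow> (nat \<Rightarrow> 'v \<Rightarrow> 'v \<Rightarrow> real) \<Rightarrow> nat \<Rightarrow> nat
    \<Rightarrow> 'v \<Rightarrow> 'v \<Rightarrow> real" where
  "mat_prod G C m 0 = (\<lambda>w v. if w = v then 1 else 0)"
| "mat_prod G C m (Suc n) =
     (if m \<le> n then (\<lambda>w v. \<Sum>t\<in>verts G n. C (Suc n) w t * mat_prod G C m n t v)
      else (\<lambda>w v. if w = v then 1 else 0))"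

definition uvec :: "('v, 'e) bratteli \<Rightarrow> ('e \<Rightarrow> real) \<Rightarrow> nat \<Rightarrow> 'v \<Rightarrow> real" where
  "uvec G \<Phi> n w = (if n = 0 then 1 else \<Sum>v\<in>verts G 0. mat_prod G (Amat G \<Phi>) 0 n w v)"

definition Bmat :: "('v, 'e) bratteli \<Rightarrow> ('e \<Rightarrow> real) \<Rightarrow> nat \<Rightarrow> 'v \<Rightarrow> 'v \<Rightarrow> real" where
  "Bmat G \<Phi> n w v = inverse (uvec G \<Phi> n w) * Amat G \<Phi> n w v * uvec G \<Phi> (n - 1) v"

definition variation_on :: "'a set \<Rightarrow> ('a \<Rightarrow> real) \<Rightarrow> real" where
  "variation_on S f = Max (f ` S) - Min (f ` S)"

definition entry_ratio :: "('v, 'e) bratteli \<Rightarrow> ('e \<Rightarrow> real) \<Rightarrow> nat \<Rightarrow> real" where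
  "entry_ratio G \<Phi> n =
     (let entries = (\<lambda>(w, v). Amat G \<Phi> n w v) ` (verts G n \<times> verts G (n - 1))
      in Min entries / Max entries)"

end

theory Submission
  imports Defs
begin

text \<open>
  Testing the Radon--Nikodym identity on the indicators of the compact open sets
  \<open>{(az, bz)}\<close>, where \<open>a\<close>, \<open>b\<close> are finite paths with the same range, turns membership in
  \<open>SD G D\<close> into the identity \<open>\<mu>(Z(a)) / \<Phi>(a) = \<mu>(Z(b)) / \<Phi>(b)\<close> for cylinders; conversely these sets
  form a countable intersection-stable basis of the topology of \<open>R\<close>, so the identity determines the
  two measures on \<open>R\<close>. Hence \<open>\<mu>(Z(a)) = \<Phi>(a) c\<^sub>n(r(a))\<close> with \<open>c\<^sub>n = c\<^sub>n\<^sub>+\<^sub>1 A\<^sub>n\<^sub>+\<^sub>1\<close>, and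
  \<open>p\<^sub>n = c\<^sub>n u\<^sub>n\<close> is a sequence of probability vectors with \<open>p\<^sub>n = p\<^sub>n\<^sub>+\<^sub>1 B\<^sub>n\<^sub>+\<^sub>1\<close>, where the \<open>B\<^sub>n\<close>
  are stochastic. Every such sequence comes from a measure, namely the law of a Markov chain of edges.
  So \<open>SD G D\<close> is an inverse limit of simplices. Two points of it differ at level \<open>m\<close> by at most the
  variation of the columns of \<open>B\<^sub>n \<dots> B\<^sub>m\<^sub>+\<^sub>1\<close>, while subsequential limits of the rows that attain the
  column maxima and minima are points that differ by exactly the limit of this variation.
  The second part is Doeblin's contraction estimate with factor \<open>1 - \<epsilon>\<^sub>n\<close>.
\<close>

section \<open>Paths and cylinders\<close>

text \<open>Membership in \<open>SD G D\<close> asks for two actual measures on the tail relation,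
  so beyond the cylinder identity these measures must be produced. Fibrewise counting is therefore
  realised explicitly: the class of a path is parametrised by a countable set of finite heads that
  does not depend on the path. The measure is then a push-forward of a product with counting
  measure, and the functionals become iterated integrals.

  The vector \<open>u n\<close> has a probabilistic meaning: \<open>u n w\<close> is the total
  weight of the finite paths from level 0 to \<open>w\<close>. Hence \<open>p n w\<close> is the
  probability of passing through \<open>w\<close>, and \<open>B\<close> holds the transition
  probabilities backwards in time, the same for every measure in \<open>SD G D\<close>. Uniqueness
  asks whether the law at level \<open>m\<close> forgets the vertex at a far level.

  Level 0 needs separate care: the cylinder of length 0 is the whole space and does not see the
  initial vertex, so \<open>c 0\<close> is recovered from level 1.

  Rows of \<open>B\<close> average, so column extrema are monotone in the level; they converge, and
  a subsequence keeps their limits.\<close>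

lemma space_borel_on: "space (borel_on T) = topspace T"
  unfolding borel_on_def by (rule space_measure_of) (auto dest: openin_subset)

lemma sets_borel_on: "sets (borel_on T) = sigma_sets (topspace T) {U. openin T U}"
  unfolding borel_on_def by (rule sets_measure_of) (auto dest: openin_subset)

lemma openin_borel_on: "openin T U \<Longrightarrow> U \<in> sets (borel_on T)"
  unfolding sets_borel_on by auto

text \<open>Countability of the basis is what matters: an open set is then a countable union of
  basic sets. Applied to cylinders and to tubes, this lets measures be compared on them.\<close>

lemma sets_borel_on_basis:
  assumes B: "countable B" "\<And>b. b \<in> B \<Longrightarrow> openin T b"
    and U: "\<And>U x. openin T U \<Longrightarrow> x \<in> U \<Longrightarrow> \<exists>b\<in>B. x \<in> b \<and> b \<subseteq> U"
  shows "sets (borel_on T) = sigma_sets (topspace T) B"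
  unfolding sets_borel_on
proof (rule sigma_sets_eqI)
  fix a assume "a \<in> {U. openin T U}"
  then have "a = \<Union>{b \<in> B. b \<subseteq> a}"
    using U by blast
  moreover have "\<Union>{b \<in> B. b \<subseteq> a} \<in> sigma_sets (topspace T) B"
    by (rule sigma_sets_UNION) (use B(1) in \<open>auto intro: countable_subset[of _ B]\<close>)
  ultimately show "a \<in> sigma_sets (topspace T) B" by simp
next
  fix b assume "b \<in> B"
  then show "b \<in> sigma_sets (topspace T) {U. openin T U}" using B(2) by auto
qed

locale bratteli =
  fixes G :: "('v, 'e) bratteli"
  assumes diagram: "bratteli_diagram G"
begin

lemma edge_src: "e \<in> edges G (Suc n) \<Longrightarrow> src G e \<in> verts G n"
  and edge_rng: "e \<in> edges G (Suc n) \<Longrightarrow> rng G e \<in> verts G (Suc n)"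
  using diagram unfolding bratteli_diagram_def by (metis Suc_eq_plus1 add_diff_cancel_right' le_add2)+

lemma finite_verts: "finite (verts G n)"
  using diagram unfolding bratteli_diagram_def by blast

lemma edge_from: "v \<in> verts G n \<Longrightarrow> \<exists>e\<in>edges G (Suc n). src G e = v"
  using diagram unfolding bratteli_diagram_def by blast

lemma edge_to: "w \<in> verts G (Suc n) \<Longrightarrow> \<exists>e\<in>edges G (Suc n). rng G e = w"
  using diagram unfolding bratteli_diagram_def by fastforce

lemma verts_nonempty: "verts G n \<noteq> {}"
proof (induction n)
  case 0
  then show ?case using diagram unfolding bratteli_diagram_def by blast
next
  case (Suc n)
  then show ?case using edge_from edge_rng by blast
qed

lemma finite_edges: "finite (edges G (Suc n))"
proof -
  have "edges G (Suc n) = (\<Union>v\<in>verts G n. {e \<in> edges G (Suc n). src G e = v})"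
    using edge_src by auto
  moreover have "finite (\<Union>v\<in>verts G n. {e \<in> edges G (Suc n). src G e = v})"
    using diagram finite_verts unfolding bratteli_diagram_def by blast
  ultimately show ?thesis by simp
qed

lemma finite_edges': "1 \<le> k \<Longrightarrow> finite (edges G k)"
  using finite_edges[of "k - 1"] by simp

section \<open>Paths as edge sequences, and extension of finite paths\<close>

lemma paths_iff:
  "x \<in> paths G \<longleftrightarrow> x 0 = undefined \<and> (\<forall>k. x (Suc k) \<in> edges G (Suc k) \<and> rng G (x (Suc k)) = src G (x (Suc (Suc k))))"
proof
  assume x: "x \<in> paths G"
  then have "x 0 = undefined"
    by (auto simp: paths_def PiE_def extensional_def)
  with x show "x 0 = undefined \<and> (\<forall>k. x (Suc k) \<in> edges G (Suc k) \<and> rng G (x (Suc k)) = src G (x (Suc (Suc k))))"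
    by (auto simp: paths_def PiE_def)
next
  assume x: "x 0 = undefined \<and> (\<forall>k. x (Suc k) \<in> edges G (Suc k) \<and> rng G (x (Suc k)) = src G (x (Suc (Suc k))))"
  have "x k \<in> edges G k \<and> rng G (x k) = src G (x (Suc k))" if "k \<ge> 1" for k
    using x that by (cases k) auto
  moreover have "x k = undefined" if "k \<notin> {1..}" for k
    using that x by (cases k) auto
  ultimately show "x \<in> paths G"
    by (auto simp: paths_def PiE_def extensional_def)
qed

lemma path_0: "x \<in> paths G \<Longrightarrow> x 0 = undefined"
  and path_edge: "x \<in> paths G \<Longrightarrow> x (Suc k) \<in> edges G (Suc k)"
  and path_link: "x \<in> paths G \<Longrightarrow> src G (x (Suc (Suc k))) = rng G (x (Suc k))"
  by (simp_all add: paths_iff)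

lemma path_edge': "x \<in> paths G \<Longrightarrow> 1 \<le> k \<Longrightarrow> x k \<in> edges G k"
  by (auto simp: paths_def PiE_def)

lemma path_link': "x \<in> paths G \<Longrightarrow> 1 \<le> k \<Longrightarrow> src G (x (Suc k)) = rng G (x k)"
  by (auto simp: paths_def PiE_def)

lemma path_eqI: "x \<in> paths G \<Longrightarrow> y \<in> paths G \<Longrightarrow> (\<And>k. k \<ge> 1 \<Longrightarrow> x k = y k) \<Longrightarrow> x = y"
proof (rule ext)
  fix k assume *: "x \<in> paths G" "y \<in> paths G" "\<And>k. k \<ge> 1 \<Longrightarrow> x k = y k"
  show "x k = y k" using * path_0[of x] path_0[of y] by (cases k) auto
qed

text \<open>Dependent choice along the rule that every vertex emits an edge. Only indices above
  \<open>n\<close> are constrained, so that any head ending at \<open>src G e\<close> can be glued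
  in front.\<close>

lemma tail_path:
  assumes "e \<in> edges G (Suc n)"
  shows "\<exists>z. z (Suc n) = e \<and> (\<forall>k\<ge>n. z (Suc k) \<in> edges G (Suc k) \<and> rng G (z (Suc k)) = src G (z (Suc (Suc k))))"
proof -
  have "\<exists>f. \<forall>k. (f k \<in> edges G (Suc (n + k)) \<and> (k = 0 \<longrightarrow> f k = e)) \<and> rng G (f k) = src G (f (Suc k))"
  proof (rule dependent_nat_choice)
    show "\<exists>x. x \<in> edges G (Suc (n + 0)) \<and> (0 = 0 \<longrightarrow> x = e)" using assms by simp
  next
    fix x k assume "x \<in> edges G (Suc (n + k)) \<and> (k = 0 \<longrightarrow> x = e)"
    then have "rng G x \<in> verts G (Suc (n + k))" using edge_rng by blast
    then obtain y where "y \<in> edges G (Suc (Suc (n + k)))" "src G y = rng G x" using edge_from by blast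
    then show "\<exists>y. (y \<in> edges G (Suc (n + Suc k)) \<and> (Suc k = 0 \<longrightarrow> y = e)) \<and> rng G x = src G y"
      by auto
  qed
  then obtain f where f: "\<And>k. f k \<in> edges G (Suc (n + k))" "f 0 = e" "\<And>k. rng G (f k) = src G (f (Suc k))"
    by blast
  have "f (k - n) \<in> edges G (Suc k) \<and> rng G (f (k - n)) = src G (f (Suc k - n))" if "k \<ge> n" for k
    using f(1)[of "k - n"] f(3)[of "k - n"] that by (simp add: Suc_diff_le)
  then show ?thesis
    using f(2) by (intro exI[of _ "\<lambda>j. f (j - Suc n)"]) auto
qed

lemma first_edge_extends:
  assumes "e \<in> edges G (Suc 0)"
  shows "\<exists>x\<in>paths G. x (Suc 0) = e"
proof -
  obtain z where "z (Suc 0) = e" "\<And>k. z (Suc k) \<in> edges G (Suc k) \<and> rng G (z (Suc k)) = src G (z (Suc (Suc k)))"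
    using tail_path[OF assms] by auto
  then show ?thesis
    by (intro bexI[of _ "z(0 := undefined)"]) (auto simp: paths_iff)
qed

lemma path_extends:
  assumes x: "x \<in> paths G" and n: "1 \<le> n" and e: "e \<in> edges G (Suc n)" "src G e = rng G (x n)"
  shows "\<exists>y\<in>cylinder G x n. y (Suc n) = e"
proof -
  obtain z where z: "z (Suc n) = e" "\<And>k. k \<ge> n \<Longrightarrow> z (Suc k) \<in> edges G (Suc k) \<and> rng G (z (Suc k)) = src G (z (Suc (Suc k)))"
    using tail_path[OF e(1)] by blast
  define y where "y k = (if k \<le> n then x k else z k)" for k
  have "y (Suc k) \<in> edges G (Suc k) \<and> rng G (y (Suc k)) = src G (y (Suc (Suc k)))" for k
    using z(2)[of k] path_edge[OF x, of k] path_link[OF x, of k] z(1) e(2)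
    by (cases "Suc k < n"; cases "Suc k = n") (auto simp: y_def)
  then have "y \<in> paths G"
    using path_0[OF x] by (auto simp: paths_iff y_def)
  then show ?thesis
    using z(1) by (intro bexI[of _ y]) (auto simp: cylinder_def y_def)
qed

text \<open>An incoming edge at the source of \<open>e\<close> reduces to the previous level;
  \<open>path_extends\<close> then replaces the tail of the path found there by one that starts with
  \<open>e\<close>.\<close>

lemma edge_on_path: "e \<in> edges G (Suc n) \<Longrightarrow> \<exists>x\<in>paths G. x (Suc n) = e"
proof (induction n arbitrary: e)
  case 0
  then show ?case by (rule first_edge_extends)
next
  case (Suc n)
  from Suc.prems have "src G e \<in> verts G (Suc n)" by (rule edge_src)
  then obtain e' where e': "e' \<in> edges G (Suc n)" "rng G e' = src G e" using edge_to by blast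
  then obtain x where "x \<in> paths G" "x (Suc n) = e'" using Suc.IH by blast
  then show ?case
    using path_extends[of x "Suc n" e] Suc.prems e'(2) by (auto simp: cylinder_def)
qed

lemma vertex_on_path:
  assumes "v \<in> verts G n" shows "\<exists>x\<in>paths G. src G (x (Suc n)) = v"
  using edge_from[OF assms] edge_on_path by blast

section \<open>Cylinders, their topology and their Borel sets\<close>

lemma cylinder_self: "x \<in> paths G \<Longrightarrow> x \<in> cylinder G x n"
  by (simp add: cylinder_def)

lemma cylinder_subset: "cylinder G x n \<subseteq> paths G"
  by (auto simp: cylinder_def)

lemma cylinder_0: "cylinder G x 0 = paths G"
  by (auto simp: cylinder_def)

lemma cylinder_mono: "m \<le> n \<Longrightarrow> cylinder G x n \<subseteq> cylinder G x m"
  by (auto simp: cylinder_def)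

lemma cylinder_eq: "y \<in> cylinder G x n \<Longrightarrow> m \<le> n \<Longrightarrow> cylinder G y m = cylinder G x m"
  by (auto simp: cylinder_def)

lemma cylinder_cong: "(\<And>k. 1 \<le> k \<Longrightarrow> k \<le> n \<Longrightarrow> x k = y k) \<Longrightarrow> cylinder G x n = cylinder G y n"
  by (auto simp: cylinder_def)

lemma countable_cylinders: "countable {cylinder G x n | x n. x \<in> paths G}"
proof -
  have "cylinder G x n \<in> (\<lambda>b. cylinder G b n) ` (\<Pi>\<^sub>E k\<in>{1..n}. edges G k)" if "x \<in> paths G" for x n
  proof
    show "cylinder G x n = cylinder G (restrict x {1..n}) n"
      by (rule cylinder_cong) auto
    show "restrict x {1..n} \<in> (\<Pi>\<^sub>E k\<in>{1..n}. edges G k)"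
      using path_edge'[OF that] by auto
  qed
  then have "{cylinder G x n | x n. x \<in> paths G} \<subseteq> (\<Union>n. (\<lambda>b. cylinder G b n) ` (\<Pi>\<^sub>E k\<in>{1..n}. edges G k))"
    by (smt (verit, ccfv_threshold) UNIV_I UN_I mem_Collect_eq subsetI)
  moreover have "countable (\<Union>n. (\<lambda>b. cylinder G b n) ` (\<Pi>\<^sub>E k\<in>{1..n}. edges G k))"
    by (rule countable_UN) (auto intro!: countable_finite finite_PiE finite_edges')
  ultimately show ?thesis by (rule countable_subset)
qed

text \<open>Every point of a cylinder generates it, so the cylinders around a point form a
  decreasing neighbourhood base, and an intersection costs only a maximum of lengths.\<close>

lemma openin_path_topology:
  "openin (path_topology G) U \<longleftrightarrow> U \<subseteq> paths G \<and> (\<forall>x\<in>U. \<exists>n. cylinder G x n \<subseteq> U)"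
proof
  assume "openin (path_topology G) U"
  then have "generate_topology_on {cylinder G x n | x n. x \<in> paths G} U"
    by (simp add: path_topology_def openin_topology_generated_by)
  then show "U \<subseteq> paths G \<and> (\<forall>x\<in>U. \<exists>n. cylinder G x n \<subseteq> U)"
  proof (induction rule: generate_topology_on.induct)
    case Empty
    then show ?case by simp
  next
    case (Int a b)
    have "\<exists>n. cylinder G x n \<subseteq> a \<inter> b" if x: "x \<in> a \<inter> b" for x
    proof -
      obtain m n where "cylinder G x m \<subseteq> a" "cylinder G x n \<subseteq> b"
        using Int x by blast
      then show ?thesis
        using cylinder_mono[of m "max m n" x] cylinder_mono[of n "max m n" x] by (intro exI[of _ "max m n"]) auto
    qed
    with Int show ?case by blast
  next
    case (UN K)
    then show ?case by (meson Sup_least Union_iff Union_upper order_trans)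
  next
    case (Basis s)
    then show ?case
      using cylinder_eq cylinder_subset by blast
  qed
next
  assume U: "U \<subseteq> paths G \<and> (\<forall>x\<in>U. \<exists>n. cylinder G x n \<subseteq> U)"
  have "openin (path_topology G) (\<Union>{cylinder G x n | x n. x \<in> paths G \<and> cylinder G x n \<subseteq> U})"
    by (intro openin_Union) (auto simp: path_topology_def intro!: topology_generated_by_Basis)
  also have "\<Union>{cylinder G x n | x n. x \<in> paths G \<and> cylinder G x n \<subseteq> U} = U"
    using U cylinder_self by blast
  finally show "openin (path_topology G) U" .
qed

lemma openin_cylinder: "openin (path_topology G) (cylinder G x n)"
  unfolding openin_path_topology using cylinder_eq cylinder_subset by blast

lemma openin_pathI:
  assumes "U \<subseteq> paths G" "\<And>x. x \<in> U \<Longrightarrow> cylinder G x n \<subseteq> U"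
  shows "openin (path_topology G) U"
  using assms unfolding openin_path_topology by blast

abbreviation path_borel :: "(nat \<Rightarrow> 'e) measure" where
  "path_borel \<equiv> borel_on (path_topology G)"

lemma space_path_borel: "space path_borel = paths G"
  by (simp add: space_borel_on topspace_path_topology)

lemma sets_path_borel: "sets path_borel = sigma_sets (paths G) {cylinder G x n | x n. x \<in> paths G}"
proof -
  have "sets path_borel = sigma_sets (topspace (path_topology G)) {cylinder G x n | x n. x \<in> paths G}"
  proof (rule sets_borel_on_basis)
    fix U x assume "openin (path_topology G) U" "x \<in> U"
    then show "\<exists>b\<in>{cylinder G x n | x n. x \<in> paths G}. x \<in> b \<and> b \<subseteq> U"
      unfolding openin_path_topology using cylinder_self by blast
  qed (use countable_cylinders openin_cylinder in auto)
  then show ?thesis by (simp add: topspace_path_topology)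
qed

lemma cylinder_sets: "cylinder G x n \<in> sets path_borel"
  by (intro openin_borel_on openin_cylinder)

text \<open>The product of the finite discrete edge sets is compact, and paths are cut out by
  conditions on adjacent coordinates, each a finite union of closed boxes. The identity into
  \<open>path_topology\<close> is continuous because a cylinder is a finite intersection of
  coordinate conditions, so compactness carries over.\<close>

lemma compact_space_path_topology: "compact_space (path_topology G)"
proof -
  let ?P = "product_topology (\<lambda>k. discrete_topology (edges G k)) {1..}"
  have top: "topspace ?P = (\<Pi>\<^sub>E k\<in>{1..}. edges G k)" by simp
  have coord: "continuous_map ?P (discrete_topology (edges G k)) (\<lambda>x. x k)" if "1 \<le> k" for k
    using that by (intro continuous_map_product_projection) auto
  have "compact_space ?P"
    by (auto simp: compact_space_product_topology compact_space_discrete_topology finite_edges')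
  moreover have "closedin ?P (paths G)"
  proof -
    have "closedin ?P {x \<in> topspace ?P. rng G (x k) = src G (x (Suc k))}" if "1 \<le> k" for k
    proof -
      have "{x \<in> topspace ?P. rng G (x k) = src G (x (Suc k))} =
        (\<Union>(a, b)\<in>{(a, b). (a, b) \<in> edges G k \<times> edges G (Suc k) \<and> rng G a = src G b}. {x \<in> topspace ?P. x k \<in> {a}} \<inter> {x \<in> topspace ?P. x (Suc k) \<in> {b}})"
        using that by (auto simp: PiE_def Pi_def)
      moreover have "closedin ?P \<dots>"
      proof (rule closedin_Union)
        have "finite {(a, b). (a, b) \<in> edges G k \<times> edges G (Suc k) \<and> rng G a = src G b}"
          by (rule finite_subset[of _ "edges G k \<times> edges G (Suc k)"]) (use that in \<open>auto simp: finite_edges finite_edges'\<close>)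
        then show "finite ((\<lambda>(a, b). {x \<in> topspace ?P. x k \<in> {a}} \<inter> {x \<in> topspace ?P. x (Suc k) \<in> {b}}) `
           {(a, b). (a, b) \<in> edges G k \<times> edges G (Suc k) \<and> rng G a = src G b})" by simp
      next
        fix S assume "S \<in> (\<lambda>(a, b). {x \<in> topspace ?P. x k \<in> {a}} \<inter> {x \<in> topspace ?P. x (Suc k) \<in> {b}}) `
           {(a, b). (a, b) \<in> edges G k \<times> edges G (Suc k) \<and> rng G a = src G b}"
        then obtain a b where S: "S = {x \<in> topspace ?P. x k \<in> {a}} \<inter> {x \<in> topspace ?P. x (Suc k) \<in> {b}}"
           "a \<in> edges G k" "b \<in> edges G (Suc k)" by auto
        show "closedin ?P S" unfolding S(1)
          by (intro closedin_Int closedin_continuous_map_preimage[OF coord]) (use that S in auto)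
      qed
      ultimately show ?thesis by simp
    qed
    then have "closedin ?P (\<Inter>k\<in>{1..}. {x \<in> topspace ?P. rng G (x k) = src G (x (Suc k))})"
      by (intro closedin_Inter) auto
    also have "(\<Inter>k\<in>{1..}. {x \<in> topspace ?P. rng G (x k) = src G (x (Suc k))}) = paths G"
      by (force simp: paths_def)
    finally show ?thesis .
  qed
  ultimately have "compactin ?P (paths G)"
    by (rule closedin_compact_space)
  then have "compact_space (subtopology ?P (paths G))"
    by (simp add: compact_space_subtopology)
  moreover have "continuous_map (subtopology ?P (paths G)) (path_topology G) id"
    unfolding path_topology_def
  proof (rule continuous_on_generated_topo)
    fix U assume "U \<in> {cylinder G x n | x n. x \<in> paths G}"
    then obtain x n where U: "U = cylinder G x n" "x \<in> paths G" by auto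
    have "openin ?P {y \<in> topspace ?P. y k \<in> {x k}}" if "k \<in> {1..n}" for k
      using that path_edge'[OF U(2), of k] by (intro openin_continuous_map_preimage[OF coord]) auto
    then have "openin ?P ((\<Inter>k\<in>{1..n}. {y \<in> topspace ?P. y k \<in> {x k}}) \<inter> topspace ?P)"
      by (intro openin_INT) auto
    then have "openin ?P (topspace ?P \<inter> (\<Inter>k\<in>{1..n}. {y \<in> topspace ?P. y k \<in> {x k}}))"
      by (simp only: Int_commute)
    then have "openin (subtopology ?P (paths G)) (paths G \<inter> (topspace ?P \<inter> (\<Inter>k\<in>{1..n}. {y \<in> topspace ?P. y k \<in> {x k}})))"
      by (auto simp: openin_subtopology)
    moreover have "id -` U \<inter> topspace (subtopology ?P (paths G)) = paths G \<inter> (topspace ?P \<inter> (\<Inter>k\<in>{1..n}. {y \<in> topspace ?P. y k \<in> {x k}}))"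
      by (auto simp: U cylinder_def)
    ultimately show "openin (subtopology ?P (paths G)) (id -` U \<inter> topspace (subtopology ?P (paths G)))"
      by simp
  next
    have "topspace (subtopology ?P (paths G)) = paths G"
      by (auto simp: paths_def)
    moreover have "x \<in> \<Union> {cylinder G x n |x n. x \<in> paths G}" if "x \<in> paths G" for x
      using cylinder_self[OF that, of 0] that by (intro UnionI[of "cylinder G x 0"]) auto
    ultimately show "id ` topspace (subtopology ?P (paths G)) \<subseteq> \<Union> {cylinder G x n |x n. x \<in> paths G}"
      unfolding id_def image_ident by (intro subsetI) (simp only:)
  qed
  ultimately have "compactin (path_topology G) (id ` topspace (subtopology ?P (paths G)))"
    using image_compactin compact_space_def by blast
  moreover have "topspace (subtopology ?P (paths G)) = paths G"
    by (auto simp: paths_def)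
  ultimately show ?thesis
    by (simp add: compact_space_def topspace_path_topology)
qed

end

section \<open>The topology of the tail relation\<close>

text \<open>If \<open>(s, t)\<close> lies in \<open>R_n\<close>, this is the graph of the
  homeomorphism \<open>az \<mapsto> bz\<close>, where \<open>a\<close> and \<open>b\<close> are the
  first \<open>n\<close> edges of \<open>s\<close> and \<open>t\<close>: a compact open bisection of
  the groupoid \<open>R\<close>. For \<open>n = 0\<close> it is the diagonal.\<close>

definition tube :: "('v, 'e) bratteli \<Rightarrow> (nat \<Rightarrow> 'e) \<Rightarrow> (nat \<Rightarrow> 'e) \<Rightarrow> nat \<Rightarrow> ((nat \<Rightarrow> 'e) \<times> (nat \<Rightarrow> 'e)) set" where
  "tube G s t n = {(x, y). x \<in> cylinder G s n \<and> y \<in> cylinder G t n \<and> (\<forall>k>n. x k = y k)}"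

text \<open>Index 0 is left to \<open>x\<close>, so that splicing preserves the normalisation of
  paths there.\<close>

definition splice :: "nat \<Rightarrow> (nat \<Rightarrow> 'e) \<Rightarrow> (nat \<Rightarrow> 'e) \<Rightarrow> nat \<Rightarrow> 'e" where
  "splice n b x k = (if 1 \<le> k \<and> k \<le> n then b k else x k)"

lemma measurable_continuous_map_real:
  assumes "continuous_map T euclideanreal f"
  shows "f \<in> borel_measurable (borel_on T)"
proof (rule borel_measurableI)
  fix S :: "real set" assume "open S"
  then have "openin T {x \<in> topspace T. f x \<in> S}"
    by (intro openin_continuous_map_preimage[OF assms]) auto
  moreover have "f -` S \<inter> space (borel_on T) = {x \<in> topspace T. f x \<in> S}"
    by (auto simp: space_borel_on)
  ultimately show "f -` S \<inter> space (borel_on T) \<in> sets (borel_on T)"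
    by (simp add: openin_borel_on)
qed

lemma continuous_map_indicator:
  assumes "openin T W" "closedin T W"
  shows "continuous_map T euclideanreal (indicator W)"
  unfolding continuous_map_def
proof (intro conjI allI impI)
  fix U :: "real set"
  have "openin T (topspace T - W)" using assms(2) by (simp add: closedin_def)
  moreover have "W \<subseteq> topspace T" using assms(1) by (rule openin_subset)
  then have "{x \<in> topspace T. indicator W x \<in> U} =
    (if 1 \<in> U then W else {}) \<union> (if 0 \<in> U then topspace T - W else {})"
    by (auto simp: indicator_def)
  ultimately show "openin T {x \<in> topspace T. indicator W x \<in> U}"
    using assms(1) by (auto intro!: openin_Un)
qed auto

context bratteli
begin

lemma in_tail_rel_upto: "(x, y) \<in> tail_rel_upto G n \<longleftrightarrow> x \<in> paths G \<and> y \<in> paths G \<and> (\<forall>k>n. x k = y k)"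
  by (simp add: tail_rel_upto_def)

lemma tail_rel_upto_mono: "m \<le> n \<Longrightarrow> tail_rel_upto G m \<subseteq> tail_rel_upto G n"
  by (auto simp: tail_rel_upto_def)

lemma tail_rel_upto_subset: "tail_rel_upto G n \<subseteq> tail_rel G"
  by (auto simp: tail_rel_def)

lemma in_tail_rel: "p \<in> tail_rel G \<longleftrightarrow> (\<exists>n. p \<in> tail_rel_upto G n)"
  by (auto simp: tail_rel_def)

lemma tail_rel_upto_sym: "(x, y) \<in> tail_rel_upto G n \<longleftrightarrow> (y, x) \<in> tail_rel_upto G n"
  by (auto simp: tail_rel_upto_def)

lemma tail_rel_sym: "(x, y) \<in> tail_rel G \<longleftrightarrow> (y, x) \<in> tail_rel G"
  using tail_rel_upto_sym by (auto simp: tail_rel_def)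

lemma tail_rel_upto_rng:
  assumes "(x, y) \<in> tail_rel_upto G n" "1 \<le> n" shows "rng G (x n) = rng G (y n)"
  using assms path_link'[of x n] path_link'[of y n] by (auto simp: in_tail_rel_upto)

lemma splice_path:
  assumes b: "b \<in> paths G" and x: "x \<in> paths G" and "n = 0 \<or> rng G (b n) = rng G (x n)"
  shows "splice n b x \<in> paths G"
proof -
  have "splice n b x (Suc k) \<in> edges G (Suc k) \<and> rng G (splice n b x (Suc k)) = src G (splice n b x (Suc (Suc k)))" for k
    using assms(3) path_edge[OF b] path_edge[OF x] path_link[OF b, of k] path_link[OF x, of k]
    by (cases "Suc k < n"; cases "Suc k = n") (auto simp: splice_def)
  then show ?thesis
    using path_0[OF x] by (auto simp: paths_iff splice_def)
qed

lemma tube_subset: "tube G s t n \<subseteq> tail_rel_upto G n"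
  by (auto simp: tube_def tail_rel_upto_def cylinder_def)

lemma tube_self: "(x, y) \<in> tail_rel_upto G n \<Longrightarrow> (x, y) \<in> tube G x y n"
  by (auto simp: tube_def tail_rel_upto_def cylinder_def)

lemma tube_eq: "(x, y) \<in> tube G s t n \<Longrightarrow> tube G x y n = tube G s t n"
  using cylinder_eq[of x s n n] cylinder_eq[of y t n n] by (auto simp: tube_def)

text \<open>A pair in the deeper tube copies \<open>x\<close> and \<open>y\<close> between
  \<open>n\<close> and \<open>N\<close>, where these already agree by hypothesis.\<close>

lemma tube_refine:
  assumes "(x, y) \<in> tail_rel_upto G n" "n \<le> N"
  shows "tube G x y N \<subseteq> tube G x y n"
proof -
  have "a k = b k" if "(a, b) \<in> tube G x y N" "k > n" for a b k
    using that assms by (cases "k \<le> N") (auto simp: tube_def in_tail_rel_upto cylinder_def)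
  then show ?thesis
    using assms(2) cylinder_mono[of n N x] cylinder_mono[of n N y] by (auto simp: tube_def)
qed

lemma openin_tail_topology_upto:
  "openin (tail_topology_upto G m) U \<longleftrightarrow> U \<subseteq> tail_rel_upto G m \<and>
     (\<forall>(x, y)\<in>U. \<exists>N. (cylinder G x N \<times> cylinder G y N) \<inter> tail_rel_upto G m \<subseteq> U)"
proof
  assume "openin (tail_topology_upto G m) U"
  then obtain T where T: "openin (prod_topology (path_topology G) (path_topology G)) T" "U = T \<inter> tail_rel_upto G m"
    by (auto simp: tail_topology_upto_def openin_subtopology)
  have "\<exists>N. (cylinder G x N \<times> cylinder G y N) \<inter> tail_rel_upto G m \<subseteq> U" if "(x, y) \<in> U" for x y
  proof -
    have "(x, y) \<in> T" using T(2) that by simp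
    then obtain A B where AB: "openin (path_topology G) A" "openin (path_topology G) B" "x \<in> A" "y \<in> B" "A \<times> B \<subseteq> T"
      using T(1)[unfolded openin_prod_topology_alt] by metis
    obtain M where M: "cylinder G x M \<subseteq> A"
      using AB(1,3) unfolding openin_path_topology by blast
    obtain N where N: "cylinder G y N \<subseteq> B"
      using AB(2,4) unfolding openin_path_topology by blast
    have "cylinder G x (max M N) \<times> cylinder G y (max M N) \<subseteq> A \<times> B"
      using M N cylinder_mono[of M "max M N" x] cylinder_mono[of N "max M N" y] by (intro Sigma_mono) auto
    then show ?thesis using T(2) AB(5) by blast
  qed
  then show "U \<subseteq> tail_rel_upto G m \<and>
     (\<forall>(x, y)\<in>U. \<exists>N. (cylinder G x N \<times> cylinder G y N) \<inter> tail_rel_upto G m \<subseteq> U)"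
    using T(2) by blast
next
  assume U: "U \<subseteq> tail_rel_upto G m \<and>
     (\<forall>(x, y)\<in>U. \<exists>N. (cylinder G x N \<times> cylinder G y N) \<inter> tail_rel_upto G m \<subseteq> U)"
  define T where "T = \<Union>{cylinder G x N \<times> cylinder G y N | x y N. (x, y) \<in> U \<and> (cylinder G x N \<times> cylinder G y N) \<inter> tail_rel_upto G m \<subseteq> U}"
  have "openin (prod_topology (path_topology G) (path_topology G)) T"
    unfolding T_def
  proof (intro openin_Union)
    fix S assume "S \<in> {cylinder G x N \<times> cylinder G y N | x y N. (x, y) \<in> U \<and> (cylinder G x N \<times> cylinder G y N) \<inter> tail_rel_upto G m \<subseteq> U}"
    then obtain x y N where "S = cylinder G x N \<times> cylinder G y N" by blast
    then show "openin (prod_topology (path_topology G) (path_topology G)) S"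
      by (simp add: openin_prod_Times_iff openin_cylinder)
  qed
  moreover have "U = T \<inter> tail_rel_upto G m"
  proof
    show "U \<subseteq> T \<inter> tail_rel_upto G m"
    proof
      fix p assume p: "p \<in> U"
      obtain x y where xy: "p = (x, y)" by (cases p)
      obtain N where N: "(cylinder G x N \<times> cylinder G y N) \<inter> tail_rel_upto G m \<subseteq> U"
        using U p xy by blast
      have "(x, y) \<in> tail_rel_upto G m" using U p xy by blast
      moreover from this have "p \<in> cylinder G x N \<times> cylinder G y N"
        by (auto simp: xy in_tail_rel_upto cylinder_self)
      ultimately show "p \<in> T \<inter> tail_rel_upto G m"
        unfolding T_def using p N xy by blast
    qed
    show "T \<inter> tail_rel_upto G m \<subseteq> U"
      unfolding T_def by blast
  qed
  ultimately show "openin (tail_topology_upto G m) U"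
    by (auto simp: tail_topology_upto_def openin_subtopology)
qed

text \<open>Why tubes are basic in the inductive limit: pairs of \<open>R_m\<close> that follow
  \<open>(x, y)\<close> up to \<open>max m n\<close> automatically agree after \<open>n\<close>, so
  a tube of level \<open>n\<close> is seen as open in every \<open>R_m\<close>. Conversely, a
  neighbourhood inside one \<open>R_n\<close> contains a tube of some larger level.\<close>

lemma openin_tail_topology_tube:
  "openin (tail_topology G) U \<longleftrightarrow> U \<subseteq> tail_rel G \<and>
     (\<forall>(x, y)\<in>U. \<exists>n. (x, y) \<in> tail_rel_upto G n \<and> tube G x y n \<subseteq> U)"
proof
  assume U: "openin (tail_topology G) U"
  have "\<exists>n. (x, y) \<in> tail_rel_upto G n \<and> tube G x y n \<subseteq> U" if xy: "(x, y) \<in> U" for x y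
  proof -
    have "U \<subseteq> tail_rel G" using U by (simp add: openin_tail_topology)
    then obtain n where n: "(x, y) \<in> tail_rel_upto G n"
      using xy in_tail_rel by blast
    have "openin (tail_topology_upto G n) (U \<inter> tail_rel_upto G n)"
      using U by (simp add: openin_tail_topology)
    then obtain N where N: "(cylinder G x N \<times> cylinder G y N) \<inter> tail_rel_upto G n \<subseteq> U"
      using xy n unfolding openin_tail_topology_upto by blast
    have "tube G x y (max n N) \<subseteq> tube G x y n" using n by (rule tube_refine) simp
    moreover have "tube G x y (max n N) \<subseteq> cylinder G x N \<times> cylinder G y N"
      using cylinder_mono[of N "max n N" x] cylinder_mono[of N "max n N" y] by (auto simp: tube_def)
    ultimately have "tube G x y (max n N) \<subseteq> U"
      using N tube_subset[of x y n] by blast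
    moreover have "(x, y) \<in> tail_rel_upto G (max n N)"
      using n tail_rel_upto_mono[of n "max n N"] by auto
    ultimately show ?thesis by blast
  qed
  then show "U \<subseteq> tail_rel G \<and> (\<forall>(x, y)\<in>U. \<exists>n. (x, y) \<in> tail_rel_upto G n \<and> tube G x y n \<subseteq> U)"
    using U by (auto simp: openin_tail_topology)
next
  assume U: "U \<subseteq> tail_rel G \<and> (\<forall>(x, y)\<in>U. \<exists>n. (x, y) \<in> tail_rel_upto G n \<and> tube G x y n \<subseteq> U)"
  have "\<exists>N. (cylinder G x N \<times> cylinder G y N) \<inter> tail_rel_upto G m \<subseteq> U \<inter> tail_rel_upto G m"
    if xy: "(x, y) \<in> U" "(x, y) \<in> tail_rel_upto G m" for x y m
  proof -
    obtain n where n: "(x, y) \<in> tail_rel_upto G n" "tube G x y n \<subseteq> U" using U xy by blast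
    have "(a, b) \<in> tube G x y n"
      if "a \<in> cylinder G x (max m n)" "b \<in> cylinder G y (max m n)" "(a, b) \<in> tail_rel_upto G m" for a b
    proof -
      have "a k = b k" if "k > n" for k
        using that n \<open>a \<in> _\<close> \<open>b \<in> _\<close> \<open>(a, b) \<in> _\<close>
        by (cases "k \<le> m") (auto simp: cylinder_def in_tail_rel_upto)
      then show ?thesis
        using that by (auto simp: tube_def cylinder_def)
    qed
    then show ?thesis using n(2) by (intro exI[of _ "max m n"]) blast
  qed
  then show "openin (tail_topology G) U"
    using U unfolding openin_tail_topology openin_tail_topology_upto by blast
qed

lemma openin_tube: "openin (tail_topology G) (tube G s t n)"
proof -
  have "tube G s t n \<subseteq> tail_rel G"
    using tube_subset tail_rel_upto_subset by blast
  moreover have "(x, y) \<in> tail_rel_upto G n \<and> tube G x y n \<subseteq> tube G s t n" if "(x, y) \<in> tube G s t n" for x y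
    using that tube_eq tube_subset by blast
  ultimately show ?thesis unfolding openin_tail_topology_tube by blast
qed

text \<open>If the tube of \<open>(x, y)\<close> at a level \<open>N\<close> beyond \<open>n\<close>
  meets this one, then \<open>x\<close> and \<open>y\<close> inherit from the common pair the
  agreement between \<open>n\<close> and \<open>N\<close>, so \<open>(x, y)\<close> was inside
  already.\<close>

lemma closedin_tube: "closedin (tail_topology G) (tube G s t n)"
proof -
  have "\<exists>N. (x, y) \<in> tail_rel_upto G N \<and> tube G x y N \<subseteq> tail_rel G - tube G s t n"
    if xy: "(x, y) \<in> tail_rel G - tube G s t n" for x y
  proof -
    obtain m where m: "(x, y) \<in> tail_rel_upto G m" using xy in_tail_rel by blast
    define N where "N = max m n"
    have N: "(x, y) \<in> tail_rel_upto G N"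
      using m tail_rel_upto_mono[of m N] by (auto simp: N_def)
    have "(x, y) \<in> tube G s t n" if "(a, b) \<in> tube G x y N" "(a, b) \<in> tube G s t n" for a b
    proof -
      have "x k = y k" if "k > n" for k
        using that N \<open>(a, b) \<in> tube G x y N\<close> \<open>(a, b) \<in> tube G s t n\<close>
        by (cases "k \<le> N") (auto simp: tube_def in_tail_rel_upto cylinder_def)
      moreover have "n \<le> N" by (simp add: N_def)
      ultimately show ?thesis
        using that N by (auto simp: tube_def in_tail_rel_upto cylinder_def)
    qed
    then have "tube G x y N \<inter> tube G s t n = {}"
      using xy by auto
    then have "tube G x y N \<subseteq> tail_rel G - tube G s t n"
      using tube_subset[of x y N] tail_rel_upto_subset[of N] by blast
    then show ?thesis using N by blast
  qed
  then have "openin (tail_topology G) (tail_rel G - tube G s t n)"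
    unfolding openin_tail_topology_tube by blast
  then show ?thesis
    using openin_subset[OF openin_tube] by (simp add: closedin_def topspace_tail_topology)
qed

lemma openin_tail_rel_upto: "openin (tail_topology G) (tail_rel_upto G n)"
  unfolding openin_tail_topology_tube using tube_subset tail_rel_upto_subset by blast

lemma splice_in_tube:
  assumes st: "(s, t) \<in> tail_rel_upto G n" and x: "x \<in> cylinder G s n"
  shows "(x, splice n t x) \<in> tube G s t n"
proof -
  have "n = 0 \<or> rng G (t n) = rng G (x n)"
    using tail_rel_upto_rng[OF st] x by (cases "n = 0") (auto simp: cylinder_def)
  then have "splice n t x \<in> paths G"
    using st x by (intro splice_path) (auto simp: in_tail_rel_upto cylinder_def)
  then show ?thesis
    using x by (auto simp: tube_def cylinder_def splice_def)
qed

lemma tube_section: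
  assumes "(x, y) \<in> tube G s t n"
  shows "y = splice n t x"
proof
  fix k
  have "x \<in> paths G" "y \<in> paths G" using assms by (auto simp: tube_def cylinder_def)
  then show "y k = splice n t x k"
    using assms path_0[of x] path_0[of y] by (cases k) (auto simp: splice_def tube_def cylinder_def)
qed

text \<open>The tube is the image of a compact cylinder under the section
  \<open>x \<mapsto> (x, splice n t x)\<close>; the work lies in its continuity into the inductive
  limit topology.\<close>

lemma compactin_tube:
  assumes st: "(s, t) \<in> tail_rel_upto G n"
  shows "compactin (tail_topology G) (tube G s t n)"
proof -
  let ?X = "subtopology (path_topology G) (cylinder G s n)"
  let ?h = "\<lambda>x. (x, splice n t x)"
  have "closedin (path_topology G) (cylinder G s n)"
  proof -
    have "\<exists>n'. cylinder G x n' \<subseteq> paths G - cylinder G s n" if "x \<in> paths G - cylinder G s n" for x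
      using that by (intro exI[of _ n]) (auto simp: cylinder_def)
    then have "openin (path_topology G) (paths G - cylinder G s n)"
      unfolding openin_path_topology by blast
    then show ?thesis
      using cylinder_subset by (simp add: closedin_def topspace_path_topology)
  qed
  then have "compactin (path_topology G) (cylinder G s n)"
    using compact_space_path_topology closedin_compact_space by blast
  then have X: "compact_space ?X" by (simp add: compact_space_subtopology)
  have tX: "topspace ?X = cylinder G s n"
    using cylinder_subset by (auto simp: topspace_path_topology)
  have "continuous_map ?X (tail_topology G) ?h"
    unfolding continuous_map_def
  proof (intro conjI allI impI)
    show "?h \<in> topspace ?X \<rightarrow> topspace (tail_topology G)"
      unfolding tX using splice_in_tube[OF st] openin_subset[OF openin_tube] by blast
  next
    fix U assume U: "openin (tail_topology G) U"
    have "\<exists>N. cylinder G x N \<subseteq> {x \<in> cylinder G s n. ?h x \<in> U}" if x: "x \<in> cylinder G s n" "?h x \<in> U" for x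
    proof -
      obtain m where m: "?h x \<in> tail_rel_upto G m" "tube G x (splice n t x) m \<subseteq> U"
        using U x(2) unfolding openin_tail_topology_tube by blast
      define N where "N = max m n"
      have "z \<in> cylinder G s n \<and> ?h z \<in> U" if z: "z \<in> cylinder G x N" for z
      proof
        show z': "z \<in> cylinder G s n"
          using z x(1) by (auto simp: cylinder_def N_def)
        \<comment> \<open>Beyond \<open>n\<close> the splice changes nothing; up to \<open>n\<close>
          the path \<open>z\<close> agrees with \<open>x\<close>, for which the coincidence after
          \<open>m\<close> is known.\<close>
        have "z k = splice n t z k" if "k > m" for k
        proof (cases "k \<le> n \<and> 1 \<le> k")
          case True
          then have "z k = x k" using z by (auto simp: cylinder_def N_def)
          also have "\<dots> = splice n t x k" using m(1) that by (auto simp: in_tail_rel_upto)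
          also have "\<dots> = splice n t z k" using True by (auto simp: splice_def)
          finally show ?thesis .
        qed (auto simp: splice_def)
        moreover have "splice n t z \<in> paths G"
          using splice_in_tube[OF st z'] by (auto simp: tube_def cylinder_def)
        ultimately have "?h z \<in> tube G x (splice n t x) m"
          using z by (auto simp: tube_def cylinder_def splice_def N_def)
        then show "?h z \<in> U" using m(2) by blast
      qed
      then show ?thesis by blast
    qed
    then have "openin (path_topology G) {x \<in> cylinder G s n. ?h x \<in> U}"
      unfolding openin_path_topology using cylinder_subset by blast
    then show "openin ?X {x \<in> topspace ?X. ?h x \<in> U}"
      unfolding tX openin_subtopology by blast
  qed
  then have "compactin (tail_topology G) (?h ` topspace ?X)"
    using image_compactin X compact_space_def by blast
  moreover have "?h ` topspace ?X = tube G s t n"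
  proof
    show "?h ` topspace ?X \<subseteq> tube G s t n"
      unfolding tX using splice_in_tube[OF st] by blast
    show "tube G s t n \<subseteq> ?h ` topspace ?X"
      unfolding tX using tube_section by (fastforce simp: tube_def)
  qed
  ultimately show ?thesis by simp
qed

lemma indicator_tube_Cc:
  assumes st: "(s, t) \<in> tail_rel_upto G n"
  shows "indicator (tube G s t n) \<in> tail_Cc G"
proof -
  have "{p \<in> tail_rel G. indicator (tube G s t n) p \<noteq> (0::real)} = tube G s t n"
    using openin_subset[OF openin_tube] by (auto simp: topspace_tail_topology indicator_def)
  moreover have "tail_topology G closure_of (tube G s t n) = tube G s t n"
    using closedin_tube by (simp add: closure_of_closedin)
  ultimately show ?thesis
    using compactin_tube[OF st] continuous_map_indicator[OF openin_tube closedin_tube]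
    by (simp add: tail_Cc_def)
qed

text \<open>The test functions whose fibre integrals can be computed: vanishing off one
  \<open>R_n\<close> makes the sum over each class finite. The class contains
  \<open>tail_Cc G\<close> and is visibly stable under exchanging the coordinates.\<close>

definition tail_bounded :: "((nat \<Rightarrow> 'e) \<times> (nat \<Rightarrow> 'e) \<Rightarrow> real) \<Rightarrow> bool" where
  "tail_bounded f \<longleftrightarrow> f \<in> borel_measurable (borel_on (tail_topology G)) \<and>
     (\<exists>C. \<forall>p\<in>tail_rel G. \<bar>f p\<bar> \<le> C) \<and> (\<exists>n. \<forall>p\<in>tail_rel G - tail_rel_upto G n. f p = 0)"

text \<open>Compactness of the closed support enters twice: its image is bounded, and the increasing
  open sets \<open>R_n\<close> cover it, so one of them contains it.\<close>

lemma tail_Cc_bounded: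
  assumes f: "f \<in> tail_Cc G"
  shows "tail_bounded f"
proof -
  let ?S = "{p \<in> tail_rel G. f p \<noteq> 0}"
  let ?K = "tail_topology G closure_of ?S"
  have cont: "continuous_map (tail_topology G) euclideanreal f" and K: "compactin (tail_topology G) ?K"
    using f by (auto simp: tail_Cc_def)
  have SK: "?S \<subseteq> ?K"
    by (rule closure_of_subset) (auto simp: topspace_tail_topology)
  have "compactin euclideanreal (f ` ?K)"
    using K cont by (rule image_compactin)
  then have "bounded (f ` ?K)"
    by (simp add: compact_imp_bounded)
  then obtain C where C: "\<And>p. p \<in> ?K \<Longrightarrow> \<bar>f p\<bar> \<le> C"
    by (auto simp: bounded_iff)
  have "\<bar>f p\<bar> \<le> max C 0" if "p \<in> tail_rel G" for p
    using C[of p] SK that by (cases "f p = 0") auto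
  moreover have "\<exists>n. \<forall>p\<in>tail_rel G - tail_rel_upto G n. f p = 0"
  proof -
    have "?K \<subseteq> \<Union> (range (tail_rel_upto G))"
      using closure_of_subset_topspace[of "tail_topology G" ?S] by (auto simp: topspace_tail_topology tail_rel_def)
    moreover have "\<forall>U\<in>range (tail_rel_upto G). openin (tail_topology G) U"
      using openin_tail_rel_upto by auto
    ultimately obtain F where F: "finite F" "F \<subseteq> range (tail_rel_upto G)" "?K \<subseteq> \<Union>F"
      using K unfolding compactin_def by meson
    then obtain I where I: "finite I" "F = tail_rel_upto G ` I"
      by (meson finite_subset_image)
    have "?K \<subseteq> tail_rel_upto G (Max (insert 0 I))"
    proof
      fix p assume "p \<in> ?K"
      then obtain i where "i \<in> I" "p \<in> tail_rel_upto G i" using F(3) I(2) by auto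
      moreover have "i \<le> Max (insert 0 I)" using I(1) \<open>i \<in> I\<close> by (intro Max_ge) auto
      ultimately show "p \<in> tail_rel_upto G (Max (insert 0 I))"
        using tail_rel_upto_mono by blast
    qed
    then show ?thesis using SK by blast
  qed
  ultimately show ?thesis
    unfolding tail_bounded_def using measurable_continuous_map_real[OF cont] by blast
qed

section \<open>Borel sets of the tail relation, and the two functionals on tubes\<close>

abbreviation tail_borel :: "((nat \<Rightarrow> 'e) \<times> (nat \<Rightarrow> 'e)) measure" where
  "tail_borel \<equiv> borel_on (tail_topology G)"

lemma space_tail_borel: "space tail_borel = tail_rel G"
  by (simp add: space_borel_on topspace_tail_topology)

definition tubes :: "((nat \<Rightarrow> 'e) \<times> (nat \<Rightarrow> 'e)) set set" where
  "tubes = {tube G x y n | x y n. (x, y) \<in> tail_rel_upto G n}"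

lemma countable_tubes: "countable tubes"
proof -
  let ?P = "\<lambda>n. \<Pi>\<^sub>E k\<in>{1..n}. edges G k"
  have "tube G x y n \<in> (\<lambda>(a, b). tube G a b n) ` (?P n \<times> ?P n)" if "(x, y) \<in> tail_rel_upto G n" for x y n
  proof (rule image_eqI)
    have "cylinder G x n = cylinder G (restrict x {1..n}) n" for x
      by (rule cylinder_cong) auto
    then show "tube G x y n = (case (restrict x {1..n}, restrict y {1..n}) of (a, b) \<Rightarrow> tube G a b n)"
      by (simp add: tube_def)
    show "(restrict x {1..n}, restrict y {1..n}) \<in> ?P n \<times> ?P n"
      using that path_edge'[of x] path_edge'[of y] by (auto simp: in_tail_rel_upto)
  qed
  then have "tubes \<subseteq> (\<Union>n. (\<lambda>(a, b). tube G a b n) ` (?P n \<times> ?P n))"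
    unfolding tubes_def by (smt (verit, ccfv_threshold) UNIV_I UN_I mem_Collect_eq subsetI)
  moreover have "countable (\<Union>n. (\<lambda>(a, b). tube G a b n) ` (?P n \<times> ?P n))"
    by (rule countable_UN) (auto intro!: countable_finite finite_PiE finite_edges' finite_imageI finite_cartesian_product)
  ultimately show ?thesis by (rule countable_subset)
qed

lemma sets_tail_borel: "sets tail_borel = sigma_sets (tail_rel G) tubes"
proof -
  have "sets tail_borel = sigma_sets (topspace (tail_topology G)) tubes"
  proof (rule sets_borel_on_basis[OF countable_tubes])
    fix U p assume U: "openin (tail_topology G) U" "p \<in> U"
    obtain x y where p: "p = (x, y)" by (cases p)
    then obtain n where n: "(x, y) \<in> tail_rel_upto G n" "tube G x y n \<subseteq> U"
      using U unfolding openin_tail_topology_tube by blast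
    then show "\<exists>b\<in>tubes. p \<in> b \<and> b \<subseteq> U"
      unfolding tubes_def p using tube_self[OF n(1)] by blast
  qed (auto simp: tubes_def openin_tube)
  then show ?thesis by (simp add: topspace_tail_topology)
qed

lemma tube_sets: "tube G s t n \<in> sets tail_borel"
  by (intro openin_borel_on openin_tube)

text \<open>Ultrametric behaviour: two tubes that meet are nested, the one of larger level inside
  the other. The empty set is added for tubes that are disjoint.\<close>

lemma Int_stable_tubes: "Int_stable (insert {} tubes)"
proof -
  have *: "tube G x y n \<inter> tube G x' y' n' \<in> insert {} tubes" if "n \<le> n'" "(x, y) \<in> tail_rel_upto G n" "(x', y') \<in> tail_rel_upto G n'"
    for x y x' y' n n'
  proof (cases "tube G x y n \<inter> tube G x' y' n' = {}")
    case False
    then obtain z z' where z: "(z, z') \<in> tube G x y n" "(z, z') \<in> tube G x' y' n'" by auto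
    have "tube G z z' n' \<subseteq> tube G z z' n"
      by (rule tube_refine) (use z tube_subset that in auto)
    then have "tube G x y n \<inter> tube G x' y' n' = tube G x' y' n'"
      using tube_eq[OF z(1)] tube_eq[OF z(2)] by blast
    then show ?thesis using that by (auto simp: tubes_def)
  qed simp
  show ?thesis
    unfolding Int_stable_def
  proof (intro ballI)
    fix a b assume ab: "a \<in> insert {} tubes" "b \<in> insert {} tubes"
    show "a \<inter> b \<in> insert {} tubes"
    proof (cases "a = {} \<or> b = {}")
      case False
      with ab obtain x y n x' y' n' where
        "a = tube G x y n" "(x, y) \<in> tail_rel_upto G n" "b = tube G x' y' n'" "(x', y') \<in> tail_rel_upto G n'"
        unfolding tubes_def by blast
      then show ?thesis
        using *[of n n' x y x' y'] *[of n' n x' y' x y] by (cases "n \<le> n'") (simp_all add: Int_commute)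
    qed auto
  qed
qed

lemma measurable_swap_tail: "prod.swap \<in> measurable tail_borel tail_borel"
proof (rule measurable_sigma_sets[OF sets_tail_borel])
  show "tubes \<subseteq> Pow (tail_rel G)"
    using tube_subset tail_rel_upto_subset by (fastforce simp: tubes_def)
  show "prod.swap \<in> space tail_borel \<rightarrow> tail_rel G"
    using tail_rel_sym by (auto simp: space_tail_borel)
  fix y assume "y \<in> tubes"
  then obtain s t n where "y = tube G s t n" by (auto simp: tubes_def)
  then have "prod.swap -` y \<inter> space tail_borel = tube G t s n"
    using tube_subset[of t s n] tail_rel_upto_subset[of n] by (auto simp: tube_def space_tail_borel)
  then show "prod.swap -` y \<inter> space tail_borel \<in> sets tail_borel"
    by (simp add: tube_sets)
qed

text \<open>Over a point of \<open>cylinder G s n\<close> the tube has exactly one point, over any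
  other point none, so the fibre sum is the indicator of that cylinder.\<close>

lemma first_functional_tube:
  assumes \<mu>: "sets \<mu> = sets path_borel" and st: "(s, t) \<in> tail_rel_upto G n"
  shows "first_functional G \<mu> (indicator (tube G s t n)) = measure \<mu> (cylinder G s n)"
proof -
  have "(\<Sum>\<^sub>\<infinity>y\<in>{y. (x, y) \<in> tail_rel G}. indicator (tube G s t n) (x, y)) = (indicator (cylinder G s n) x :: real)" for x
  proof (cases "x \<in> cylinder G s n")
    case True
    have "(x, splice n t x) \<in> tube G s t n" using splice_in_tube[OF st True] .
    moreover from this have "(x, splice n t x) \<in> tail_rel G"
      using tube_subset tail_rel_upto_subset by blast
    ultimately have "(\<Sum>\<^sub>\<infinity>y\<in>{y. (x, y) \<in> tail_rel G}. indicator (tube G s t n) (x, y)) =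
       (\<Sum>\<^sub>\<infinity>y\<in>{splice n t x}. indicator (tube G s t n) (x, y) :: real)"
      by (intro infsum_cong_neutral) (auto simp: indicator_def dest: tube_section)
    then show ?thesis using \<open>(x, splice n t x) \<in> tube G s t n\<close> True by simp
  next
    case False
    then have "(\<Sum>\<^sub>\<infinity>y\<in>{y. (x, y) \<in> tail_rel G}. indicator (tube G s t n) (x, y)) = (0::real)"
      by (intro infsum_0) (auto simp: indicator_def tube_def)
    then show ?thesis using False by simp
  qed
  moreover have "cylinder G s n \<in> sets \<mu>" using \<mu> cylinder_sets by simp
  ultimately show ?thesis
    by (simp add: first_functional_def sets.Int_space_eq2)
qed

lemma second_functional_swap: "second_functional G \<mu> f = first_functional G \<mu> (f \<circ> prod.swap)"
  by (simp add: first_functional_def second_functional_def tail_rel_sym[of _ y for y])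

lemma second_functional_tube:
  assumes \<mu>: "sets \<mu> = sets path_borel" and st: "(s, t) \<in> tail_rel_upto G n"
  shows "second_functional G \<mu> (indicator (tube G s t n)) = measure \<mu> (cylinder G t n)"
proof -
  have "(t, s) \<in> tail_rel_upto G n" using st by (auto simp: in_tail_rel_upto)
  moreover have "indicator (tube G s t n) \<circ> prod.swap = (indicator (tube G t s n) :: _ \<Rightarrow> real)"
    by (auto simp: fun_eq_iff indicator_def tube_def)
  ultimately show ?thesis
    using first_functional_tube[OF \<mu>] by (simp add: second_functional_swap)
qed

end

section \<open>The measures on the tail relation\<close>

context bratteli
begin

text \<open>Every path equivalent to \<open>x\<close> is \<open>switch_head (n, b) x\<close> for exactly one head \<open>(n, b)\<close>
  with \<open>((n, b), x) \<in> switch\<close>, since \<open>n\<close> is forced to be the last index at which the two paths differ.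
  This writes the sum over the class of \<open>x\<close> as an integral over a fixed countable set.\<close>

definition heads :: "(nat \<times> (nat \<Rightarrow> 'e)) set" where
  "heads = {(n, restrict y {1..n}) | n y. y \<in> paths G}"

definition switch :: "((nat \<times> (nat \<Rightarrow> 'e)) \<times> (nat \<Rightarrow> 'e)) set" where
  "switch = {((n, b), x). (n, b) \<in> heads \<and> x \<in> paths G \<and> (n = 0 \<or> b n \<noteq> x n \<and> rng G (b n) = rng G (x n))}"

text \<open>Where the head does not apply, \<open>x\<close> is a harmless default: it keeps the map
  inside the tail relation for every \<open>k\<close>, and the density in
  \<open>fiber_measure\<close> discards these points.\<close>

definition switch_head :: "(nat \<times> (nat \<Rightarrow> 'e)) \<Rightarrow> (nat \<Rightarrow> 'e) \<Rightarrow> nat \<Rightarrow> 'e" where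
  "switch_head k x = (if (k, x) \<in> switch then splice (fst k) (snd k) x else x)"

lemma finite_heads: "finite {k \<in> heads. fst k \<le> n}"
proof (rule finite_subset)
  show "{k \<in> heads. fst k \<le> n} \<subseteq> (SIGMA m:{..n}. \<Pi>\<^sub>E k\<in>{1..m}. edges G k)"
    using path_edge' by (auto simp: heads_def)
  show "finite (SIGMA m:{..n}. \<Pi>\<^sub>E k\<in>{1..m}. edges G k)"
    by (intro finite_SigmaI finite_PiE finite_edges') auto
qed

lemma countable_heads: "countable heads"
proof -
  have "heads = (\<Union>n. {k \<in> heads. fst k \<le> n})" by auto
  moreover have "countable (\<Union>n. {k \<in> heads. fst k \<le> n})"
    by (rule countable_UN) (simp_all add: finite_heads countable_finite)
  ultimately show ?thesis by simp
qed

lemma switch_head_path: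
  assumes x: "x \<in> paths G"
  shows "switch_head k x \<in> paths G"
proof (cases "(k, x) \<in> switch")
  case True
  then obtain n y where k: "k = (n, restrict y {1..n})" "y \<in> paths G" and "n = 0 \<or> rng G (restrict y {1..n} n) = rng G (x n)"
    by (auto simp: switch_def heads_def)
  then have "n = 0 \<or> rng G (y n) = rng G (x n)" by (cases "n = 0") auto
  moreover have "splice n (restrict y {1..n}) x = splice n y x"
    by (auto simp: splice_def)
  ultimately show ?thesis
    using True splice_path[OF k(2) x] by (simp add: switch_head_def k)
qed (simp add: switch_head_def x)

lemma switch_head_beyond: "fst k < j \<Longrightarrow> switch_head k x j = x j"
  by (simp add: switch_head_def splice_def)

lemma switch_cylinder:
  assumes "z \<in> cylinder G x N" "fst k \<le> N" "x \<in> paths G"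
  shows "(k, z) \<in> switch \<longleftrightarrow> (k, x) \<in> switch"
  using assms by (cases k; cases "fst k = 0") (auto simp: switch_def cylinder_def)

lemma switch_head_cylinder:
  assumes "z \<in> cylinder G x N" "fst k \<le> N" "x \<in> paths G" "1 \<le> j" "j \<le> N"
  shows "switch_head k z j = switch_head k x j"
  using assms switch_cylinder[OF assms(1-3)] by (auto simp: switch_head_def splice_def cylinder_def)

text \<open>Whether the head applies depends on the first \<open>fst k\<close> edges, and later
  edges stay unchanged. The preimage of a tube of level \<open>n\<close> is therefore a union of
  cylinders of length \<open>max n (fst k)\<close>.\<close>

lemma measurable_switch_head:
  "(\<lambda>x. (x, switch_head k x)) \<in> measurable path_borel tail_borel"
proof (rule measurable_sigma_sets[OF sets_tail_borel])
  show "tubes \<subseteq> Pow (tail_rel G)"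
    using tube_subset tail_rel_upto_subset by (fastforce simp: tubes_def)
  show "(\<lambda>x. (x, switch_head k x)) \<in> space path_borel \<rightarrow> tail_rel G"
  proof
    fix x assume "x \<in> space path_borel"
    then have "(x, switch_head k x) \<in> tail_rel_upto G (fst k)"
      by (simp add: space_path_borel in_tail_rel_upto switch_head_path switch_head_beyond)
    then show "(x, switch_head k x) \<in> tail_rel G"
      using tail_rel_upto_subset by blast
  qed
  fix y assume "y \<in> tubes"
  then obtain s t n where y: "y = tube G s t n" by (auto simp: tubes_def)
  define N where "N = max n (fst k)"
  let ?P = "(\<lambda>x. (x, switch_head k x)) -` y \<inter> space path_borel"
  have "openin (path_topology G) ?P"
  proof (rule openin_pathI)
    show "?P \<subseteq> paths G" by (auto simp: space_path_borel)
    fix x assume "x \<in> ?P"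
    then have x: "x \<in> paths G" "(x, switch_head k x) \<in> tube G s t n" by (auto simp: space_path_borel y)
    show "cylinder G x N \<subseteq> ?P"
    proof
      fix z assume z: "z \<in> cylinder G x N"
      then have zp: "z \<in> paths G" by (simp add: cylinder_def)
      have agree: "switch_head k z j = switch_head k x j \<and> z j = x j" if "1 \<le> j" "j \<le> N" for j
        using switch_head_cylinder[OF z _ x(1) that] z that by (simp add: N_def cylinder_def)
      have "z j = switch_head k z j" if "n < j" for j
      proof (cases "j \<le> N")
        case True
        then show ?thesis using agree[of j] that x(2) by (auto simp: tube_def)
      next
        case False
        then show ?thesis using switch_head_beyond[of k j z] by (simp add: N_def)
      qed
      moreover have "n \<le> N" by (simp add: N_def)
      ultimately have "(z, switch_head k z) \<in> tube G s t n"
        using x(2) agree zp switch_head_path[OF zp, of k] by (auto simp: tube_def cylinder_def)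
      then show "z \<in> ?P" using zp by (simp add: y space_path_borel)
    qed
  qed
  then show "?P \<in> sets path_borel" by (rule openin_borel_on)
qed

lemma tail_class_bij:
  assumes x: "x \<in> paths G"
  shows "bij_betw (\<lambda>k. switch_head k x) {k \<in> heads. fst k \<le> n \<and> (k, x) \<in> switch} {y. (x, y) \<in> tail_rel_upto G n}"
  unfolding bij_betw_def
proof
  let ?K = "{k \<in> heads. fst k \<le> n \<and> (k, x) \<in> switch}"
  show "inj_on (\<lambda>k. switch_head k x) ?K"
  proof (rule inj_onI)
    fix k k' assume k: "k \<in> ?K" "k' \<in> ?K" and eq: "switch_head k x = switch_head k' x"
    have fst_le: "fst k \<le> fst k'" if "k \<in> ?K" "k' \<in> ?K" "switch_head k x = switch_head k' x" for k k'
    proof (rule ccontr)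
      assume *: "\<not> fst k \<le> fst k'"
      then have "switch_head k x (fst k) = x (fst k)"
        using that(3) switch_head_beyond[of k' "fst k" x] by simp
      moreover have "switch_head k x (fst k) \<noteq> x (fst k)"
        using that(1) * by (auto simp: switch_head_def switch_def splice_def)
      ultimately show False by simp
    qed
    have fst_eq: "fst k = fst k'" using fst_le[OF k eq] fst_le[OF k(2,1) eq[symmetric]] by simp
    have "snd k j = snd k' j" for j
    proof (cases "j \<in> {1..fst k}")
      case True
      then show ?thesis
        using fun_cong[OF eq, of j] k fst_eq by (auto simp: switch_head_def splice_def)
    next
      case False
      then show ?thesis using k fst_eq by (auto simp: heads_def)
    qed
    then show "k = k'" using fst_eq by (auto simp: prod_eq_iff)
  qed
  show "(\<lambda>k. switch_head k x) ` ?K = {y. (x, y) \<in> tail_rel_upto G n}"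
  proof
    show "(\<lambda>k. switch_head k x) ` ?K \<subseteq> {y. (x, y) \<in> tail_rel_upto G n}"
      using x switch_head_path[OF x] switch_head_beyond by (auto simp: in_tail_rel_upto)
    show "{y. (x, y) \<in> tail_rel_upto G n} \<subseteq> (\<lambda>k. switch_head k x) ` ?K"
    proof
      fix y assume "y \<in> {y. (x, y) \<in> tail_rel_upto G n}"
      then have y: "(x, y) \<in> tail_rel_upto G n" by simp
      \<comment> \<open>The least admissible level is the last index where \<open>x\<close> and
        \<open>y\<close> differ, or 0 if the paths coincide; then the empty head serves.\<close>
      define m where "m = (LEAST m. (x, y) \<in> tail_rel_upto G m)"
      have m: "(x, y) \<in> tail_rel_upto G m" unfolding m_def using y by (rule LeastI)
      have mn: "m \<le> n" unfolding m_def using y by (rule Least_le)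
      have neq: "x m \<noteq> y m" if "m \<noteq> 0"
      proof
        assume eq: "x m = y m"
        have "x k = y k" if "k > m - 1" for k
          using m eq that by (cases "k = m") (auto simp: in_tail_rel_upto)
        then have "(x, y) \<in> tail_rel_upto G (m - 1)" using m by (simp add: in_tail_rel_upto)
        then have "m \<le> m - 1" unfolding m_def by (rule Least_le)
        then show False using \<open>m \<noteq> 0\<close> by simp
      qed
      let ?k = "(m, restrict y {1..m})"
      have yp: "y \<in> paths G" using y by (simp add: in_tail_rel_upto)
      then have "?k \<in> heads" by (auto simp: heads_def)
      moreover from this have sw: "(?k, x) \<in> switch"
        using x neq tail_rel_upto_rng[OF m] by (cases "m = 0") (auto simp: switch_def)
      ultimately have "?k \<in> ?K" using mn by simp
      moreover have "y = switch_head ?k x"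
      proof (rule path_eqI[OF yp switch_head_path[OF x]])
        fix k assume "1 \<le> (k::nat)"
        then show "y k = switch_head ?k x k"
          using sw m by (auto simp: switch_head_def splice_def in_tail_rel_upto)
      qed
      ultimately show "y \<in> (\<lambda>k. switch_head k x) ` ?K" by blast
    qed
  qed
qed

text \<open>Counting measure on the class of \<open>x\<close>, integrated over \<open>x\<close>: the
  measure that represents the first functional. The density ensures that each member of a class is
  counted once; without it every head that does not apply would count \<open>x\<close>
  again.\<close>

definition fiber_measure :: "(nat \<Rightarrow> 'e) measure \<Rightarrow> ((nat \<Rightarrow> 'e) \<times> (nat \<Rightarrow> 'e)) measure" where
  "fiber_measure \<mu> = distr (density (count_space heads \<Otimes>\<^sub>M \<mu>) (\<lambda>p. ennreal (indicator switch p))) tail_borel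
     (\<lambda>(k, x). (x, switch_head k x))"

text \<open>Fubini turns the integral into a sum over heads for each path, which
  \<open>tail_class_bij\<close> reindexes as the sum over the class. Integrability holds because
  only finitely many heads contribute when \<open>f\<close> vanishes off one
  \<open>R_n\<close>.\<close>

lemma integral_fiber_measure:
  assumes "prob_space \<mu>" and \<mu>: "sets \<mu> = sets path_borel" and f: "tail_bounded f"
  shows "integrable (fiber_measure \<mu>) f" "integral\<^sup>L (fiber_measure \<mu>) f = first_functional G \<mu> f"
proof -
  interpret \<mu>: prob_space \<mu> by fact
  interpret H: sigma_finite_measure "count_space heads"
    by (rule sigma_finite_measure_count_space_countable[OF countable_heads])
  interpret P: pair_sigma_finite "count_space heads" \<mu> ..
  have sp: "space \<mu> = paths G"
    using sets_eq_imp_space_eq[OF \<mu>] by (simp add: space_path_borel)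
  let ?N = "count_space heads \<Otimes>\<^sub>M \<mu>"
  let ?g = "\<lambda>(k, x). (x, switch_head k x)"
  have fm[measurable]: "f \<in> borel_measurable tail_borel"
    using f by (simp add: tail_bounded_def)
  obtain C where C: "\<And>p. p \<in> tail_rel G \<Longrightarrow> \<bar>f p\<bar> \<le> C"
    using f unfolding tail_bounded_def by blast
  obtain n where n: "\<And>p. p \<in> tail_rel G \<Longrightarrow> p \<notin> tail_rel_upto G n \<Longrightarrow> f p = 0"
    using f unfolding tail_bounded_def by blast
  have gm[measurable]: "?g \<in> measurable ?N tail_borel"
  proof (rule measurable_pair_measure_countable1[OF countable_heads])
    fix k show "(\<lambda>y. case (k, y) of (k, x) \<Rightarrow> (x, switch_head k x)) \<in> measurable \<mu> tail_borel"
      using measurable_switch_head[of k] by (simp add: measurable_cong_sets[OF \<mu> refl])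
  qed
  have sm[measurable]: "(indicator switch :: _ \<Rightarrow> real) \<in> borel_measurable ?N"
  proof (rule measurable_pair_measure_countable1[OF countable_heads])
    fix k
    have "openin (path_topology G) {x. (k, x) \<in> switch}"
    proof (rule openin_pathI)
      show "{x. (k, x) \<in> switch} \<subseteq> paths G" by (auto simp: switch_def)
      fix x assume x: "x \<in> {x. (k, x) \<in> switch}"
      then have "x \<in> paths G" by (auto simp: switch_def)
      then show "cylinder G x (fst k) \<subseteq> {x. (k, x) \<in> switch}"
        using switch_cylinder[of _ x "fst k" k] x by auto
    qed
    then have "{x. (k, x) \<in> switch} \<in> sets \<mu>"
      by (simp add: \<mu> openin_borel_on)
    then have "(indicator {x. (k, x) \<in> switch} :: _ \<Rightarrow> real) \<in> borel_measurable \<mu>"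
      by (rule borel_measurable_indicator)
    moreover have "(\<lambda>y. indicator switch (k, y) :: real) = indicator {x. (k, x) \<in> switch}"
      by (auto simp: fun_eq_iff indicator_def)
    ultimately show "(\<lambda>y. indicator switch (k, y) :: real) \<in> borel_measurable \<mu>" by simp
  qed
  define F where "F k x = indicator switch (k, x) * f (x, switch_head k x)" for k x
  have Feq: "case_prod F = (\<lambda>p. indicator switch p * f (?g p))"
    by (auto simp: F_def fun_eq_iff)
  have tr: "(x, switch_head k x) \<in> tail_rel_upto G (fst k)" if "x \<in> paths G" for x k
    using that switch_head_path switch_head_beyond by (auto simp: in_tail_rel_upto)
  have Fbound: "\<bar>F k x\<bar> \<le> max C 0" if "x \<in> paths G" for k x
    using C[of "(x, switch_head k x)"] tr[OF that, of k] tail_rel_upto_subset[of "fst k"]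
    by (auto simp: F_def indicator_def)
  \<comment> \<open>A head longer than \<open>n\<close> that applies changes the edge at its last
    index, so the resulting pair lies outside \<open>R_n\<close> and \<open>f\<close> vanishes at
    it.\<close>
  have F0: "F k x = 0" if "x \<in> paths G" "\<not> fst k \<le> n" for k x
  proof (cases "(k, x) \<in> switch")
    case True
    then have "x (fst k) \<noteq> switch_head k x (fst k)"
      using that by (auto simp: switch_head_def switch_def splice_def)
    then have "(x, switch_head k x) \<notin> tail_rel_upto G n"
      using that by (auto simp: in_tail_rel_upto intro!: exI[of _ "fst k"])
    then show ?thesis
      using n[of "(x, switch_head k x)"] tr[OF that(1), of k] tail_rel_upto_subset[of "fst k"] by (auto simp: F_def)
  qed (simp add: F_def)
  let ?K = "{k \<in> heads. fst k \<le> n}"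
  have intF: "integrable ?N (case_prod F)"
  proof (rule integrableI_bounded_set)
    show "?K \<times> space \<mu> \<in> sets ?N" by (intro pair_measureI) auto
    show "case_prod F \<in> borel_measurable ?N" unfolding Feq by measurable
    have "emeasure ?N (?K \<times> space \<mu>) = emeasure (count_space heads) ?K * emeasure \<mu> (space \<mu>)"
      by (rule \<mu>.emeasure_pair_measure_Times) auto
    then show "emeasure ?N (?K \<times> space \<mu>) < \<infinity>"
      using finite_heads[of n] by (simp add: \<mu>.emeasure_space_1 emeasure_count_space of_nat_less_top)
    show "AE p in ?N. p \<in> ?K \<times> space \<mu> \<longrightarrow> norm (case_prod F p) \<le> max C 0"
      using Fbound by (intro AE_I2) (auto simp: sp)
    show "AE p in ?N. p \<notin> ?K \<times> space \<mu> \<longrightarrow> case_prod F p = 0"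
      using F0 by (intro AE_I2) (auto simp: sp space_pair_measure)
  qed
  have intg: "integrable (density ?N (\<lambda>p. ennreal (indicator switch p))) (\<lambda>p. f (?g p))"
    using intF unfolding Feq by (subst integrable_density) auto
  then show "integrable (fiber_measure \<mu>) f"
    unfolding fiber_measure_def by (subst integrable_distr_eq) auto
  have "integral\<^sup>L (fiber_measure \<mu>) f = integral\<^sup>L (density ?N (\<lambda>p. ennreal (indicator switch p))) (\<lambda>p. f (?g p))"
    unfolding fiber_measure_def by (subst integral_distr) auto
  also have "\<dots> = integral\<^sup>L ?N (case_prod F)"
    unfolding Feq by (subst integral_density) auto
  also have "\<dots> = (\<integral>x. (\<integral>k. F k x \<partial>count_space heads) \<partial>\<mu>)"
    by (rule P.integral_snd[OF intF, symmetric])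
  also have "\<dots> = first_functional G \<mu> f"
    unfolding first_functional_def
  proof (rule Bochner_Integration.integral_cong[OF refl])
    fix x assume "x \<in> space \<mu>"
    then have x: "x \<in> paths G" by (simp add: sp)
    let ?Kx = "{k \<in> heads. fst k \<le> n \<and> (k, x) \<in> switch}"
    have fin: "finite ?Kx" by (rule finite_subset[OF _ finite_heads[of n]]) auto
    have supp: "{k \<in> heads. F k x \<noteq> 0} \<subseteq> ?Kx"
      using F0[OF x] by (auto simp: F_def indicator_def split: if_splits)
    have "(\<integral>k. F k x \<partial>count_space heads) = (\<Sum>k | k \<in> heads \<and> F k x \<noteq> 0. F k x)"
      by (rule lebesgue_integral_count_space_finite_support) (rule finite_subset[OF supp fin])
    also have "\<dots> = (\<Sum>k\<in>?Kx. F k x)"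
      by (rule sum.mono_neutral_left[OF fin supp]) auto
    also have "\<dots> = (\<Sum>k\<in>?Kx. f (x, switch_head k x))"
      by (rule sum.cong) (auto simp: F_def)
    also have "\<dots> = (\<Sum>y\<in>{y. (x, y) \<in> tail_rel_upto G n}. f (x, y))"
      using tail_class_bij[OF x, of n] by (rule sum.reindex_bij_betw)
    also have "\<dots> = (\<Sum>\<^sub>\<infinity>y\<in>{y. (x, y) \<in> tail_rel_upto G n}. f (x, y))"
      using bij_betw_finite[OF tail_class_bij[OF x, of n]] fin by (intro infsum_finite[symmetric]) simp
    also have "\<dots> = (\<Sum>\<^sub>\<infinity>y\<in>{y. (x, y) \<in> tail_rel G}. f (x, y))"
      using n tail_rel_upto_subset[of n] by (intro infsum_cong_neutral) auto
    finally show "(\<integral>k. F k x \<partial>count_space heads) = (\<Sum>\<^sub>\<infinity>y\<in>{y. (x, y) \<in> tail_rel G}. f (x, y))" .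
  qed
  finally show "integral\<^sup>L (fiber_measure \<mu>) f = first_functional G \<mu> f" .
qed

lemma sets_fiber_measure: "sets (fiber_measure \<mu>) = sets tail_borel"
  by (simp add: fiber_measure_def)

lemma integral_fiber_measure_swap:
  assumes "prob_space \<mu>" and \<mu>: "sets \<mu> = sets path_borel" and f: "tail_bounded f"
  shows "integrable (distr (fiber_measure \<mu>) tail_borel prod.swap) f"
    "integral\<^sup>L (distr (fiber_measure \<mu>) tail_borel prod.swap) f = second_functional G \<mu> f"
proof -
  have fm: "f \<in> borel_measurable tail_borel" using f by (simp add: tail_bounded_def)
  have sw: "prod.swap \<in> measurable (fiber_measure \<mu>) tail_borel"
    using measurable_swap_tail by (simp add: measurable_cong_sets[OF sets_fiber_measure refl])
  have "tail_bounded (f \<circ> prod.swap)"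
    unfolding tail_bounded_def
  proof (intro conjI)
    show "f \<circ> prod.swap \<in> borel_measurable tail_borel"
      using measurable_swap_tail fm by (rule measurable_comp)
    obtain C where "\<And>p. p \<in> tail_rel G \<Longrightarrow> \<bar>f p\<bar> \<le> C"
      using f unfolding tail_bounded_def by blast
    then show "\<exists>C. \<forall>p\<in>tail_rel G. \<bar>(f \<circ> prod.swap) p\<bar> \<le> C"
      using tail_rel_sym by (intro exI[of _ C]) auto
    obtain n where "\<And>p. p \<in> tail_rel G \<Longrightarrow> p \<notin> tail_rel_upto G n \<Longrightarrow> f p = 0"
      using f unfolding tail_bounded_def by blast
    then show "\<exists>n. \<forall>p\<in>tail_rel G - tail_rel_upto G n. (f \<circ> prod.swap) p = 0"
      using tail_rel_sym tail_rel_upto_sym by (intro exI[of _ n]) auto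
  qed
  note * = integral_fiber_measure[OF assms(1) \<mu> this]
  show "integrable (distr (fiber_measure \<mu>) tail_borel prod.swap) f"
    using *(1) by (simp add: integrable_distr_eq[OF sw fm] comp_def)
  show "integral\<^sup>L (distr (fiber_measure \<mu>) tail_borel prod.swap) f = second_functional G \<mu> f"
    using *(2) by (simp add: integral_distr[OF sw fm] second_functional_swap comp_def)
qed

end

section \<open>Conformal measures\<close>

locale weighted_bratteli = bratteli G for G :: "('v, 'e) bratteli" +
  fixes \<Phi> :: "'e \<Rightarrow> real" and D :: "(nat \<Rightarrow> 'e) \<times> (nat \<Rightarrow> 'e) \<Rightarrow> real"
  assumes weight_pos: "\<forall>n\<ge>1. \<forall>e\<in>edges G n. \<Phi> e > 0"
    and cocycle: "D \<in> cocycles G"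
    and D_eq: "\<forall>p\<in>tail_rel G. D p = quasi_product \<Phi> p"
begin

definition weight :: "nat \<Rightarrow> (nat \<Rightarrow> 'e) \<Rightarrow> real" where
  "weight n x = (\<Prod>k=1..n. \<Phi> (x k))"

lemma edge_weight_pos: "e \<in> edges G (Suc n) \<Longrightarrow> \<Phi> e > 0"
  using weight_pos by auto

lemma weight_pos_path: "x \<in> paths G \<Longrightarrow> weight n x > 0"
  unfolding weight_def using path_edge' weight_pos by (intro prod_pos) auto

lemma weight_0: "weight 0 x = 1"
  and weight_Suc: "weight (Suc n) x = weight n x * \<Phi> (x (Suc n))"
  by (simp_all add: weight_def)

lemma weight_cylinder: "y \<in> cylinder G x n \<Longrightarrow> weight n y = weight n x"
  unfolding weight_def by (intro prod.cong) (auto simp: cylinder_def)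

text \<open>The factors after index \<open>n\<close> coincide and cancel, so the sequence defining
  the cocycle is constant from \<open>n\<close> on.\<close>

lemma D_weight:
  assumes xy: "(x, y) \<in> tail_rel_upto G n"
  shows "D (x, y) = weight n x / weight n y"
proof -
  have x: "x \<in> paths G" and y: "y \<in> paths G" using xy by (auto simp: in_tail_rel_upto)
  have "weight N x / weight N y = weight n x / weight n y" if "n \<le> N" for N
    using that
  proof (induction rule: dec_induct)
    case (step i)
    have "\<Phi> (y (Suc i)) > 0" "x (Suc i) = y (Suc i)"
      using path_edge[OF y] edge_weight_pos xy step by (auto simp: in_tail_rel_upto)
    then show ?case using step by (simp add: weight_Suc)
  qed simp
  then have "eventually (\<lambda>N. weight N x / weight N y = weight n x / weight n y) sequentially"
    by (rule eventually_sequentiallyI)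
  then have "(\<lambda>N. weight N x / weight N y) \<longlonglongrightarrow> weight n x / weight n y"
    by (rule tendsto_eventually)
  moreover have "(x, y) \<in> tail_rel G" using xy tail_rel_upto_subset by blast
  ultimately show ?thesis
    using D_eq by (simp add: quasi_product_def weight_def limI)
qed

lemma D_pos: "p \<in> tail_rel G \<Longrightarrow> D p > 0"
  by (cases p) (auto simp: in_tail_rel D_weight in_tail_rel_upto weight_pos_path)

lemma D_measurable: "D \<in> borel_measurable tail_borel"
  using cocycle
  by (intro measurable_continuous_map_real) (auto simp: cocycles_def continuous_map_in_subtopology)

lemma D_tube:
  assumes "(s, t) \<in> tail_rel_upto G n" "p \<in> tube G s t n"
  shows "D p = weight n s / weight n t"
proof -
  obtain x y where p: "p = (x, y)" by (cases p)
  have "(x, y) \<in> tail_rel_upto G n" using assms p tube_subset by blast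
  moreover have "weight n x = weight n s" "weight n y = weight n t"
    using assms p by (auto simp: tube_def weight_cylinder)
  ultimately show ?thesis using D_weight p by simp
qed

text \<open>Equivalent infinite paths stand in for pairs of finite paths with a common range: any
  such pair arises by attaching the same tail to both.\<close>

definition conformal :: "(nat \<Rightarrow> 'e) measure \<Rightarrow> bool" where
  "conformal \<mu> \<longleftrightarrow> prob_space \<mu> \<and> sets \<mu> = sets path_borel \<and>
     (\<forall>n x y. (x, y) \<in> tail_rel_upto G n \<longrightarrow>
        measure \<mu> (cylinder G x n) = weight n x / weight n y * measure \<mu> (cylinder G y n))"

lemma density_tube:
  assumes st: "(s, t) \<in> tail_rel_upto G n" and \<nu>: "sets \<nu> = sets tail_borel"
  shows "emeasure (density \<nu> (\<lambda>p. ennreal (D p))) (tube G s t n) = ennreal (weight n s / weight n t) * emeasure \<nu> (tube G s t n)"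
proof -
  have Dm: "(\<lambda>p. ennreal (D p)) \<in> borel_measurable \<nu>"
    using D_measurable by (simp add: measurable_cong_sets[OF \<nu> refl])
  have W: "tube G s t n \<in> sets \<nu>" by (simp add: \<nu> tube_sets)
  have "emeasure (density \<nu> (\<lambda>p. ennreal (D p))) (tube G s t n) = (\<integral>\<^sup>+p. ennreal (D p) * indicator (tube G s t n) p \<partial>\<nu>)"
    using Dm W by (rule emeasure_density)
  also have "\<dots> = (\<integral>\<^sup>+p. ennreal (weight n s / weight n t) * indicator (tube G s t n) p \<partial>\<nu>)"
    using D_tube[OF st] by (intro nn_integral_cong) (auto simp: indicator_def)
  also have "\<dots> = ennreal (weight n s / weight n t) * emeasure \<nu> (tube G s t n)"
    using W by (rule nn_integral_cmult_indicator)
  finally show ?thesis .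
qed

lemma emeasure_tube:
  assumes \<nu>: "sets \<nu> = sets tail_borel" and int: "integrable \<nu> (indicator (tube G s t n) :: _ \<Rightarrow> real)"
    "integral\<^sup>L \<nu> (indicator (tube G s t n)) = r"
  shows "emeasure \<nu> (tube G s t n) = ennreal r"
proof -
  have W: "tube G s t n \<in> sets \<nu>" by (simp add: \<nu> tube_sets)
  then have "tube G s t n \<inter> space \<nu> = tube G s t n" by (simp add: sets.Int_space_eq2)
  then show ?thesis
    using int W by (simp add: integrable_indicator_iff emeasure_eq_ennreal_measure)
qed

text \<open>The representing measures are arbitrary, but indicators of tubes lie in
  \<open>tail_Cc G\<close>, so both measures are known on tubes. There \<open>D\<close> is constant,
  and the density identity becomes an equation between two cylinder measures.\<close>

lemma SD_conformal:
  assumes "\<mu> \<in> SD G D"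
  shows "conformal \<mu>"
proof -
  have prob: "prob_space \<mu>" and \<mu>: "sets \<mu> = sets path_borel"
    using assms by (auto simp: SD_def)
  obtain \<nu>1 \<nu>2 where \<nu>1: "represents G \<nu>1 (first_functional G \<mu>)" and \<nu>2: "represents G \<nu>2 (second_functional G \<mu>)"
    and dens: "\<nu>1 = density \<nu>2 (\<lambda>p. ennreal (D p))"
    using assms unfolding SD_def admits_RN_derivative_def by blast
  have "measure \<mu> (cylinder G s n) = weight n s / weight n t * measure \<mu> (cylinder G t n)"
    if st: "(s, t) \<in> tail_rel_upto G n" for s t n
  proof -
    have "emeasure \<nu>1 (tube G s t n) = ennreal (measure \<mu> (cylinder G s n))"
      using \<nu>1 indicator_tube_Cc[OF st] first_functional_tube[OF \<mu> st]
      by (intro emeasure_tube) (auto simp: represents_def)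
    moreover have "emeasure \<nu>2 (tube G s t n) = ennreal (measure \<mu> (cylinder G t n))"
      using \<nu>2 indicator_tube_Cc[OF st] second_functional_tube[OF \<mu> st]
      by (intro emeasure_tube) (auto simp: represents_def)
    moreover have "emeasure \<nu>1 (tube G s t n) = ennreal (weight n s / weight n t) * emeasure \<nu>2 (tube G s t n)"
      unfolding dens using st \<nu>2 by (intro density_tube) (auto simp: represents_def)
    moreover have "0 \<le> weight n s / weight n t"
      using st weight_pos_path[of s n] weight_pos_path[of t n] by (auto simp: in_tail_rel_upto)
    ultimately have "ennreal (measure \<mu> (cylinder G s n)) = ennreal (weight n s / weight n t * measure \<mu> (cylinder G t n))"
      by (simp only: ennreal_mult')
    then show ?thesis
      using \<open>0 \<le> weight n s / weight n t\<close>
      by (subst (asm) ennreal_inj) (simp_all only: mult_nonneg_nonneg measure_nonneg)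
  qed
  then show ?thesis using prob \<mu> by (auto simp: conformal_def)
qed

lemma tail_bounded_tube:
  assumes "(s, t) \<in> tail_rel_upto G n"
  shows "tail_bounded (indicator (tube G s t n))"
  using tail_Cc_bounded[OF indicator_tube_Cc[OF assms]] .

lemma conformal_SD:
  assumes "conformal \<mu>"
  shows "\<mu> \<in> SD G D"
proof -
  have prob: "prob_space \<mu>" and \<mu>: "sets \<mu> = sets path_borel"
    and conf: "\<And>n x y. (x, y) \<in> tail_rel_upto G n \<Longrightarrow>
        measure \<mu> (cylinder G x n) = weight n x / weight n y * measure \<mu> (cylinder G y n)"
    using assms by (auto simp: conformal_def)
  define \<nu>1 where "\<nu>1 = fiber_measure \<mu>"
  \<comment> \<open>The second functional is the first one after exchanging coordinates, so the flip
    of \<open>\<nu>1\<close> represents it.\<close>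
  define \<nu>2 where "\<nu>2 = distr \<nu>1 tail_borel prod.swap"
  have s1: "sets \<nu>1 = sets tail_borel" and s2: "sets \<nu>2 = sets tail_borel"
    by (simp_all add: \<nu>1_def \<nu>2_def sets_fiber_measure)
  have r1: "represents G \<nu>1 (first_functional G \<mu>)"
    unfolding represents_def using integral_fiber_measure[OF prob \<mu> tail_Cc_bounded] s1
    by (auto simp: \<nu>1_def)
  have r2: "represents G \<nu>2 (second_functional G \<mu>)"
    unfolding represents_def using integral_fiber_measure_swap[OF prob \<mu> tail_Cc_bounded] s2
    by (auto simp: \<nu>1_def \<nu>2_def)
  have t1: "emeasure \<nu>1 (tube G s t n) = ennreal (measure \<mu> (cylinder G s n))" if st: "(s, t) \<in> tail_rel_upto G n" for s t n
    using integral_fiber_measure[OF prob \<mu> tail_bounded_tube[OF st]] first_functional_tube[OF \<mu> st] s1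
    by (intro emeasure_tube) (auto simp: \<nu>1_def)
  have t2: "emeasure \<nu>2 (tube G s t n) = ennreal (measure \<mu> (cylinder G t n))" if st: "(s, t) \<in> tail_rel_upto G n" for s t n
    using integral_fiber_measure_swap[OF prob \<mu> tail_bounded_tube[OF st]] second_functional_tube[OF \<mu> st] s2
    by (intro emeasure_tube) (auto simp: \<nu>1_def \<nu>2_def)
  \<comment> \<open>Conformality gives equality on tubes; countably many tubes of finite measure
    cover the tail relation, so agreement on this \<pi>-system is enough.\<close>
  have dens: "\<nu>1 = density \<nu>2 (\<lambda>p. ennreal (D p))"
  proof (rule measure_eqI_generator_eq_countable[OF Int_stable_tubes, where A = tubes and \<Omega> = "tail_rel G"])
    have sub: "tubes \<subseteq> Pow (tail_rel G)"
      using tube_subset tail_rel_upto_subset by (fastforce simp: tubes_def)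
    then show "insert {} tubes \<subseteq> Pow (tail_rel G)" by simp
    show "emeasure \<nu>1 X = emeasure (density \<nu>2 (\<lambda>p. ennreal (D p))) X" if X: "X \<in> insert {} tubes" for X
    proof (cases "X = {}")
      case False
      then obtain s t n where st: "X = tube G s t n" "(s, t) \<in> tail_rel_upto G n"
        using X by (auto simp: tubes_def)
      have "0 \<le> weight n s / weight n t"
        using st weight_pos_path[of s n] weight_pos_path[of t n] by (auto simp: in_tail_rel_upto)
      then show ?thesis
        unfolding st(1) density_tube[OF st(2) s2] t1[OF st(2)] t2[OF st(2)] conf[OF st(2)]
        by (simp only: ennreal_mult')
    qed simp
    have *: "sigma_sets (tail_rel G) (insert {} tubes) = sigma_sets (tail_rel G) tubes"
      by (rule sigma_sets_eqI) (auto intro: sigma_sets.Empty)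
    show "sets \<nu>1 = sigma_sets (tail_rel G) (insert {} tubes)"
      by (simp add: s1 sets_tail_borel *)
    show "sets (density \<nu>2 (\<lambda>p. ennreal (D p))) = sigma_sets (tail_rel G) (insert {} tubes)"
      by (simp add: s2 sets_tail_borel *)
    show "\<Union>tubes = tail_rel G"
    proof
      show "\<Union>tubes \<subseteq> tail_rel G" using sub by blast
      show "tail_rel G \<subseteq> \<Union>tubes"
      proof
        fix p assume "p \<in> tail_rel G"
        then obtain x y n where "p = (x, y)" "(x, y) \<in> tail_rel_upto G n"
          by (cases p) (auto simp: in_tail_rel)
        then show "p \<in> \<Union>tubes"
          using tube_self by (auto simp: tubes_def)
      qed
    qed
    show "emeasure \<nu>1 a \<noteq> \<infinity>" if "a \<in> tubes" for a
      using that t1 by (auto simp: tubes_def)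
  qed (auto simp: countable_tubes)
  have sp2: "space \<nu>2 = tail_rel G" by (simp add: \<nu>2_def space_tail_borel)
  have Dm: "(\<lambda>p. ennreal (D p)) \<in> borel_measurable \<nu>2"
    using D_measurable by (simp add: measurable_cong_sets[OF s2 refl])
  have ac21: "absolutely_continuous \<nu>2 \<nu>1"
    unfolding dens using Dm by (rule absolutely_continuousI_density)
  \<comment> \<open>Strict positivity of \<open>D\<close> is what turns null sets of the density
    into null sets of \<open>\<nu>2\<close>.\<close>
  have ac12: "absolutely_continuous \<nu>1 \<nu>2"
    unfolding absolutely_continuous_def
  proof
    fix A assume "A \<in> null_sets \<nu>1"
    then have A: "A \<in> sets \<nu>2" "AE p in \<nu>2. p \<in> A \<longrightarrow> ennreal (D p) = 0"
      unfolding dens null_sets_density_iff[OF Dm] by auto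
    have "AE p in \<nu>2. p \<notin> A"
      using A(2) AE_space by eventually_elim (use D_pos sp2 in \<open>force simp: ennreal_eq_0_iff\<close>)
    then show "A \<in> null_sets \<nu>2"
      using AE_iff_null_sets[OF A(1)] by simp
  qed
  show ?thesis
    unfolding SD_def quasi_invariant_def admits_RN_derivative_def
    using prob \<mu> r1 r2 dens ac12 ac21 by blast
qed

lemma SD_iff: "\<mu> \<in> SD G D \<longleftrightarrow> conformal \<mu>"
  using SD_conformal conformal_SD by blast


section \<open>Conformal measures and harmonic functions on vertices\<close>

abbreviation out_edges :: "nat \<Rightarrow> 'v \<Rightarrow> 'e set" where
  "out_edges n v \<equiv> {e \<in> edges G (Suc n). src G e = v}"

text \<open>\<open>c n v\<close> is the measure per unit weight of a cylinder ending at
  \<open>v\<close>. The equation is kept edge by edge, the form in which a cylinder splits;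
  \<open>sum_out_edges_Amat\<close> later collects parallel edges into \<open>Amat\<close>.\<close>

definition harmonic :: "(nat \<Rightarrow> 'v \<Rightarrow> real) \<Rightarrow> bool" where
  "harmonic c \<longleftrightarrow> (\<forall>n. \<forall>v\<in>verts G n. 0 \<le> c n v \<and> c n v = (\<Sum>e\<in>out_edges n v. \<Phi> e * c (Suc n) (rng G e))) \<and>
     (\<Sum>v\<in>verts G 0. c 0 v) = 1"

text \<open>Levels start at 1 because a cylinder of length 0 has no final vertex.\<close>

definition realizes :: "(nat \<Rightarrow> 'e) measure \<Rightarrow> (nat \<Rightarrow> 'v \<Rightarrow> real) \<Rightarrow> bool" where
  "realizes \<mu> c \<longleftrightarrow> prob_space \<mu> \<and> sets \<mu> = sets path_borel \<and>
     (\<forall>n\<ge>1. \<forall>x\<in>paths G. measure \<mu> (cylinder G x n) = weight n x * c n (rng G (x n)))"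

lemma path_rng:
  assumes "x \<in> paths G" "1 \<le> n"
  shows "rng G (x n) \<in> verts G n"
  using path_edge[OF assms(1), of "n - 1", THEN edge_rng] assms(2) by simp

lemma sum_out_edges:
  "(\<Sum>v\<in>verts G n. \<Sum>e\<in>out_edges n v. f e) = (\<Sum>e\<in>edges G (Suc n). f e)"
  using sum.group[OF finite_edges finite_verts, of "src G" n n f] edge_src by blast

lemma realizes_conformal:
  assumes "realizes \<mu> c"
  shows "conformal \<mu>"
proof -
  have "measure \<mu> (cylinder G x n) = weight n x / weight n y * measure \<mu> (cylinder G y n)"
    if xy: "(x, y) \<in> tail_rel_upto G n" for x y n
  proof (cases "n = 0")
    case True
    then show ?thesis by (simp add: cylinder_0 weight_0)
  next
    case False
    have "x \<in> paths G" "y \<in> paths G" using xy by (auto simp: in_tail_rel_upto)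
    moreover have "rng G (x n) = rng G (y n)" using xy False by (intro tail_rel_upto_rng) auto
    ultimately show ?thesis
      using assms False weight_pos_path[of y n] by (simp add: realizes_def)
  qed
  then show ?thesis using assms by (auto simp: realizes_def conformal_def)
qed

text \<open>Covers two cases at once: a cylinder split by its next edge, and the whole space split
  by the first edge.\<close>

lemma measure_next_edge:
  assumes "prob_space \<mu>" and \<mu>: "sets \<mu> = sets path_borel" and A: "A \<in> sets path_borel" and F: "finite F"
    and "\<And>x. x \<in> A \<Longrightarrow> x k \<in> F"
    and z: "\<And>e. e \<in> F \<Longrightarrow> {x \<in> A. x k = e} = cylinder G (z e) n"
  shows "measure \<mu> A = (\<Sum>e\<in>F. measure \<mu> (cylinder G (z e) n))"
proof -
  interpret prob_space \<mu> by fact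
  have "A = (\<Union>e\<in>F. {x \<in> A. x k = e})" using assms(5) by blast
  also have "\<dots> = (\<Union>e\<in>F. cylinder G (z e) n)" using z by simp
  finally have "A = (\<Union>e\<in>F. cylinder G (z e) n)" .
  moreover have "disjoint_family_on (\<lambda>e. cylinder G (z e) n) F"
    by (auto simp: disjoint_family_on_def z[symmetric])
  moreover have "(\<lambda>e. cylinder G (z e) n) ` F \<subseteq> sets \<mu>"
    using cylinder_sets \<mu> by auto
  ultimately show ?thesis
    using finite_measure_finite_Union[OF F] by metis
qed

lemma measure_cylinder_split:
  assumes "prob_space \<mu>" and \<mu>: "sets \<mu> = sets path_borel" and x: "x \<in> paths G" and n: "1 \<le> n"
    and z: "\<And>e. e \<in> out_edges n (rng G (x n)) \<Longrightarrow> z e \<in> cylinder G x n \<and> z e (Suc n) = e"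
  shows "measure \<mu> (cylinder G x n) = (\<Sum>e\<in>out_edges n (rng G (x n)). measure \<mu> (cylinder G (z e) (Suc n)))"
proof (rule measure_next_edge[OF assms(1,2) cylinder_sets, where k = "Suc n"])
  show "finite (out_edges n (rng G (x n)))" using finite_edges by simp
  show "y (Suc n) \<in> out_edges n (rng G (x n))" if "y \<in> cylinder G x n" for y
    using that path_link'[of y n] path_edge[of y n] n by (auto simp: cylinder_def)
  show "{y \<in> cylinder G x n. y (Suc n) = e} = cylinder G (z e) (Suc n)" if "e \<in> out_edges n (rng G (x n))" for e
    using z[OF that] by (auto simp: cylinder_def atLeastAtMostSuc_conv)
qed

text \<open>A reference path through each vertex defines \<open>c\<close>. Conformality makes the
  value independent of the reference, and additivity over the next edge is harmonicity.\<close>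

lemma conformal_realizes:
  assumes "conformal \<mu>"
  shows "\<exists>c. harmonic c \<and> realizes \<mu> c"
proof -
  have prob: "prob_space \<mu>" and \<mu>: "sets \<mu> = sets path_borel"
    and conf: "\<And>n x y. (x, y) \<in> tail_rel_upto G n \<Longrightarrow>
        measure \<mu> (cylinder G x n) = weight n x / weight n y * measure \<mu> (cylinder G y n)"
    using assms by (auto simp: conformal_def)
  define X where "X n v = (SOME x. x \<in> paths G \<and> src G (x (Suc n)) = v)" for n v
  have X: "X n v \<in> paths G \<and> src G (X n v (Suc n)) = v" if "v \<in> verts G n" for n v
  proof -
    have "\<exists>x. x \<in> paths G \<and> src G (x (Suc n)) = v" using vertex_on_path[OF that] by blast
    from someI_ex[OF this] show ?thesis by (simp add: X_def)
  qed
  define c1 where "c1 n v = measure \<mu> (cylinder G (X n v) n) / weight n (X n v)" for n v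
  \<comment> \<open>No cylinder determines a value at level 0, so there the harmonic equation itself
    serves as the definition.\<close>
  define c where "c n v = (if n = 0 then \<Sum>e\<in>out_edges 0 v. \<Phi> e * c1 1 (rng G e) else c1 n v)" for n v
  have c: "measure \<mu> (cylinder G x n) = weight n x * c n (rng G (x n))" if n: "1 \<le> n" and x: "x \<in> paths G" for n x
  proof -
    let ?z = "X n (rng G (x n))"
    have z: "?z \<in> paths G" "rng G (?z n) = rng G (x n)"
      using X[OF path_rng[OF x n]] path_link'[of ?z n] n by auto
    \<comment> \<open>The head of the reference path followed by the tail of \<open>x\<close>:
      equivalent to \<open>x\<close>, while its cylinder is that of the reference path.\<close>
    define y where "y = splice n ?z x"
    have "y \<in> paths G" unfolding y_def using z x by (intro splice_path) auto
    then have y: "y \<in> cylinder G ?z n" and "(x, y) \<in> tail_rel_upto G n"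
      using x by (auto simp: cylinder_def y_def splice_def in_tail_rel_upto)
    then have "measure \<mu> (cylinder G x n) = weight n x / weight n ?z * measure \<mu> (cylinder G ?z n)"
      using conf[of x y n] cylinder_eq[OF y order_refl] weight_cylinder[OF y] by simp
    then show ?thesis using n by (simp add: c_def c1_def)
  qed
  then have real: "realizes \<mu> c" using prob \<mu> by (simp add: realizes_def)
  have step: "c n v = (\<Sum>e\<in>out_edges n v. \<Phi> e * c (Suc n) (rng G e))" if v: "v \<in> verts G n" for n v
  proof (cases "n = 0")
    case True
    then show ?thesis by (simp add: c_def)
  next
    case False
    obtain x where x: "x \<in> paths G" "rng G (x n) = v"
      using X[OF v] path_link'[of "X n v" n] False by auto
    have "\<exists>z. e \<in> out_edges n v \<longrightarrow> z \<in> cylinder G x n \<and> z (Suc n) = e" for e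
      using path_extends[OF x(1), of n e] x(2) False by auto
    then obtain z where z: "\<And>e. e \<in> out_edges n v \<Longrightarrow> z e \<in> cylinder G x n \<and> z e (Suc n) = e"
      by metis
    have "weight n x * c n v = measure \<mu> (cylinder G x n)"
      using c[of n x] x False by simp
    also have "\<dots> = (\<Sum>e\<in>out_edges n v. measure \<mu> (cylinder G (z e) (Suc n)))"
      using measure_cylinder_split[OF prob \<mu> x(1), of n z] z x(2) False by simp
    also have "\<dots> = (\<Sum>e\<in>out_edges n v. weight n x * (\<Phi> e * c (Suc n) (rng G e)))"
    proof (rule sum.cong[OF refl])
      fix e assume e: "e \<in> out_edges n v"
      then have "z e \<in> paths G" using z cylinder_subset by blast
      then show "measure \<mu> (cylinder G (z e) (Suc n)) = weight n x * (\<Phi> e * c (Suc n) (rng G e))"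
        using c[of "Suc n" "z e"] z[OF e] weight_cylinder[of "z e" x n] by (simp add: weight_Suc)
    qed
    also have "\<dots> = weight n x * (\<Sum>e\<in>out_edges n v. \<Phi> e * c (Suc n) (rng G e))"
      by (simp add: sum_distrib_left)
    finally show ?thesis
      using weight_pos_path[OF x(1), of n] by simp
  qed
  have nonneg: "0 \<le> c n v" if v: "v \<in> verts G n" for n v
  proof -
    have *: "0 \<le> c n v" if v: "v \<in> verts G n" "n \<noteq> 0" for n v
    proof -
      have "weight n (X n v) > 0" using X[OF v(1)] weight_pos_path by blast
      then show ?thesis using v by (simp add: c_def c1_def)
    qed
    show ?thesis
    proof (cases "n = 0")
      case True
      have "0 \<le> \<Phi> e * c (Suc 0) (rng G e)" if "e \<in> out_edges 0 v" for e
        using that edge_weight_pos[of e 0] *[of "rng G e" "Suc 0"] edge_rng[of e 0] by simp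
      then have "0 \<le> (\<Sum>e\<in>out_edges 0 v. \<Phi> e * c (Suc 0) (rng G e))"
        by (rule sum_nonneg)
      then show ?thesis
        using step[OF v] True by simp
    qed (use * v in auto)
  qed
  have "(\<Sum>v\<in>verts G 0. c 0 v) = (\<Sum>e\<in>edges G (Suc 0). \<Phi> e * c (Suc 0) (rng G e))"
    using step[of _ 0] sum_out_edges[of "\<lambda>e. \<Phi> e * c (Suc 0) (rng G e)" 0] by simp
  also have "\<dots> = 1"
  proof -
    have "\<exists>z. e \<in> edges G (Suc 0) \<longrightarrow> z \<in> paths G \<and> z (Suc 0) = e" for e
      using first_edge_extends by blast
    then obtain z where z: "\<And>e. e \<in> edges G (Suc 0) \<Longrightarrow> z e \<in> paths G \<and> z e (Suc 0) = e"
      by metis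
    have "1 = measure \<mu> (paths G)"
      using prob_space.prob_space[OF prob] sets_eq_imp_space_eq[OF \<mu>] by (simp add: space_path_borel)
    also have "\<dots> = (\<Sum>e\<in>edges G (Suc 0). measure \<mu> (cylinder G (z e) 1))"
    proof (rule measure_next_edge[OF prob \<mu>, where k = "Suc 0"])
      show "paths G \<in> sets path_borel" using cylinder_sets[of _ 0] by (simp add: cylinder_0)
      show "{x \<in> paths G. x (Suc 0) = e} = cylinder G (z e) 1" if "e \<in> edges G (Suc 0)" for e
        using z[OF that] by (auto simp: cylinder_def)
    qed (use path_edge finite_edges in auto)
    also have "\<dots> = (\<Sum>e\<in>edges G (Suc 0). \<Phi> e * c (Suc 0) (rng G e))"
      using z c[of 1] by (intro sum.cong) (auto simp: weight_def)
    finally show ?thesis by simp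
  qed
  finally have "harmonic c"
    using step nonneg unfolding harmonic_def by blast
  then show ?thesis using real by blast
qed

lemma path_to_vertex:
  assumes "v \<in> verts G n" "1 \<le> n"
  shows "\<exists>x\<in>paths G. rng G (x n) = v"
  using vertex_on_path[OF assms(1)] path_link' assms(2) by metis

lemma paths_nonempty: "paths G \<noteq> {}"
  using verts_nonempty[of 0] vertex_on_path by blast

text \<open>Cylinders that meet are nested, so with the empty set they form a \<pi>-system; length 0
  is settled by total mass 1.\<close>

lemma realizes_unique:
  assumes r: "realizes \<mu> c" and r': "realizes \<mu>' c'"
    and eq: "\<And>n v. v \<in> verts G n \<Longrightarrow> c n v = c' n v"
  shows "\<mu> = \<mu>'"
proof -
  interpret \<mu>: prob_space \<mu> using r by (simp add: realizes_def)
  interpret \<mu>': prob_space \<mu>' using r' by (simp add: realizes_def)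
  have s: "sets \<mu> = sets path_borel" "sets \<mu>' = sets path_borel"
    using r r' by (auto simp: realizes_def)
  let ?C = "{cylinder G x n | x n. x \<in> paths G}"
  have *: "sigma_sets (paths G) (insert {} ?C) = sigma_sets (paths G) ?C"
    by (rule sigma_sets_eqI) (auto intro: sigma_sets.Empty)
  show ?thesis
  proof (rule measure_eqI_generator_eq_countable[where E = "insert {} ?C" and A = "{paths G}" and \<Omega> = "paths G"])
    have int: "cylinder G x m \<inter> cylinder G y n \<in> insert {} ?C" if "m \<le> n" "y \<in> paths G" for x y m n
    proof (cases "cylinder G x m \<inter> cylinder G y n = {}")
      case False
      then obtain z where "z \<in> cylinder G x m" "z \<in> cylinder G y n" by blast
      then have "cylinder G x m \<inter> cylinder G y n = cylinder G y n"
        using cylinder_eq[of z x m m] cylinder_eq[of z y n n] cylinder_mono[OF that(1), of z] by auto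
      then show ?thesis using that by auto
    qed simp
    show "Int_stable (insert {} ?C)"
      unfolding Int_stable_def
    proof (intro ballI)
      fix a b assume ab: "a \<in> insert {} ?C" "b \<in> insert {} ?C"
      show "a \<inter> b \<in> insert {} ?C"
      proof (cases "a = {} \<or> b = {}")
        case False
        with ab obtain x m y n where "a = cylinder G x m" "x \<in> paths G" "b = cylinder G y n" "y \<in> paths G"
          by blast
        then show ?thesis
          using int[of m n y x] int[of n m x y] by (cases "m \<le> n") (simp_all add: Int_commute)
      qed auto
    qed
    show "insert {} ?C \<subseteq> Pow (paths G)" using cylinder_subset by blast
    show "sets \<mu> = sigma_sets (paths G) (insert {} ?C)" "sets \<mu>' = sigma_sets (paths G) (insert {} ?C)"
      unfolding * by (simp_all add: s sets_path_borel)
    obtain x0 where "x0 \<in> paths G" using paths_nonempty by blast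
    then show "{paths G} \<subseteq> insert {} ?C"
      using cylinder_0[of x0] by blast
    show "emeasure \<mu> X = emeasure \<mu>' X" if XC: "X \<in> insert {} ?C" for X
    proof (cases "X = {}")
      case False
      then obtain x n where X: "X = cylinder G x n" "x \<in> paths G" using XC by blast
      have sp: "space \<mu> = paths G" "space \<mu>' = paths G"
        using s[THEN sets_eq_imp_space_eq] by (simp_all add: space_path_borel)
      have "measure \<mu> X = measure \<mu>' X"
      proof (cases "n = 0")
        case True
        then show ?thesis
          using \<mu>.prob_space \<mu>'.prob_space by (simp add: X cylinder_0 sp)
      next
        case False
        have "rng G (x n) \<in> verts G n"
          using path_rng[OF X(2)] False by simp
        then show ?thesis
          using r r' eq False X by (simp add: realizes_def)
      qed
      then show ?thesis by (simp add: \<mu>.emeasure_eq_measure \<mu>'.emeasure_eq_measure)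
    qed simp
  qed simp_all
qed

text \<open>Every vertex of level at least 1 ends some finite path of positive weight, whose
  cylinder fixes \<open>c\<close> there; level 0 follows from the harmonic equation.\<close>

lemma realizes_determines:
  assumes r: "realizes \<mu> c" "harmonic c" and r': "realizes \<mu> c'" "harmonic c'" and v: "v \<in> verts G n"
  shows "c n v = c' n v"
proof -
  have pos: "c n v = c' n v" if v: "v \<in> verts G n" and n: "1 \<le> n" for n v
  proof -
    obtain x where x: "x \<in> paths G" "rng G (x n) = v" using path_to_vertex[OF v n] by blast
    then have "weight n x * c n v = weight n x * c' n v"
      using r r' n by (metis realizes_def)
    then show ?thesis using weight_pos_path[OF x(1), of n] by simp
  qed
  have "c n v = (\<Sum>e\<in>out_edges n v. \<Phi> e * c (Suc n) (rng G e))"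
    using r v by (simp add: harmonic_def)
  also have "\<dots> = (\<Sum>e\<in>out_edges n v. \<Phi> e * c' (Suc n) (rng G e))"
    using pos edge_rng by (intro sum.cong) auto
  also have "\<dots> = c' n v"
    using r' v by (simp add: harmonic_def)
  finally show ?thesis .
qed

end

section \<open>Stochastic matrices and consistent sequences\<close>

context weighted_bratteli
begin

abbreviation A where "A \<equiv> Amat G \<Phi>"
abbreviation B where "B \<equiv> Bmat G \<Phi>"
abbreviation u where "u \<equiv> uvec G \<Phi>"

lemma Amat_nonneg: "0 \<le> A (Suc n) w v"
  unfolding Amat_def using edge_weight_pos by (intro sum_nonneg) (auto intro: less_imp_le)

lemma Amat_edge_pos: "e \<in> edges G (Suc n) \<Longrightarrow> 0 < A (Suc n) (rng G e) (src G e)"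
  unfolding Amat_def using edge_weight_pos finite_edges[of n]
  by (intro sum_pos2[of _ e]) (auto intro: less_imp_le)

lemma sum_out_edges_Amat:
  assumes v: "v \<in> verts G n"
  shows "(\<Sum>e\<in>out_edges n v. \<Phi> e * h (rng G e)) = (\<Sum>w\<in>verts G (Suc n). A (Suc n) w v * h w)"
proof -
  have "(\<Sum>w\<in>verts G (Suc n). A (Suc n) w v * h w) = (\<Sum>w\<in>verts G (Suc n). \<Sum>e\<in>{e \<in> out_edges n v. rng G e = w}. \<Phi> e * h (rng G e))"
    unfolding Amat_def sum_distrib_right by (intro sum.cong) auto
  also have "\<dots> = (\<Sum>e\<in>out_edges n v. \<Phi> e * h (rng G e))"
    by (rule sum.group) (use finite_edges finite_verts edge_rng in auto)
  finally show ?thesis by simp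
qed

lemma uvec_Suc: "u (Suc n) w = (\<Sum>t\<in>verts G n. A (Suc n) w t * u n t)"
proof -
  have "u (Suc n) w = (\<Sum>v\<in>verts G 0. \<Sum>t\<in>verts G n. A (Suc n) w t * mat_prod G A 0 n t v)"
    by (simp add: uvec_def)
  also have "\<dots> = (\<Sum>t\<in>verts G n. A (Suc n) w t * (\<Sum>v\<in>verts G 0. mat_prod G A 0 n t v))"
    by (subst sum.swap) (simp add: sum_distrib_left)
  also have "\<dots> = (\<Sum>t\<in>verts G n. A (Suc n) w t * u n t)"
    by (intro sum.cong) (auto simp: uvec_def sum.delta finite_verts)
  finally show ?thesis .
qed

text \<open>Rests on every vertex above level 0 receiving an edge; it makes the normalisation in
  \<open>Bmat\<close> legitimate.\<close>

lemma uvec_pos: "w \<in> verts G n \<Longrightarrow> 0 < u n w"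
proof (induction n arbitrary: w)
  case 0
  then show ?case by (simp add: uvec_def)
next
  case (Suc n)
  obtain e where e: "e \<in> edges G (Suc n)" "rng G e = w" using edge_to[OF Suc.prems] by blast
  have "0 < A (Suc n) w (src G e) * u n (src G e)"
    using Amat_edge_pos[OF e(1)] Suc.IH[OF edge_src[OF e(1)]] e(2) by simp
  then show ?case
    unfolding uvec_Suc using Suc.IH Amat_nonneg edge_src[OF e(1)]
    by (intro sum_pos2[of _ "src G e"]) (auto simp: finite_verts less_imp_le)
qed

lemma Bmat_Suc: "B (Suc n) w v = A (Suc n) w v * u n v / u (Suc n) w"
  by (simp add: Bmat_def divide_inverse)

lemma Bmat_nonneg: "w \<in> verts G (Suc n) \<Longrightarrow> v \<in> verts G n \<Longrightarrow> 0 \<le> B (Suc n) w v"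
  using uvec_pos[of w "Suc n"] uvec_pos[of v n] Amat_nonneg[of n w v] by (simp add: Bmat_Suc)

lemma Bmat_stochastic:
  assumes "w \<in> verts G (Suc n)"
  shows "(\<Sum>v\<in>verts G n. B (Suc n) w v) = 1"
  using uvec_pos[OF assms] by (simp add: Bmat_Suc sum_divide_distrib[symmetric] uvec_Suc[symmetric])

definition consistent :: "(nat \<Rightarrow> 'v \<Rightarrow> real) \<Rightarrow> bool" where
  "consistent p \<longleftrightarrow> (\<forall>n. \<forall>v\<in>verts G n. 0 \<le> p n v \<and> p n v = (\<Sum>w\<in>verts G (Suc n). p (Suc n) w * B (Suc n) w v)) \<and>
     (\<forall>n. (\<Sum>v\<in>verts G n. p n v) = 1)"

lemma consistentD:
  assumes "consistent p"
  shows "v \<in> verts G n \<Longrightarrow> 0 \<le> p n v"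
    and "v \<in> verts G n \<Longrightarrow> p n v = (\<Sum>w\<in>verts G (Suc n). p (Suc n) w * B (Suc n) w v)"
    and "(\<Sum>v\<in>verts G n. p n v) = 1"
  using assms unfolding consistent_def by blast+

text \<open>Stochastic rows preserve total mass, so normalisation at level 0 propagates to all
  levels.\<close>

lemma sum_consistent:
  assumes "\<And>n v. v \<in> verts G n \<Longrightarrow> p n v = (\<Sum>w\<in>verts G (Suc n). p (Suc n) w * B (Suc n) w v)"
  shows "(\<Sum>v\<in>verts G (Suc n). p (Suc n) v) = (\<Sum>v\<in>verts G n. p n v)"
proof -
  have "(\<Sum>v\<in>verts G n. p n v) = (\<Sum>w\<in>verts G (Suc n). \<Sum>v\<in>verts G n. p (Suc n) w * B (Suc n) w v)"
    using assms by (simp add: sum.swap[of _ "verts G n"])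
  also have "\<dots> = (\<Sum>w\<in>verts G (Suc n). p (Suc n) w)"
    by (intro sum.cong) (simp_all add: sum_distrib_left[symmetric] Bmat_stochastic)
  finally show ?thesis by simp
qed

text \<open>Multiplication by the positive \<open>u n v\<close> trades \<open>A\<close> for
  \<open>B\<close>: the factor \<open>u (Suc n) w\<close> cancels the denominator of
  \<open>B (Suc n) w v\<close>.\<close>

lemma harmonic_step_iff:
  assumes v: "v \<in> verts G n"
  shows "c n v = (\<Sum>e\<in>out_edges n v. \<Phi> e * c (Suc n) (rng G e)) \<longleftrightarrow>
    u n v * c n v = (\<Sum>w\<in>verts G (Suc n). u (Suc n) w * c (Suc n) w * B (Suc n) w v)"
proof -
  have "(\<Sum>w\<in>verts G (Suc n). u (Suc n) w * c (Suc n) w * B (Suc n) w v) = u n v * (\<Sum>w\<in>verts G (Suc n). A (Suc n) w v * c (Suc n) w)"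
    unfolding sum_distrib_left
  proof (rule sum.cong[OF refl])
    fix w assume "w \<in> verts G (Suc n)"
    then have "u (Suc n) w \<noteq> 0" using uvec_pos by fastforce
    then show "u (Suc n) w * c (Suc n) w * B (Suc n) w v = u n v * (A (Suc n) w v * c (Suc n) w)"
      by (simp add: Bmat_Suc)
  qed
  then show ?thesis
    unfolding sum_out_edges_Amat[OF v] using uvec_pos[OF v] by simp
qed

lemma harmonic_consistent:
  assumes "harmonic c"
  shows "consistent (\<lambda>n v. u n v * c n v)"
proof -
  have step: "u n v * c n v = (\<Sum>w\<in>verts G (Suc n). u (Suc n) w * c (Suc n) w * B (Suc n) w v)" if "v \<in> verts G n" for n v
    using assms harmonic_step_iff[OF that, of c] that unfolding harmonic_def by blast
  have "(\<Sum>v\<in>verts G n. u n v * c n v) = 1" for n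
  proof (induction n)
    case 0
    have "(\<Sum>v\<in>verts G 0. c 0 v) = 1" using assms unfolding harmonic_def by blast
    then show ?case by (simp add: uvec_def)
  next
    case (Suc n)
    then show ?case using sum_consistent[of "\<lambda>n v. u n v * c n v" n] step by simp
  qed
  moreover have "0 \<le> u n v * c n v" if "v \<in> verts G n" for n v
  proof -
    have "0 \<le> c n v" using assms that unfolding harmonic_def by blast
    then show ?thesis using uvec_pos[OF that] by simp
  qed
  ultimately show ?thesis
    using step unfolding consistent_def by blast
qed

lemma consistent_harmonic:
  assumes "consistent p"
  shows "harmonic (\<lambda>n v. p n v / u n v)"
proof -
  have u0: "u n v \<noteq> 0" if "v \<in> verts G n" for n v using uvec_pos[OF that] by simp
  have "p n v / u n v = (\<Sum>e\<in>out_edges n v. \<Phi> e * (p (Suc n) (rng G e) / u (Suc n) (rng G e)))" if v: "v \<in> verts G n" for n v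
  proof -
    have "u n v * (p n v / u n v) = (\<Sum>w\<in>verts G (Suc n). p (Suc n) w * B (Suc n) w v)"
      using u0[OF v] consistentD(2)[OF assms v] by simp
    also have "\<dots> = (\<Sum>w\<in>verts G (Suc n). u (Suc n) w * (p (Suc n) w / u (Suc n) w) * B (Suc n) w v)"
      using u0 by (intro sum.cong) auto
    finally show ?thesis
      using harmonic_step_iff[OF v, of "\<lambda>n v. p n v / u n v"] by blast
  qed
  moreover have "0 \<le> p n v / u n v" if "v \<in> verts G n" for n v
    using consistentD(1)[OF assms that] uvec_pos[OF that] by simp
  moreover have "(\<Sum>v\<in>verts G 0. p 0 v / u 0 v) = 1"
    using consistentD(3)[OF assms, of 0] by (simp add: uvec_def)
  ultimately show ?thesis
    unfolding harmonic_def by blast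
qed

section \<open>Products of the stochastic matrices\<close>

abbreviation BP where "BP \<equiv> mat_prod G B"

lemma BP_self: "BP m m w v = (if w = v then 1 else 0)"
  by (cases m) auto

lemma BP_Suc: "m \<le> n \<Longrightarrow> BP m (Suc n) w v = (\<Sum>t\<in>verts G n. B (Suc n) w t * BP m n t v)"
  by simp

declare mat_prod.simps [simp del]

lemma BP_nonneg: "m \<le> n \<Longrightarrow> w \<in> verts G n \<Longrightarrow> 0 \<le> BP m n w v"
proof (induction n arbitrary: w rule: dec_induct)
  case (step n)
  then show ?case
    by (auto simp: BP_Suc intro!: sum_nonneg mult_nonneg_nonneg Bmat_nonneg)
qed (simp add: BP_self)

lemma BP_stochastic: "m \<le> n \<Longrightarrow> w \<in> verts G n \<Longrightarrow> (\<Sum>v\<in>verts G m. BP m n w v) = 1"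
proof (induction n arbitrary: w rule: dec_induct)
  case base
  then show ?case by (simp add: BP_self sum.delta finite_verts)
next
  case (step n)
  have "(\<Sum>v\<in>verts G m. BP m (Suc n) w v) = (\<Sum>t\<in>verts G n. B (Suc n) w t * (\<Sum>v\<in>verts G m. BP m n t v))"
    using step.hyps by (simp add: BP_Suc sum_distrib_left) (rule sum.swap)
  then show ?case using step by (simp add: Bmat_stochastic)
qed

lemma BP_le_1:
  assumes "m \<le> n" "w \<in> verts G n" "v \<in> verts G m"
  shows "BP m n w v \<le> 1"
  using member_le_sum[of v "verts G m" "BP m n w"] BP_nonneg[OF assms(1,2)] BP_stochastic[OF assms(1,2)] assms(3) finite_verts
  by auto

text \<open>The recursion of \<open>mat_prod\<close> peels off the factor of the highest level,
  whereas limits of the consistency equation need the factor of the lowest one. This is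
  associativity.\<close>

lemma BP_split_last:
  assumes "Suc m \<le> n" "v \<in> verts G m" "w \<in> verts G n"
  shows "BP m n w v = (\<Sum>t\<in>verts G (Suc m). BP (Suc m) n w t * B (Suc m) t v)"
  using assms(1,3)
proof (induction n arbitrary: w rule: dec_induct)
  case base
  have "BP m (Suc m) w v = B (Suc m) w v"
    using assms(2) by (simp add: BP_Suc BP_self if_distrib[of "(*) _"] sum.delta finite_verts cong: if_cong)
  also have "\<dots> = (\<Sum>t\<in>verts G (Suc m). BP (Suc m) (Suc m) w t * B (Suc m) t v)"
    using base by (simp add: BP_self if_distrib[of "\<lambda>x. x * _"] sum.delta finite_verts cong: if_cong)
  finally show ?case .
next
  case (step n)
  have "BP m (Suc n) w v = (\<Sum>s\<in>verts G n. B (Suc n) w s * (\<Sum>t\<in>verts G (Suc m). BP (Suc m) n s t * B (Suc m) t v))"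
    using step by (simp add: BP_Suc)
  also have "\<dots> = (\<Sum>t\<in>verts G (Suc m). (\<Sum>s\<in>verts G n. B (Suc n) w s * BP (Suc m) n s t) * B (Suc m) t v)"
    by (simp add: sum_distrib_left sum_distrib_right mult.assoc sum.swap[of _ "verts G n"])
  finally show ?case using step by (simp add: BP_Suc)
qed

lemma consistent_BP:
  assumes p: "consistent p" and "m \<le> n" and v: "v \<in> verts G m"
  shows "p m v = (\<Sum>w\<in>verts G n. p n w * BP m n w v)"
  using assms(2)
proof (induction n rule: dec_induct)
  case base
  show ?case
    using v by (simp add: BP_self if_distrib[of "(*) _"] sum.delta finite_verts cong: if_cong)
next
  case (step n)
  have "p m v = (\<Sum>t\<in>verts G n. (\<Sum>w\<in>verts G (Suc n). p (Suc n) w * B (Suc n) w t) * BP m n t v)"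
    unfolding step.IH using consistentD(2)[OF p] by (intro sum.cong) auto
  also have "\<dots> = (\<Sum>w\<in>verts G (Suc n). p (Suc n) w * (\<Sum>t\<in>verts G n. B (Suc n) w t * BP m n t v))"
    by (simp add: sum_distrib_left sum_distrib_right mult.assoc sum.swap[of _ "verts G n"])
  finally show ?case using step by (simp add: BP_Suc)
qed

end

section \<open>Measures from harmonic sequences\<close>

text \<open>The dummy state at time 0 lets the initial law be part of the same family of
  kernels.\<close>

definition prev_state :: "(nat \<Rightarrow> 'a) \<Rightarrow> nat \<Rightarrow> 'a" where
  "prev_state x n = (if n = 0 then undefined else x (n - 1))"

text \<open>Ionescu-Tulcea for kernels that see only the previous state. The state space is a whole
  type, possibly uncountable, so the almost sure statement is made for one state \<open>a\<close> at
  a time.\<close>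

lemma markov_chain_exists:
  fixes Q :: "nat \<Rightarrow> 'a \<Rightarrow> 'a pmf"
  shows "\<exists>L. prob_space L \<and> sets L = sets (PiM UNIV (\<lambda>_. count_space UNIV)) \<and>
    (\<forall>n x. measure L {y. \<forall>i<n. y i = x i} = (\<Prod>i<n. pmf (Q i (prev_state x i)) (x i))) \<and>
    (\<forall>n a. AE y in L. prev_state y n = a \<longrightarrow> y n \<in> set_pmf (Q n a))"
proof -
  define M :: "nat \<Rightarrow> 'a measure" where "M n = count_space UNIV" for n
  define P :: "nat \<Rightarrow> (nat \<Rightarrow> 'a) \<Rightarrow> 'a measure" where "P n x = measure_pmf (Q n (prev_state x n))" for n x
  have Pm: "P i \<in> measurable (PiM {0..<i} M) (subprob_algebra (M i))" for i
  proof -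
    have sub: "measure_pmf p \<in> space (subprob_algebra (count_space UNIV))" for p :: "'a pmf"
      by (simp add: space_subprob_algebra measure_pmf.subprob_space_axioms)
    show ?thesis
    proof (cases "i = 0")
      case True
      have "P 0 = (\<lambda>_. measure_pmf (Q 0 undefined))"
        by (simp add: P_def prev_state_def fun_eq_iff)
      with True show ?thesis by (simp add: M_def sub)
    next
      case False
      have "(\<lambda>x. x (i - 1)) \<in> measurable (PiM {0..<i} M) (count_space UNIV)"
        using measurable_component_singleton[of "i - 1" "{0..<i}" M] False by (simp add: M_def)
      moreover have "(\<lambda>a. measure_pmf (Q i a)) \<in> measurable (count_space UNIV) (subprob_algebra (M i))"
        by (simp add: M_def sub)
      ultimately have "(\<lambda>x. measure_pmf (Q i (x (i - 1)))) \<in> measurable (PiM {0..<i} M) (subprob_algebra (M i))"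
        by (rule measurable_compose)
      moreover have "P i = (\<lambda>x. measure_pmf (Q i (x (i - 1))))"
        using False by (simp add: P_def prev_state_def fun_eq_iff)
      ultimately show ?thesis by simp
    qed
  qed
  interpret IT: Ionescu_Tulcea P M
  proof (rule Ionescu_Tulcea.intro)
    show "P i \<in> measurable (PiM {0..<i} M) (subprob_algebra (M i))" for i by (rule Pm)
    show "\<And>i x. x \<in> space (PiM {0..<i} M) \<Longrightarrow> prob_space (P i x)" by (simp add: P_def measure_pmf.prob_space_axioms)
  qed
  let ?u = "\<lambda>_. undefined :: 'a"
  have u: "?u \<in> space (PiM {0..<0} M)" by (simp add: space_PiM)
  have spaceM: "space (PiM I M) = extensional I" for I :: "nat set"
    by (simp add: space_PiM M_def PiE_UNIV_domain PiE_def)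
  have spaceC: "space (IT.C 0 n ?u) = extensional {0..<n}" for n
    using IT.space_C[OF u, of n] spaceM by simp
  have setsC: "sets (IT.C 0 n ?u) = sets (PiM {0..<n} M)" for n
    using IT.sets_C[OF u, of n] by simp
  have C_step: "emeasure (IT.C 0 (Suc n) ?u) A = (\<integral>\<^sup>+\<omega>. emeasure (measure_pmf (Q n (prev_state \<omega> n))) {e. fun_upd \<omega> n e \<in> A} \<partial>IT.C 0 n ?u)"
    if A: "A \<in> sets (PiM {0..<Suc n} M)" for n A
  proof -
    have "emeasure (IT.C 0 (Suc n) ?u) A = (\<integral>\<^sup>+\<omega>. emeasure (IT.eP n \<omega>) A \<partial>IT.C 0 n ?u)"
      using emeasure_bind[of "IT.C 0 n ?u" "IT.eP n" "PiM {0..<Suc n} M" A]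
        prob_space.not_empty[OF IT.prob_space_C[OF u, of n]] IT.measurable_eP[of n] A
      by (simp add: measurable_cong_sets[OF setsC refl])
    also have "\<dots> = (\<integral>\<^sup>+\<omega>. emeasure (measure_pmf (Q n (prev_state \<omega> n))) {e. fun_upd \<omega> n e \<in> A} \<partial>IT.C 0 n ?u)"
    proof (rule nn_integral_cong)
      fix \<omega> assume "\<omega> \<in> space (IT.C 0 n ?u)"
      then have "\<omega> \<in> space (PiM {0..<n} M)" by (simp add: spaceC spaceM)
      from IT.emeasure_eP[OF this A]
      show "emeasure (IT.eP n \<omega>) A = emeasure (measure_pmf (Q n (prev_state \<omega> n))) {e. fun_upd \<omega> n e \<in> A}"
        by (simp add: P_def M_def vimage_def)
    qed
    finally show ?thesis .
  qed
  have single: "{restrict x {0..<n}} \<in> sets (PiM {0..<n} M)" for x n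
  proof -
    have "{restrict x {0..<n}} = (\<Pi>\<^sub>E i\<in>{0..<n}. {x i})"
      by (auto simp: PiE_singleton PiE_iff extensional_def fun_eq_iff)
    moreover have "(\<Pi>\<^sub>E i\<in>{0..<n}. {x i}) \<in> sets (PiM {0..<n} M)"
      by (intro sets_PiM_I_finite) (auto simp: M_def)
    ultimately show ?thesis by simp
  qed
  have C_single: "emeasure (IT.C 0 n ?u) {restrict x {0..<n}} = ennreal (\<Prod>i<n. pmf (Q i (prev_state x i)) (x i))" for x n
  proof (induction n)
    case 0
    have "{restrict x {0..<0}} = space (IT.C 0 0 ?u)"
      unfolding spaceC by (auto simp: extensional_def fun_eq_iff)
    then show ?case
      using prob_space.emeasure_space_1[OF IT.prob_space_C[OF u, of 0]] by (simp del: IT.C.simps restrict_apply)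
  next
    case (Suc n)
    let ?r = "restrict x {0..<n}"
    have "emeasure (IT.C 0 (Suc n) ?u) {restrict x {0..<Suc n}} =
       (\<integral>\<^sup>+\<omega>. emeasure (measure_pmf (Q n (prev_state \<omega> n))) {e. fun_upd \<omega> n e = restrict x {0..<Suc n}} \<partial>IT.C 0 n ?u)"
      using C_step[OF single] by simp
    also have "\<dots> = (\<integral>\<^sup>+\<omega>. ennreal (pmf (Q n (prev_state x n)) (x n)) * indicator {?r} \<omega> \<partial>IT.C 0 n ?u)"
    proof (rule nn_integral_cong)
      fix \<omega> assume "\<omega> \<in> space (IT.C 0 n ?u)"
      then have \<omega>: "\<omega> \<in> extensional {0..<n}" by (simp add: spaceC)
      \<comment> \<open>Appending \<open>e\<close> gives the prescribed word exactly when the past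
        is right and \<open>e\<close> is its next letter, so the integrand is a constant times an
        indicator.\<close>
      have *: "fun_upd \<omega> n e = restrict x {0..<Suc n} \<longleftrightarrow> \<omega> = ?r \<and> e = x n" for e
      proof
        assume eq: "fun_upd \<omega> n e = restrict x {0..<Suc n}"
        have "\<omega> i = ?r i" for i
          using fun_cong[OF eq, of i] \<omega> by (cases "i < n") (auto simp: extensional_def)
        then show "\<omega> = ?r \<and> e = x n" using fun_cong[OF eq, of n] by auto
      qed (auto simp: fun_eq_iff restrict_def)
      show "emeasure (measure_pmf (Q n (prev_state \<omega> n))) {e. fun_upd \<omega> n e = restrict x {0..<Suc n}} = ennreal (pmf (Q n (prev_state x n)) (x n)) * indicator {?r} \<omega>"
      proof (cases "\<omega> = ?r")
        case True
        then have "prev_state \<omega> n = prev_state x n" by (auto simp: prev_state_def)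
        then show ?thesis unfolding * using True by (simp add: emeasure_pmf_single)
      next
        case False
        then show ?thesis unfolding * by simp
      qed
    qed
    also have "\<dots> = ennreal (pmf (Q n (prev_state x n)) (x n)) * emeasure (IT.C 0 n ?u) {?r}"
      using single by (intro nn_integral_cmult_indicator) (simp add: setsC)
    also have "\<dots> = ennreal (\<Prod>i<Suc n. pmf (Q i (prev_state x i)) (x i))"
      unfolding Suc by (simp add: ennreal_mult' mult.commute prod_nonneg)
    finally show ?case .
  qed
  let ?L = "IT.PF.lim"
  have setsL: "sets ?L = sets (PiM UNIV (\<lambda>_. count_space UNIV))"
    using IT.PF.sets_lim by (simp add: M_def[abs_def])
  have spL: "space ?L = UNIV"
    using sets_eq_imp_space_eq[OF setsL] by (simp add: space_PiM PiE_UNIV_domain)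
  have limC: "emeasure ?L {y. restrict y {0..<n} \<in> A} = emeasure (IT.C 0 n ?u) A"
    if A: "A \<in> sets (PiM {0..<n} M)" for n A
  proof -
    have "IT.PF.emb UNIV {0..<n} A = {y. restrict y {0..<n} \<in> A}"
      using A[THEN sets.sets_into_space] by (auto simp: prod_emb_def space_PiM PiE_UNIV_domain M_def)
    then have "emeasure ?L {y. restrict y {0..<n} \<in> A} = emeasure (IT.CI {0..<n}) A"
      using IT.lim[of "{0..<n}" A] A by simp
    also have "\<dots> = emeasure (IT.C 0 n ?u) (IT.PF.emb {0..<n} {0..<n} A)"
      using IT.emeasure_CI[of "{0..<n}" n A] A by simp
    also have "IT.PF.emb {0..<n} {0..<n} A = A"
      using A[THEN sets.sets_into_space] by (intro prod_emb_id) (simp add: space_PiM)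
    finally show ?thesis .
  qed
  have cyl: "emeasure ?L {y. \<forall>i<n. y i = x i} = ennreal (\<Prod>i<n. pmf (Q i (prev_state x i)) (x i))" for n x
  proof -
    have "{y. \<forall>i<n. y i = x i} = {y. restrict y {0..<n} \<in> {restrict x {0..<n}}}"
      by (auto simp: fun_eq_iff restrict_def)
    then show ?thesis using limC[OF single] C_single by simp
  qed
  have prob: "prob_space ?L"
  proof
    show "emeasure ?L (space ?L) = 1"
      unfolding spL using cyl[of 0] by simp
  qed
  have meas: "measure ?L {y. \<forall>i<n. y i = x i} = (\<Prod>i<n. pmf (Q i (prev_state x i)) (x i))" for n x
    using cyl[of n x] by (simp add: measure_def prod_nonneg)
  have ae: "AE y in ?L. prev_state y n = a \<longrightarrow> y n \<in> set_pmf (Q n a)" for n a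
  proof -
    let ?A = "{\<omega> \<in> space (PiM {0..<Suc n} M). prev_state \<omega> n = a \<and> \<omega> n \<notin> set_pmf (Q n a)}"
    have A: "?A \<in> sets (PiM {0..<Suc n} M)"
    proof -
      have c: "(\<lambda>\<omega>. \<omega> j) \<in> measurable (PiM {0..<Suc n} M) (count_space UNIV)" if "j \<le> n" for j
        using measurable_component_singleton[of j "{0..<Suc n}" M] that by (simp add: M_def)
      have 1: "{\<omega> \<in> space (PiM {0..<Suc n} M). \<omega> n \<notin> set_pmf (Q n a)} \<in> sets (PiM {0..<Suc n} M)"
        using measurable_sets[OF c[of n], of "- set_pmf (Q n a)"] by (simp add: vimage_def Int_def conj_commute)
      have 2: "{\<omega> \<in> space (PiM {0..<Suc n} M). prev_state \<omega> n = a} \<in> sets (PiM {0..<Suc n} M)"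
      proof (cases "n = 0")
        case False
        then show ?thesis
          using measurable_sets[OF c[of "n - 1"], of "{a}"] by (simp add: prev_state_def vimage_def Int_def conj_commute)
      qed (simp add: prev_state_def)
      show ?thesis using sets.Int[OF 1 2] by (simp add: Int_def conj_ac)
    qed
    have "emeasure (IT.C 0 (Suc n) ?u) ?A = 0"
    proof -
      \<comment> \<open>The bad event has probability 0 given any past: either the past does not end
        in \<open>a\<close>, or the next letter must avoid the support of
        \<open>Q n a\<close>.\<close>
      have "emeasure (measure_pmf (Q n (prev_state \<omega> n))) {e. fun_upd \<omega> n e \<in> ?A} = 0" for \<omega>
      proof (cases "prev_state \<omega> n = a")
        case True
        have "emeasure (measure_pmf (Q n a)) {e. fun_upd \<omega> n e \<in> ?A} \<le> emeasure (measure_pmf (Q n a)) (- set_pmf (Q n a))"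
          by (intro emeasure_mono) auto
        also have "\<dots> = 0"
          by (simp add: measure_pmf.emeasure_eq_measure measure_pmf_zero_iff)
        finally show ?thesis using True by simp
      next
        case False
        have "prev_state (fun_upd \<omega> n e) n = prev_state \<omega> n" for e by (cases n) (simp_all add: prev_state_def)
        then show ?thesis using False by simp
      qed
      then show ?thesis unfolding C_step[OF A] by simp
    qed
    then have "emeasure ?L {y. restrict y {0..<Suc n} \<in> ?A} = 0"
      using limC[OF A] by simp
    moreover have "{y. restrict y {0..<Suc n} \<in> ?A} = {y. \<not> (prev_state y n = a \<longrightarrow> y n \<in> set_pmf (Q n a))}"
      by (auto simp: spaceM prev_state_def)
    moreover have "{y. restrict y {0..<Suc n} \<in> ?A} \<in> sets ?L"
    proof -
      have "(\<lambda>y. restrict y {0..<Suc n}) \<in> measurable ?L (PiM {0..<Suc n} M)"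
        by (subst measurable_cong_sets[OF IT.PF.sets_lim refl]) (intro measurable_restrict_subset, simp)
      from measurable_sets[OF this A] show ?thesis by (simp only: spL vimage_def Int_UNIV_right)
    qed
    ultimately show ?thesis
      by (intro AE_I[where N = "{y. restrict y {0..<Suc n} \<in> ?A}"]) auto
  qed
  show ?thesis using prob setsL meas ae by blast
qed

lemma pmf_of_weights:
  fixes g :: "'a \<Rightarrow> real"
  assumes S: "finite S" and g: "\<And>x. x \<in> S \<Longrightarrow> 0 \<le> g x" "sum g S = 1"
  shows "\<exists>p. \<forall>x. pmf p x = (if x \<in> S then g x else 0)"
proof -
  let ?f = "\<lambda>x. if x \<in> S then g x else 0"
  have "(\<integral>\<^sup>+x. ennreal (?f x) \<partial>count_space UNIV) = (\<Sum>x\<in>S. ennreal (?f x))"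
    using S by (intro nn_integral_count_space') auto
  also have "\<dots> = 1"
    using g by (simp add: sum_ennreal)
  finally have "pmf (embed_pmf ?f) x = ?f x" for x
    using g by (intro pmf_embed_pmf) auto
  then show ?thesis by blast
qed

context weighted_bratteli
begin

section \<open>The Markov chain of edges attached to a harmonic function\<close>

lemma harmonicD:
  assumes "harmonic c"
  shows "v \<in> verts G n \<Longrightarrow> 0 \<le> c n v"
    and "v \<in> verts G n \<Longrightarrow> c n v = (\<Sum>e\<in>out_edges n v. \<Phi> e * c (Suc n) (rng G e))"
    and "(\<Sum>v\<in>verts G 0. c 0 v) = 1"
  using assms unfolding harmonic_def by blast+

lemma harmonic_edge_nonneg:
  assumes "harmonic c" "e \<in> edges G (Suc n)"
  shows "0 \<le> \<Phi> e * c (Suc n) (rng G e)"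
  using harmonicD(1)[OF assms(1) edge_rng[OF assms(2)]] edge_weight_pos[OF assms(2)] by simp

lemma finite_out_edges: "finite (out_edges n v)"
  using finite_edges by simp

text \<open>The multiplied form survives \<open>c n v = 0\<close>: every outgoing term then
  vanishes, as a nonnegative summand of a zero sum, and any law on the outgoing edges will do. The
  uniform one is taken, so the chain never leaves the diagram.\<close>

lemma transition_pmf_exists:
  assumes c: "harmonic c" and v: "v \<in> verts G n"
  shows "\<exists>p. set_pmf p \<subseteq> out_edges n v \<and>
    (\<forall>e\<in>out_edges n v. c n v * pmf p e = \<Phi> e * c (Suc n) (rng G e))"
proof (cases "c n v = 0")
  case True
  have "out_edges n v \<noteq> {}" using edge_from[OF v] by blast
  then have "set_pmf (pmf_of_set (out_edges n v)) \<subseteq> out_edges n v"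
    using finite_out_edges by simp
  moreover have "\<Phi> e * c (Suc n) (rng G e) = 0" if "e \<in> out_edges n v" for e
  proof -
    have sum0: "(\<Sum>e\<in>out_edges n v. \<Phi> e * c (Suc n) (rng G e)) = 0"
      using harmonicD(2)[OF c v] True by simp
    have nonneg: "\<And>e. e \<in> out_edges n v \<Longrightarrow> 0 \<le> \<Phi> e * c (Suc n) (rng G e)"
      using harmonic_edge_nonneg[OF c] by blast
    show ?thesis
      by (rule sum_nonneg_0[OF finite_out_edges nonneg sum0 that])
  qed
  ultimately show ?thesis
    using True by (intro exI[of _ "pmf_of_set (out_edges n v)"]) auto
next
  case False
  then have pos: "0 < c n v" using harmonicD(1)[OF c v] by simp
  let ?g = "\<lambda>e. \<Phi> e * c (Suc n) (rng G e) / c n v"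
  have "\<exists>p. \<forall>e. pmf p e = (if e \<in> out_edges n v then ?g e else 0)"
  proof (rule pmf_of_weights[OF finite_out_edges])
    show "0 \<le> ?g e" if "e \<in> out_edges n v" for e
      using harmonic_edge_nonneg[OF c, of e n] that pos by simp
    show "sum ?g (out_edges n v) = 1"
      using harmonicD(2)[OF c v] pos by (simp add: sum_divide_distrib[symmetric])
  qed
  then obtain p where p: "\<And>e. pmf p e = (if e \<in> out_edges n v then ?g e else 0)" by blast
  have "set_pmf p \<subseteq> out_edges n v"
    by (auto simp: set_pmf_iff p split: if_splits)
  then show ?thesis using p pos by (intro exI[of _ p]) auto
qed

lemma initial_pmf_exists:
  assumes c: "harmonic c"
  shows "\<exists>p. set_pmf p \<subseteq> edges G (Suc 0) \<and> (\<forall>e\<in>edges G (Suc 0). pmf p e = \<Phi> e * c (Suc 0) (rng G e))"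
proof -
  let ?g = "\<lambda>e. \<Phi> e * c (Suc 0) (rng G e)"
  have "sum ?g (edges G (Suc 0)) = (\<Sum>v\<in>verts G 0. c 0 v)"
    using harmonicD(2)[OF c] by (simp add: sum_out_edges[symmetric])
  then have "sum ?g (edges G (Suc 0)) = 1" using harmonicD(3)[OF c] by simp
  then obtain p where p: "\<And>e. pmf p e = (if e \<in> edges G (Suc 0) then ?g e else 0)"
    using pmf_of_weights[OF finite_edges, of 0 ?g] harmonic_edge_nonneg[OF c] by blast
  then have "set_pmf p \<subseteq> edges G (Suc 0)"
    by (auto simp: set_pmf_iff split: if_splits)
  then show ?thesis using p by (intro exI[of _ p]) simp
qed

text \<open>Over an uncountable edge type a relation between two coordinates need not be measurable;
  finiteness of each edge set turns it into a finite union of coordinate conditions.\<close>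

lemma paths_measurable: "paths G \<in> sets (PiM UNIV (\<lambda>_. count_space UNIV))"
proof -
  let ?N = "PiM UNIV (\<lambda>_. count_space UNIV) :: (nat \<Rightarrow> 'e) measure"
  have coord: "{y. y k = a} \<in> sets ?N" for k a
  proof -
    have "(\<lambda>y. y k) \<in> measurable ?N (count_space UNIV)"
      by (rule measurable_component_singleton) simp
    from measurable_sets[OF this, of "{a}"] show ?thesis
      by (simp add: space_PiM PiE_UNIV_domain vimage_def)
  qed
  let ?T = "\<lambda>k. {(a, b). a \<in> edges G (Suc k) \<and> b \<in> edges G (Suc (Suc k)) \<and> rng G a = src G b}"
  have "paths G = {y. y 0 = undefined} \<inter> (\<Inter>k. \<Union>t\<in>?T k. {y. y (Suc k) = fst t} \<inter> {y. y (Suc (Suc k)) = snd t})"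
    by (auto simp: paths_iff)
  moreover have "(\<Union>t\<in>?T k. {y. y (Suc k) = fst t} \<inter> {y. y (Suc (Suc k)) = snd t}) \<in> sets ?N" for k
  proof (rule sets.finite_UN)
    show "finite (?T k)"
      by (rule finite_subset[of _ "edges G (Suc k) \<times> edges G (Suc (Suc k))"]) (auto simp: finite_edges)
  qed (use coord in auto)
  ultimately show ?thesis
    using coord by auto
qed

text \<open>The chain chooses the next edge with probability proportional to its weight times
  \<open>c\<close> at its range. In the probability of a finite path the intermediate values of
  \<open>c\<close> telescope away and only the last one remains.\<close>

lemma harmonic_realizes:
  assumes c: "harmonic c"
  shows "\<exists>\<mu>. realizes \<mu> c"
proof -
  \<comment> \<open>Coordinate 0 is frozen at \<open>undefined\<close>, the normalised value of a
    path, and the initial law acts at coordinate 1.\<close>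
  define Q :: "nat \<Rightarrow> 'e \<Rightarrow> 'e pmf" where
    "Q n a = (if n = 0 then return_pmf undefined
      else if n = 1 then (SOME p. set_pmf p \<subseteq> edges G (Suc 0) \<and> (\<forall>e\<in>edges G (Suc 0). pmf p e = \<Phi> e * c (Suc 0) (rng G e)))
      else (SOME p. set_pmf p \<subseteq> out_edges (n - 1) (rng G a) \<and>
          (\<forall>e\<in>out_edges (n - 1) (rng G a). c (n - 1) (rng G a) * pmf p e = \<Phi> e * c n (rng G e))))" for n a
  have Q0: "Q 0 a = return_pmf undefined" for a by (simp add: Q_def)
  have Q1: "set_pmf (Q (Suc 0) a) \<subseteq> edges G (Suc 0) \<and> (\<forall>e\<in>edges G (Suc 0). pmf (Q (Suc 0) a) e = \<Phi> e * c (Suc 0) (rng G e))" for a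
    using someI_ex[OF initial_pmf_exists[OF c]] by (simp add: Q_def)
  have Q2: "set_pmf (Q (Suc (Suc n)) a) \<subseteq> out_edges (Suc n) (rng G a) \<and>
      (\<forall>e\<in>out_edges (Suc n) (rng G a). c (Suc n) (rng G a) * pmf (Q (Suc (Suc n)) a) e = \<Phi> e * c (Suc (Suc n)) (rng G e))"
    if "a \<in> edges G (Suc n)" for n a
    using someI_ex[OF transition_pmf_exists[OF c edge_rng[OF that]]] by (simp add: Q_def)
  obtain L where L: "prob_space L" and setsL: "sets L = sets (PiM UNIV (\<lambda>_. count_space UNIV))"
    and cylL: "\<And>n x. measure L {y. \<forall>i<n. y i = x i} = (\<Prod>i<n. pmf (Q i (prev_state x i)) (x i))"
    and aeL: "\<And>n a. AE y in L. prev_state y n = a \<longrightarrow> y n \<in> set_pmf (Q n a)"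
    using markov_chain_exists[of Q] by blast
  interpret L: prob_space L by fact
  have spL: "space L = UNIV"
    using sets_eq_imp_space_eq[OF setsL] by (simp add: space_PiM PiE_UNIV_domain)
  have pL: "paths G \<in> sets L" using paths_measurable setsL by simp
  have prodQ: "(\<Prod>i<Suc (Suc n). pmf (Q i (prev_state x i)) (x i)) = weight (Suc n) x * c (Suc n) (rng G (x (Suc n)))"
    if x: "x \<in> paths G" for x n
  proof (induction n)
    case 0
    show ?case
      using Q1 path_edge[OF x, of 0] by (simp add: Q0 path_0[OF x] weight_def)
  next
    case (Suc n)
    have "x (Suc (Suc n)) \<in> out_edges (Suc n) (rng G (x (Suc n)))"
      using path_edge[OF x] path_link[OF x] by simp
    then have "c (Suc n) (rng G (x (Suc n))) * pmf (Q (Suc (Suc n)) (x (Suc n))) (x (Suc (Suc n))) =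
      \<Phi> (x (Suc (Suc n))) * c (Suc (Suc n)) (rng G (x (Suc (Suc n))))"
      using Q2[OF path_edge[OF x, of n]] by blast
    then show ?case
      unfolding prod.lessThan_Suc[of _ "Suc (Suc n)"] Suc by (simp add: weight_Suc prev_state_def)
  qed
  have ae0: "AE y in L. y 0 = undefined"
    using aeL[of 0 undefined] by (simp add: prev_state_def Q0)
  have ae1: "AE y in L. y (Suc 0) \<in> edges G (Suc 0)"
    using ae0 aeL[of "Suc 0" undefined] by eventually_elim (use Q1 in \<open>auto simp: prev_state_def\<close>)
  \<comment> \<open>Only finitely many edges can be the previous state at this level, so finitely
    many null sets are discarded.\<close>
  have "AE y in L. \<forall>a\<in>edges G (Suc k). prev_state y (Suc (Suc k)) = a \<longrightarrow> y (Suc (Suc k)) \<in> set_pmf (Q (Suc (Suc k)) a)" for k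
    using finite_edges by (intro AE_finite_allI) (auto intro: aeL)
  then have ae2: "AE y in L. \<forall>k. \<forall>a\<in>edges G (Suc k). prev_state y (Suc (Suc k)) = a \<longrightarrow> y (Suc (Suc k)) \<in> set_pmf (Q (Suc (Suc k)) a)"
    by (simp add: AE_all_countable)
  have aep: "AE y in L. y \<in> paths G"
    using ae0 ae1 ae2
  proof eventually_elim
    fix y assume y: "y 0 = undefined" "y (Suc 0) \<in> edges G (Suc 0)"
      "\<forall>k. \<forall>a\<in>edges G (Suc k). prev_state y (Suc (Suc k)) = a \<longrightarrow> y (Suc (Suc k)) \<in> set_pmf (Q (Suc (Suc k)) a)"
    have next_edge: "y (Suc (Suc k)) \<in> out_edges (Suc k) (rng G (y (Suc k)))" if "y (Suc k) \<in> edges G (Suc k)" for k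
      using y(3) Q2[OF that] that by (fastforce simp: prev_state_def)
    have "y (Suc k) \<in> edges G (Suc k)" for k
      by (induction k) (use y(2) next_edge in auto)
    then show "y \<in> paths G"
      using next_edge y(1) by (auto simp: paths_iff)
  qed
  obtain x0 where x0: "x0 \<in> paths G" using paths_nonempty by blast
  \<comment> \<open>The chain lives on all sequences. Sending the null set of non-paths to one fixed
    path gives a map into the path space that changes the chain only on that null set.\<close>
  define h where "h y = (if y \<in> paths G then y else x0)" for y
  have coord: "{y. y k = a} \<in> sets L" for k a
  proof -
    have "(\<lambda>y. y k) \<in> measurable L (count_space UNIV)"
      unfolding measurable_cong_sets[OF setsL refl] by (rule measurable_component_singleton) simp
    from measurable_sets[OF this, of "{a}"] show ?thesis
      by (simp add: spL vimage_def)
  qed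
  have hpre: "h -` cylinder G x n \<inter> space L \<in> sets L" for x n
  proof -
    have "h -` cylinder G x n \<inter> space L = (paths G \<inter> (\<Inter>k\<in>{..n}. if k = 0 then space L else {y. y k = x k})) \<union>
       (if x0 \<in> cylinder G x n then space L - paths G else {})"
      by (auto simp: h_def spL cylinder_def)
    moreover have "(\<Inter>k\<in>{..n}. if k = 0 then space L else {y. y k = x k}) \<in> sets L"
      using coord by (intro sets.finite_INT) auto
    ultimately show ?thesis using pL by auto
  qed
  have h: "h \<in> measurable L path_borel"
  proof (rule measurable_sigma_sets[OF sets_path_borel])
    show "{cylinder G x n |x n. x \<in> paths G} \<subseteq> Pow (paths G)" using cylinder_subset by blast
    show "h \<in> space L \<rightarrow> paths G" using x0 by (auto simp: h_def)
  qed (use hpre in auto)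
  define \<mu> where "\<mu> = distr L path_borel h"
  have "measure \<mu> (cylinder G x n) = weight n x * c n (rng G (x n))" if n: "1 \<le> n" and x: "x \<in> paths G" for n x
  proof -
    have "measure \<mu> (cylinder G x n) = measure L (h -` cylinder G x n \<inter> space L)"
      unfolding \<mu>_def using h cylinder_sets by (rule measure_distr)
    also have "\<dots> = measure L {y. \<forall>i<Suc n. y i = x i}"
    proof (rule L.finite_measure_eq_AE)
      show "AE y in L. (y \<in> h -` cylinder G x n \<inter> space L) = (y \<in> {y. \<forall>i<Suc n. y i = x i})"
        using aep
      proof eventually_elim
        fix y assume y: "y \<in> paths G"
        have "(\<forall>k\<in>{1..n}. y k = x k) \<longleftrightarrow> (\<forall>i<Suc n. y i = x i)"
        proof
          assume *: "\<forall>k\<in>{1..n}. y k = x k"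
          show "\<forall>i<Suc n. y i = x i"
          proof (intro allI impI)
            fix i assume "i < Suc n"
            then show "y i = x i" using * path_0[OF x] path_0[OF y] by (cases i) auto
          qed
        qed auto
        then show "(y \<in> h -` cylinder G x n \<inter> space L) = (y \<in> {y. \<forall>i<Suc n. y i = x i})"
          using y by (simp add: h_def spL cylinder_def)
      qed
      show "h -` cylinder G x n \<inter> space L \<in> sets L" by (rule hpre)
      have "{y. \<forall>i<Suc n. y i = x i} = (\<Inter>k\<in>{..n}. {y. y k = x k})" by auto
      also have "\<dots> \<in> sets L" using coord by (intro sets.finite_INT) auto
      finally show "{y. \<forall>i<Suc n. y i = x i} \<in> sets L" .
    qed
    also have "\<dots> = weight n x * c n (rng G (x n))"
      unfolding cylL using prodQ[OF x, of "n - 1"] n by simp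
    finally show ?thesis .
  qed
  then have "realizes \<mu> c"
    unfolding realizes_def using L.prob_space_distr[OF h] by (simp add: \<mu>_def)
  then show ?thesis by blast
qed

text \<open>Measures determine harmonic functions and consistent sequences only on the vertex sets,
  hence the equality of \<open>p\<close> and \<open>q\<close> restricted to
  \<open>verts G n\<close>.\<close>

lemma SD_unique_iff:
  "(\<exists>!\<mu>. \<mu> \<in> SD G D) \<longleftrightarrow>
    (\<exists>p. consistent p) \<and> (\<forall>p q. consistent p \<longrightarrow> consistent q \<longrightarrow> (\<forall>n. \<forall>v\<in>verts G n. p n v = q n v))"
proof
  assume ex1: "\<exists>!\<mu>. \<mu> \<in> SD G D"
  then obtain \<mu> where \<mu>: "conformal \<mu>" by (auto simp: SD_iff)
  then obtain c where "harmonic c" using conformal_realizes by blast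
  then have ex: "\<exists>p. consistent p" using harmonic_consistent by blast
  have "p n v = q n v" if p: "consistent p" and q: "consistent q" and v: "v \<in> verts G n" for p q n v
  proof -
    obtain \<mu>1 where \<mu>1: "realizes \<mu>1 (\<lambda>n v. p n v / u n v)"
      using harmonic_realizes[OF consistent_harmonic[OF p]] by blast
    obtain \<mu>2 where \<mu>2: "realizes \<mu>2 (\<lambda>n v. q n v / u n v)"
      using harmonic_realizes[OF consistent_harmonic[OF q]] by blast
    have "\<mu>1 = \<mu>2"
      using ex1 realizes_conformal[OF \<mu>1] realizes_conformal[OF \<mu>2] by (auto simp: SD_iff)
    then have "p n v / u n v = q n v / u n v"
      using realizes_determines[OF \<mu>1 consistent_harmonic[OF p], of "\<lambda>n v. q n v / u n v" v n] \<mu>2 consistent_harmonic[OF q] v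
      by simp
    then show ?thesis using uvec_pos[OF v] by simp
  qed
  with ex show "(\<exists>p. consistent p) \<and> (\<forall>p q. consistent p \<longrightarrow> consistent q \<longrightarrow> (\<forall>n. \<forall>v\<in>verts G n. p n v = q n v))"
    by blast
next
  assume *: "(\<exists>p. consistent p) \<and> (\<forall>p q. consistent p \<longrightarrow> consistent q \<longrightarrow> (\<forall>n. \<forall>v\<in>verts G n. p n v = q n v))"
  then obtain p where p: "consistent p" by blast
  obtain \<mu> where "realizes \<mu> (\<lambda>n v. p n v / u n v)"
    using harmonic_realizes[OF consistent_harmonic[OF p]] by blast
  then have ex: "\<mu> \<in> SD G D" using realizes_conformal by (simp add: SD_iff)
  have "\<mu>1 = \<mu>2" if \<mu>12: "\<mu>1 \<in> SD G D" "\<mu>2 \<in> SD G D" for \<mu>1 \<mu>2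
  proof -
    obtain c1 where c1: "harmonic c1" "realizes \<mu>1 c1"
      using conformal_realizes \<mu>12(1) by (auto simp: SD_iff)
    obtain c2 where c2: "harmonic c2" "realizes \<mu>2 c2"
      using conformal_realizes \<mu>12(2) by (auto simp: SD_iff)
    have "c1 n v = c2 n v" if v: "v \<in> verts G n" for n v
    proof -
      have "u n v * c1 n v = u n v * c2 n v"
        using * harmonic_consistent[OF c1(1)] harmonic_consistent[OF c2(1)] v by blast
      then show ?thesis using uvec_pos[OF v] by simp
    qed
    then show ?thesis using realizes_unique[OF c1(2) c2(2)] by blast
  qed
  then show "\<exists>!\<mu>. \<mu> \<in> SD G D" using ex by blast
qed

end

section \<open>Uniqueness and column variation\<close>

text \<open>Tychonoff makes the cube compact, and with countably many factors compactness is
  sequential; this takes the place of a diagonal argument.\<close>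

lemma pointwise_convergent_subsequence:
  fixes F :: "nat \<Rightarrow> nat \<Rightarrow> real"
  assumes "\<And>n i. F n i \<in> {0..1}"
  shows "\<exists>r l. strict_mono r \<and> (\<forall>i. (\<lambda>n. F (r n) i) \<longlonglongrightarrow> l i)"
proof -
  have "compactin (product_topology (\<lambda>i. euclidean) UNIV) (\<Pi>\<^sub>E i\<in>(UNIV::nat set). {0..1::real})"
    by (simp add: compactin_PiE)
  then have "compact (\<Pi>\<^sub>E i\<in>(UNIV::nat set). {0..1::real})"
    by (simp add: euclidean_product_topology)
  then have "seq_compact (\<Pi>\<^sub>E i\<in>(UNIV::nat set). {0..1::real})"
    by (rule compact_imp_seq_compact)
  moreover have "\<forall>n. F n \<in> (\<Pi>\<^sub>E i\<in>(UNIV::nat set). {0..1::real})"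
    using assms by (simp add: PiE_UNIV_domain)
  ultimately obtain l r where r: "strict_mono r" and l: "(F \<circ> r) \<longlonglongrightarrow> l"
    unfolding seq_compact_def by metis
  have "(\<lambda>n. F (r n) i) \<longlonglongrightarrow> l i" for i
    using continuous_on_tendsto_compose[OF continuous_on_product_coordinates[of i] l] by simp
  then show ?thesis using r by blast
qed

lemma weighted_average_bounds:
  fixes g f :: "'a \<Rightarrow> real"
  assumes "\<And>t. t \<in> S \<Longrightarrow> 0 \<le> g t" "sum g S = s" "\<And>t. t \<in> S \<Longrightarrow> a \<le> f t \<and> f t \<le> b"
  shows "s * a \<le> (\<Sum>t\<in>S. g t * f t)" "(\<Sum>t\<in>S. g t * f t) \<le> s * b"
proof -
  have "s * a = (\<Sum>t\<in>S. g t * a)" by (simp add: assms(2)[symmetric] sum_distrib_right)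
  also have "\<dots> \<le> (\<Sum>t\<in>S. g t * f t)" using assms by (intro sum_mono mult_left_mono) auto
  finally show "s * a \<le> (\<Sum>t\<in>S. g t * f t)" .
  have "(\<Sum>t\<in>S. g t * f t) \<le> (\<Sum>t\<in>S. g t * b)" using assms by (intro sum_mono mult_left_mono) auto
  also have "\<dots> = s * b" by (simp add: assms(2)[symmetric] sum_distrib_right)
  finally show "(\<Sum>t\<in>S. g t * f t) \<le> s * b" .
qed

context weighted_bratteli
begin

text \<open>Row \<open>w n\<close> of \<open>BP k n\<close> is a probability vector on level
  \<open>k\<close>. If a subsequence converges for all \<open>k\<close> and \<open>v\<close> at
  once, the limit is consistent, because the splitting of the lowest factor and the row sums are
  finite sums and pass to the limit.\<close>

lemma consistent_limit:
  assumes w: "\<And>n. w n \<in> verts G n"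
  shows "\<exists>r p. strict_mono r \<and> consistent p \<and> (\<forall>k. \<forall>v\<in>verts G k. (\<lambda>j. BP k (r j) (w (r j)) v) \<longlonglongrightarrow> p k v)"
proof -
  define S where "S = (SIGMA k:UNIV. verts G k)"
  have S: "countable S" unfolding S_def
    by (intro countable_SIGMA) (auto simp: countable_finite finite_verts)
  have Sne: "S \<noteq> {}" using verts_nonempty by (auto simp: S_def)
  \<comment> \<open>One enumeration of all pairs \<open>(k, v)\<close> lets a single subsequence
    serve every level. Entries with \<open>k > n\<close> have no meaning and are set to 0, which
    does not affect the limit.\<close>
  define F where "F n i = (case from_nat_into S i of (k, v) \<Rightarrow> if k \<le> n then BP k n (w n) v else 0)" for n i
  have "F n i \<in> {0..1}" for n i
    using from_nat_into[OF Sne, of i] BP_nonneg[OF _ w[of n]] BP_le_1[OF _ w[of n]]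
    by (auto simp: F_def S_def split: prod.split)
  then obtain r l where r: "strict_mono r" and l: "\<And>i. (\<lambda>n. F (r n) i) \<longlonglongrightarrow> l i"
    using pointwise_convergent_subsequence[of F] by blast
  define p where "p k v = l (to_nat_on S (k, v))" for k v
  have ev: "eventually (\<lambda>j. k \<le> r j) sequentially" for k
    using seq_suble[OF r] by (intro eventually_sequentiallyI[of k]) (meson order_trans)
  have lim: "(\<lambda>j. BP k (r j) (w (r j)) v) \<longlonglongrightarrow> p k v" if "v \<in> verts G k" for k v
  proof -
    have idx: "from_nat_into S (to_nat_on S (k, v)) = (k, v)"
      using S that by (intro from_nat_into_to_nat_on) (auto simp: S_def)
    have "eventually (\<lambda>j. F (r j) (to_nat_on S (k, v)) = BP k (r j) (w (r j)) v) sequentially"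
      using ev[of k] by eventually_elim (simp add: F_def idx)
    then show ?thesis
      using l[of "to_nat_on S (k, v)"] unfolding p_def by (rule Lim_transform_eventually[rotated])
  qed
  have "consistent p"
    unfolding consistent_def
  proof (intro conjI allI ballI)
    fix n v assume v: "v \<in> verts G n"
    show "0 \<le> p n v"
      using lim[OF v] by (rule tendsto_lowerbound) (use ev[of n] in eventually_elim, auto intro: BP_nonneg w)
    have "(\<lambda>j. \<Sum>t\<in>verts G (Suc n). BP (Suc n) (r j) (w (r j)) t * B (Suc n) t v) \<longlonglongrightarrow> (\<Sum>t\<in>verts G (Suc n). p (Suc n) t * B (Suc n) t v)"
      by (intro tendsto_sum tendsto_mult_right lim)
    moreover have "eventually (\<lambda>j. (\<Sum>t\<in>verts G (Suc n). BP (Suc n) (r j) (w (r j)) t * B (Suc n) t v) = BP n (r j) (w (r j)) v) sequentially"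
      using ev[of "Suc n"] by eventually_elim (rule BP_split_last[OF _ v w, symmetric])
    ultimately have "(\<lambda>j. BP n (r j) (w (r j)) v) \<longlonglongrightarrow> (\<Sum>t\<in>verts G (Suc n). p (Suc n) t * B (Suc n) t v)"
      by (rule Lim_transform_eventually)
    then show "p n v = (\<Sum>w\<in>verts G (Suc n). p (Suc n) w * B (Suc n) w v)"
      using lim[OF v] LIMSEQ_unique by blast
  next
    fix n
    have "(\<lambda>j. \<Sum>v\<in>verts G n. BP n (r j) (w (r j)) v) \<longlonglongrightarrow> (\<Sum>v\<in>verts G n. p n v)"
      by (intro tendsto_sum lim)
    moreover have "eventually (\<lambda>j. (\<Sum>v\<in>verts G n. BP n (r j) (w (r j)) v) = 1) sequentially"
      using ev[of n] by eventually_elim (rule BP_stochastic[OF _ w])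
    ultimately have "(\<lambda>j. 1) \<longlonglongrightarrow> (\<Sum>v\<in>verts G n. p n v)"
      by (rule Lim_transform_eventually)
    then show "(\<Sum>v\<in>verts G n. p n v) = 1"
      using LIMSEQ_unique tendsto_const by blast
  qed
  then show ?thesis using r lim by blast
qed

lemma consistent_exists: "\<exists>p. consistent p"
proof -
  have "(SOME v. v \<in> verts G n) \<in> verts G n" for n
    using verts_nonempty by (simp add: some_in_eq)
  then show ?thesis using consistent_limit[of "\<lambda>n. SOME v. v \<in> verts G n"] by blast
qed

section \<open>Column extrema and their limits\<close>

definition hi :: "nat \<Rightarrow> 'v \<Rightarrow> nat \<Rightarrow> real" where
  "hi m v n = Max ((\<lambda>w. BP m n w v) ` verts G n)"

definition lo :: "nat \<Rightarrow> 'v \<Rightarrow> nat \<Rightarrow> real" where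
  "lo m v n = Min ((\<lambda>w. BP m n w v) ` verts G n)"

lemma BP_between: "w \<in> verts G n \<Longrightarrow> lo m v n \<le> BP m n w v \<and> BP m n w v \<le> hi m v n"
  unfolding lo_def hi_def using finite_verts by simp

lemma hi_attained: "\<exists>w\<in>verts G n. BP m n w v = hi m v n"
proof -
  have "hi m v n \<in> (\<lambda>w. BP m n w v) ` verts G n"
    unfolding hi_def using finite_verts verts_nonempty by (intro Max_in) auto
  then show ?thesis by auto
qed

lemma lo_attained: "\<exists>w\<in>verts G n. BP m n w v = lo m v n"
proof -
  have "lo m v n \<in> (\<lambda>w. BP m n w v) ` verts G n"
    unfolding lo_def using finite_verts verts_nonempty by (intro Min_in) auto
  then show ?thesis by auto
qed

lemma variation_BP: "variation_on (verts G n) (\<lambda>w. BP m n w v) = hi m v n - lo m v n"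
  by (simp add: variation_on_def hi_def lo_def)

text \<open>Each new entry averages the column of the previous level, which yields the monotonicity
  of \<open>hi\<close> and \<open>lo\<close>.\<close>

lemma BP_Suc_between:
  assumes "m \<le> n" "w \<in> verts G (Suc n)"
  shows "lo m v n \<le> BP m (Suc n) w v \<and> BP m (Suc n) w v \<le> hi m v n"
  using weighted_average_bounds[of "verts G n" "B (Suc n) w" 1 "lo m v n" "\<lambda>t. BP m n t v" "hi m v n"]
    Bmat_nonneg[OF assms(2)] Bmat_stochastic[OF assms(2)] BP_between
  by (simp add: BP_Suc[OF assms(1)])

lemma hi_mono: "m \<le> n \<Longrightarrow> hi m v (Suc n) \<le> hi m v n"
  using hi_attained[of "Suc n" m v] BP_Suc_between by metis

lemma lo_mono: "m \<le> n \<Longrightarrow> lo m v n \<le> lo m v (Suc n)"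
  using lo_attained[of "Suc n" m v] BP_Suc_between by metis

lemma lo_nonneg: "m \<le> n \<Longrightarrow> 0 \<le> lo m v n"
  using lo_attained[of n m v] BP_nonneg by metis

lemma hi_le_1: "m \<le> n \<Longrightarrow> v \<in> verts G m \<Longrightarrow> hi m v n \<le> 1"
  using hi_attained[of n m v] BP_le_1 by metis

lemma lo_le_hi: "lo m v n \<le> hi m v n"
  using verts_nonempty[of n] BP_between by (meson ex_in_conv order_trans)

text \<open>Since the whole sequence \<open>x\<close> converges, the subsequence chosen by
  compactness keeps its limit, so the extracted point takes exactly the value
  \<open>l\<close>.\<close>

lemma extremal_consistent:
  assumes v: "v \<in> verts G m" and att: "\<And>n. \<exists>w\<in>verts G n. BP m n w v = x n" and lim: "x \<longlonglongrightarrow> l"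
  shows "\<exists>p. consistent p \<and> p m v = l"
proof -
  obtain w where w: "\<And>n. w n \<in> verts G n" "\<And>n. BP m n (w n) v = x n"
    using att by metis
  obtain r p where r: "strict_mono r" and p: "consistent p" and conv: "\<And>k v. v \<in> verts G k \<Longrightarrow> (\<lambda>j. BP k (r j) (w (r j)) v) \<longlonglongrightarrow> p k v"
    using consistent_limit[of w] w(1) by blast
  have "(\<lambda>j. x (r j)) \<longlonglongrightarrow> p m v"
    using conv[OF v] w(2) by simp
  moreover have "(\<lambda>j. x (r j)) \<longlonglongrightarrow> l"
    using LIMSEQ_subseq_LIMSEQ[OF lim r] by (simp add: comp_def)
  ultimately have "p m v = l" by (rule LIMSEQ_unique)
  then show ?thesis using p by blast
qed

lemma unique_imp_variation:
  assumes uniq: "\<And>p q n v. consistent p \<Longrightarrow> consistent q \<Longrightarrow> v \<in> verts G n \<Longrightarrow> p n v = q n v"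
    and v: "v \<in> verts G m"
  shows "(\<lambda>n. hi m v n - lo m v n) \<longlonglongrightarrow> 0"
proof -
  \<comment> \<open>Monotonicity starts at level \<open>m\<close>, below which the products have no
    meaning, hence the shift by \<open>m\<close>.\<close>
  have "decseq (\<lambda>k. hi m v (k + m))"
    by (rule decseq_SucI) (simp add: hi_mono)
  then obtain a where "(\<lambda>k. hi m v (k + m)) \<longlonglongrightarrow> a"
    using decseq_convergent[of "\<lambda>k. hi m v (k + m)" 0] lo_nonneg lo_le_hi by (metis le_add2 order_trans)
  then have a: "hi m v \<longlonglongrightarrow> a" by (rule LIMSEQ_offset)
  have "incseq (\<lambda>k. lo m v (k + m))"
    by (rule incseq_SucI) (simp add: lo_mono)
  then obtain b where "(\<lambda>k. lo m v (k + m)) \<longlonglongrightarrow> b"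
    using incseq_convergent[of "\<lambda>k. lo m v (k + m)" 1] hi_le_1[OF _ v] lo_le_hi by (metis le_add2 order_trans)
  then have b: "lo m v \<longlonglongrightarrow> b" by (rule LIMSEQ_offset)
  obtain p where p: "consistent p" "p m v = a"
    using extremal_consistent[OF v hi_attained a] by blast
  obtain q where q: "consistent q" "q m v = b"
    using extremal_consistent[OF v lo_attained b] by blast
  have "a = b" using uniq[OF p(1) q(1) v] p(2) q(2) by simp
  then show ?thesis using tendsto_diff[OF a b] by simp
qed

text \<open>\<open>p m v\<close> is the average of the column of \<open>v\<close> with weights
  \<open>p n\<close>.\<close>

lemma consistent_between:
  assumes p: "consistent p" and "m \<le> n" "v \<in> verts G m"
  shows "lo m v n \<le> p m v \<and> p m v \<le> hi m v n"
  using weighted_average_bounds[of "verts G n" "p n" 1 "lo m v n" "\<lambda>w. BP m n w v" "hi m v n"]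
    consistentD(1,3)[OF p] BP_between consistent_BP[OF assms] by auto

lemma variation_imp_unique:
  assumes var: "(\<lambda>n. hi m v n - lo m v n) \<longlonglongrightarrow> 0" and v: "v \<in> verts G m"
    and p: "consistent p" and q: "consistent q"
  shows "p m v = q m v"
proof -
  have "\<bar>p m v - q m v\<bar> \<le> 0"
  proof (rule tendsto_lowerbound[OF var])
    show "eventually (\<lambda>n. \<bar>p m v - q m v\<bar> \<le> hi m v n - lo m v n) sequentially"
      using eventually_ge_at_top[of m]
    proof eventually_elim
      case (elim n)
      then show ?case
        using consistent_between[OF p elim v] consistent_between[OF q elim v] by linarith
    qed
  qed simp
  then show ?thesis by simp
qed

lemma SD_unique_iff_variation:
  "(\<exists>!\<mu>. \<mu> \<in> SD G D) \<longleftrightarrow> (\<forall>m. \<forall>v\<in>verts G m. (\<lambda>n. hi m v n - lo m v n) \<longlonglongrightarrow> 0)"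
  unfolding SD_unique_iff
  using consistent_exists unique_imp_variation variation_imp_unique by meson

text \<open>The largest entry is positive because some edge exists, so the ratio is an honest
  quotient.\<close>

lemma entry_ratio_bound:
  obtains a b where "0 \<le> a" "0 < b" "entry_ratio G \<Phi> (Suc n) = a / b"
    "\<And>w v. w \<in> verts G (Suc n) \<Longrightarrow> v \<in> verts G n \<Longrightarrow> a \<le> A (Suc n) w v \<and> A (Suc n) w v \<le> b"
proof -
  define E where "E = (\<lambda>(w, v). A (Suc n) w v) ` (verts G (Suc n) \<times> verts G n)"
  have fin: "finite E" by (simp add: E_def finite_verts)
  have ne: "E \<noteq> {}" using verts_nonempty by (auto simp: E_def)
  have mem: "A (Suc n) w v \<in> E" if "w \<in> verts G (Suc n)" "v \<in> verts G n" for w v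
    using that by (force simp: E_def)
  have "Min E \<in> E" using fin ne by simp
  then have "0 \<le> Min E" using Amat_nonneg by (force simp: E_def)
  moreover have "0 < Max E"
  proof -
    obtain v where "v \<in> verts G n" using verts_nonempty by blast
    then obtain e where e: "e \<in> edges G (Suc n)" using edge_from by blast
    have "0 < A (Suc n) (rng G e) (src G e)" using Amat_edge_pos[OF e] .
    also have "\<dots> \<le> Max E" using mem[OF edge_rng[OF e] edge_src[OF e]] fin by simp
    finally show ?thesis .
  qed
  moreover have "entry_ratio G \<Phi> (Suc n) = Min E / Max E"
    by (simp add: entry_ratio_def E_def Let_def)
  ultimately show ?thesis
    using mem fin by (intro that[of "Min E" "Max E"]) auto
qed

text \<open>Doeblin's condition: each row of \<^term>\<open>B (Suc n)\<close> dominates the entry ratio times one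
  and the same probability vector, so this part cancels in the difference of two rows.\<close>

lemma variation_contraction:
  assumes "m \<le> n"
  shows "hi m v (Suc n) - lo m v (Suc n) \<le> (1 - entry_ratio G \<Phi> (Suc n)) * (hi m v n - lo m v n)"
proof -
  let ?\<epsilon> = "entry_ratio G \<Phi> (Suc n)"
  obtain a b where ab: "0 \<le> a" "0 < b" "?\<epsilon> = a / b"
    and Aab: "\<And>w v. w \<in> verts G (Suc n) \<Longrightarrow> v \<in> verts G n \<Longrightarrow> a \<le> A (Suc n) w v \<and> A (Suc n) w v \<le> b"
    using entry_ratio_bound[of n] by metis
  define U where "U = (\<Sum>t\<in>verts G n. u n t)"
  \<comment> \<open>The common probability vector is \<open>u n\<close> normalised. Entries at most
    \<open>b\<close> give \<open>u (Suc n) w \<le> b * U\<close>, and entries at least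
    \<open>a\<close> then leave the share \<open>a / b\<close> of \<open>\<pi>\<close> in every
    row.\<close>
  define \<pi> where "\<pi> t = u n t / U" for t
  have U: "0 < U"
    unfolding U_def using uvec_pos finite_verts verts_nonempty by (intro sum_pos) auto
  have \<pi>1: "(\<Sum>t\<in>verts G n. \<pi> t) = 1"
    using U by (simp add: \<pi>_def sum_divide_distrib[symmetric] U_def[symmetric])
  have dom: "?\<epsilon> * \<pi> t \<le> B (Suc n) w t" if w: "w \<in> verts G (Suc n)" and t: "t \<in> verts G n" for w t
  proof -
    have "u (Suc n) w \<le> b * U"
      unfolding uvec_Suc U_def sum_distrib_left
      using Aab[OF w] uvec_pos by (intro sum_mono mult_right_mono) (auto intro: less_imp_le)
    then have "(a * u n t) / (b * U) \<le> (A (Suc n) w t * u n t) / u (Suc n) w"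
      using Aab[OF w t] uvec_pos[OF w] uvec_pos[OF t] ab by (intro frac_le mult_right_mono) auto
    then show ?thesis by (simp add: ab \<pi>_def Bmat_Suc)
  qed
  \<comment> \<open>The contribution of the common part, the same for every row \<open>w\<close>; it
    cancels between the rows attaining the maximum and the minimum.\<close>
  define s where "s = (\<Sum>t\<in>verts G n. ?\<epsilon> * \<pi> t * BP m n t v)"
  have row: "(1 - ?\<epsilon>) * lo m v n \<le> BP m (Suc n) w v - s \<and> BP m (Suc n) w v - s \<le> (1 - ?\<epsilon>) * hi m v n"
    if w: "w \<in> verts G (Suc n)" for w
  proof -
    have eq: "BP m (Suc n) w v - s = (\<Sum>t\<in>verts G n. (B (Suc n) w t - ?\<epsilon> * \<pi> t) * BP m n t v)"
      by (simp add: BP_Suc[OF assms] s_def sum_subtractf[symmetric] left_diff_distrib)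
    have "(\<Sum>t\<in>verts G n. B (Suc n) w t - ?\<epsilon> * \<pi> t) = 1 - ?\<epsilon>"
      by (simp add: sum_subtractf Bmat_stochastic[OF w] sum_distrib_left[symmetric] \<pi>1)
    then show ?thesis
      unfolding eq using weighted_average_bounds[of "verts G n" "\<lambda>t. B (Suc n) w t - ?\<epsilon> * \<pi> t" "1 - ?\<epsilon>" "lo m v n" "\<lambda>t. BP m n t v" "hi m v n"]
        dom[OF w] BP_between by simp
  qed
  obtain w1 where w1: "w1 \<in> verts G (Suc n)" "BP m (Suc n) w1 v = hi m v (Suc n)" using hi_attained by blast
  obtain w2 where w2: "w2 \<in> verts G (Suc n)" "BP m (Suc n) w2 v = lo m v (Suc n)" using lo_attained by blast
  show ?thesis
    using row[OF w1(1)] row[OF w2(1)] unfolding w1(2) w2(2) by (simp add: right_diff_distrib)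
qed

text \<open>By \<open>1 - x \<le> exp (- x)\<close>, the product of the contraction factors is at
  most the exponential of minus a block of the divergent series. The blocks start at
  \<open>m\<close>, where the products begin.\<close>

lemma entry_ratio_divergent_variation:
  assumes div: "filterlim (\<lambda>N. \<Sum>n=1..N. entry_ratio G \<Phi> n) at_top sequentially" and v: "v \<in> verts G m"
  shows "(\<lambda>n. hi m v n - lo m v n) \<longlonglongrightarrow> 0"
proof -
  let ?\<epsilon> = "entry_ratio G \<Phi>"
  let ?S = "\<lambda>N. \<Sum>n=1..N. ?\<epsilon> n"
  have bound: "hi m v n - lo m v n \<le> exp (?S m - ?S n) * (hi m v m - lo m v m)" if "m \<le> n" for n
    using that
  proof (induction n rule: dec_induct)
    case (step n)
    have "1 - ?\<epsilon> (Suc n) \<le> exp (- ?\<epsilon> (Suc n))"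
      using exp_ge_add_one_self[of "- ?\<epsilon> (Suc n)"] by simp
    then have "hi m v (Suc n) - lo m v (Suc n) \<le> exp (- ?\<epsilon> (Suc n)) * (hi m v n - lo m v n)"
      using variation_contraction[OF step.hyps(1), of v] lo_le_hi[of m v n]
      by (meson diff_ge_0_iff_ge mult_right_mono order_trans)
    also have "\<dots> \<le> exp (- ?\<epsilon> (Suc n)) * (exp (?S m - ?S n) * (hi m v m - lo m v m))"
      using step.IH by (intro mult_left_mono) auto
    also have "\<dots> = exp (?S m - ?S (Suc n)) * (hi m v m - lo m v m)"
      by (simp add: mult.assoc[symmetric] exp_add[symmetric])
    finally show ?case .
  qed simp
  have "filterlim (\<lambda>n. - ?S m + ?S n) at_top sequentially"
    by (rule filterlim_tendsto_add_at_top[OF tendsto_const div])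
  then have "filterlim (\<lambda>n. ?S m - ?S n) at_bot sequentially"
    unfolding filterlim_uminus_at_top by simp
  then have "(\<lambda>n. exp (?S m - ?S n)) \<longlonglongrightarrow> 0"
    by (rule filterlim_compose[OF exp_at_bot])
  then have lim: "(\<lambda>n. exp (?S m - ?S n) * (hi m v m - lo m v m)) \<longlonglongrightarrow> 0"
    by (rule tendsto_mult_left_zero)
  have upper: "eventually (\<lambda>n. hi m v n - lo m v n \<le> exp (?S m - ?S n) * (hi m v m - lo m v m)) sequentially"
    using bound by (rule eventually_sequentiallyI)
  have lower: "eventually (\<lambda>n. 0 \<le> hi m v n - lo m v n) sequentially"
    by (simp add: lo_le_hi)
  show ?thesis
    by (rule tendsto_sandwich[OF lower upper tendsto_const lim])
qed

end

theorem corollary4p3: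
  fixes G :: "('v, 'e) bratteli" and \<Phi> :: "'e \<Rightarrow> real"
    and D :: "(nat \<Rightarrow> 'e) \<times> (nat \<Rightarrow> 'e) \<Rightarrow> real"
  assumes "bratteli_diagram G"
    and "\<forall>n\<ge>1. \<forall>e\<in>edges G n. \<Phi> e > 0"
    and "D \<in> cocycles G"
    and "\<forall>p\<in>tail_rel G. D p = quasi_product \<Phi> p"
  shows "((\<exists>!\<mu>. \<mu> \<in> SD G D) \<longleftrightarrow>
            (\<forall>m. \<forall>v\<in>verts G m.
               (\<lambda>n. variation_on (verts G n) (\<lambda>w. mat_prod G (Bmat G \<Phi>) m n w v)) \<longlonglongrightarrow> 0))
       \<and> (filterlim (\<lambda>N. \<Sum>n=1..N. entry_ratio G \<Phi> n) at_top sequentially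
            \<longrightarrow> (\<exists>!\<mu>. \<mu> \<in> SD G D))"
proof -
  interpret weighted_bratteli G \<Phi> D
    using assms by (unfold_locales) auto
  show ?thesis
    unfolding variation_BP SD_unique_iff_variation
    using entry_ratio_divergent_variation by blast
qed

end
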